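(* Assume that $\mu \in \mathfrak{M}_x(\mathcal{G})$ is definable, invariantly supported, idempotent and minimal, and let $G\prec\mathcal{G}$ be a small model such that $\mu$ is definable over $G$. Let $\varphi(x;\bar{b}) \in \mathcal{L}_{x}(\mathcal{G})$, where $\bar b$ is the tuple of parameters of the formula. Then, for any $a \in \mathcal{G}$ such that $\mathrm{tp}(a/G\bar{b}) \in S(\mu|_{G\bar{b}})$, we have $\mu(\varphi(x;\bar b)) = \mu(\varphi(x \cdot a;\bar b))$.
   Context: Setting: $T$ is a first-order theory in a language $\mathcal{L}$ expanding a group, $\mathcal{G}$ is a sufficiently saturated (monster) model of $T$, and "small" means small relative to the saturation of $\mathcal{G}$. The variable $x$ (and $y$ in convolutions) is a singleton variable of the sort on which the group is defined. Keisler measures: for $A\subseteq\mathcal{G}$, $\mathcal{L}_x(A)$ is the Boolean algebra of formulas in $x$ with parameters from $A$ (up to equivalence), $S_x(A)$ is the space of types over $A$, and $\mathfrak{M}_x(A)$ is the set of Keisler measures over $A$, i.e. finitely additive probability measures on $\mathcal{L}_x(A)$; each is identified with the corresponding regular Borel probability measure on $S_x(A)$. $\mu|_A$ denotes restriction. The support of $\mu\in\mathfrak{M}_x(A)$ is $S(\mu)=\{p\in S_x(A):\mu(\varphi(x))>0 \text{ for all }\varphi(x)\in p\}$. $\mu\in\mathfrak{M}_x(\mathcal{G})$ is definable over a small $M\prec\mathcal{G}$ if for every $\mathcal{L}(M)$-formula $\varphi(x;y)$ ($y$ any finite tuple of variables), $\mu(\varphi(x;b))$ depends only on $\mathrm{tp}(b/M)$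 and the map $S_y(M)\to[0,1]$, $\mathrm{tp}(b/M)\mapsto\mu(\varphi(x;b))$ is continuous; $\mu$ is definable if it is definable over some small $M$. $\mu$ is invariantly supported if there is a small $M\prec\mathcal{G}$ such that every $p\in S(\mu)$ is $M$-invariant. Convolution: for $\mu,\nu\in\mathfrak{M}_x(\mathcal{G})$ let $\nu_y$ be $\nu$ viewed as a measure in the variable $y$. The pair $(\mu,\nu)$ is $*$-Borel if for every $\varphi(x,\bar c)\in\mathcal{L}_x(\mathcal{G})$ there is a small $N\prec\mathcal{G}$ containing $\bar c$ such that for every $q\in S(\nu_y|_N)$ the value $F(q):=\mu(\varphi(x\cdot d,\bar c))$ is the same for all $d\models q$ in $\mathcal{G}$, and $F:S(\nu_y|_N)\to[0,1]$ is Borel. Then $(\mu*\nu)(\varphi(x,\bar c)):=\int_{S(\nu_y|_N)}F\,d\nu_N$, where $\nu_N$ is the Borel measure $\nu_y|_N$ restricted to its support (this does not depend on $N$). $\mu$ is idempotent if $(\mu,\mu)$ is $*$-Borel and $\mu*\mu=\mu$. Product of types: if $p,q\in S_x(\mathcal{G})$ are invariant over a small model $M$, then $p*q:=\mathrm{tp}(a\cdot b/\mathcal{G})$, where (in a larger monster model) $b\models q$ and $a$ realizes the restriction to $\mathcal{G}b$ of the unique $M$-invariant extension of $p$. For $\mu$ definable, invariantly supported and idempotent, $(S(\mu),* )$ is a compact Hausdorff left-continuous semigroup (each map $-*q$ is continuous), hence has a minimal left ideal $I_\mu$ (automatically closed). Such $\mu$ is called minimal if $I_\mu=S(\mu)$,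 i.e. $S(\mu)$ has no proper (closed) left ideals. *)

theory Defs
  imports "HOL-Probability.Probability" "HOL-Algebra.Group"
begin

unbundle cardinal_syntax

text \<open>Many-sorted first-order languages and structures. The sorts are the elements of the type
  \<open>'s\<close>, and a variable \<open>(s, n)\<close> has sort \<open>s\<close>. Terms may contain parameters \<open>Par u\<close>, so that
  formulas over a parameter set \<open>A\<close> are the formulas all of whose parameters lie in \<open>A\<close>, and
  formulas of the language itself are those without parameters.\<close>

record ('s, 'f, 'r) lang =
  funs :: "'f set"
  fun_dom :: "'f \<Rightarrow> 's list"
  fun_cod :: "'f \<Rightarrow> 's"
  rels :: "'r set"
  rel_dom :: "'r \<Rightarrow> 's list"

record ('s, 'f, 'r, 'u) struc =
  univ :: "'s \<Rightarrow> 'u set"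
  fun_int :: "'f \<Rightarrow> 'u list \<Rightarrow> 'u"
  rel_int :: "'r \<Rightarrow> 'u list \<Rightarrow> bool"

type_synonym 's var = "'s \<times> nat"

datatype ('s, 'f, 'u) tm =
    Var "'s var"
  | Par 'u
  | App 'f "('s, 'f, 'u) tm list"

datatype ('s, 'f, 'r, 'u) form =
    Eq "('s, 'f, 'u) tm" "('s, 'f, 'u) tm"
  | Rel 'r "('s, 'f, 'u) tm list"
  | Neg "('s, 'f, 'r, 'u) form"
  | Conj "('s, 'f, 'r, 'u) form" "('s, 'f, 'r, 'u) form"
  | All "'s var" "('s, 'f, 'r, 'u) form"

abbreviation Disj :: "('s, 'f, 'r, 'u) form \<Rightarrow> ('s, 'f, 'r, 'u) form \<Rightarrow> ('s, 'f, 'r, 'u) form" where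
  "Disj \<phi> \<psi> \<equiv> Neg (Conj (Neg \<phi>) (Neg \<psi>))"

definition points :: "('s, 'f, 'r, 'u) struc \<Rightarrow> 'u set" where
  "points M = (\<Union>s. univ M s)"

text \<open>The universes of different sorts are disjoint, so a parameter determines its sort.\<close>

definition is_struc :: "('s, 'f, 'r) lang \<Rightarrow> ('s, 'f, 'r, 'u) struc \<Rightarrow> bool" where
  "is_struc L M \<longleftrightarrow>
     (\<forall>s. univ M s \<noteq> {}) \<and>
     (\<forall>s t. s \<noteq> t \<longrightarrow> univ M s \<inter> univ M t = {}) \<and>
     (\<forall>f\<in>funs L. \<forall>us. list_all2 (\<lambda>u s. u \<in> univ M s) us (fun_dom L f) \<longrightarrow>
        fun_int M f us \<in> univ M (fun_cod L f))"

inductive has_sort ::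
  "('s, 'f, 'r) lang \<Rightarrow> ('s, 'f, 'r, 'u) struc \<Rightarrow> ('s, 'f, 'u) tm \<Rightarrow> 's \<Rightarrow> bool"
  for L M where
  "has_sort L M (Var v) (fst v)"
| "u \<in> univ M s \<Longrightarrow> has_sort L M (Par u) s"
| "f \<in> funs L \<Longrightarrow> list_all2 (has_sort L M) ts (fun_dom L f) \<Longrightarrow>
     has_sort L M (App f ts) (fun_cod L f)"

primrec wf_form ::
  "('s, 'f, 'r) lang \<Rightarrow> ('s, 'f, 'r, 'u) struc \<Rightarrow> ('s, 'f, 'r, 'u) form \<Rightarrow> bool" where
  "wf_form L M (Eq t u) \<longleftrightarrow> (\<exists>s. has_sort L M t s \<and> has_sort L M u s)"
| "wf_form L M (Rel r ts) \<longleftrightarrow> r \<in> rels L \<and> list_all2 (has_sort L M) ts (rel_dom L r)"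
| "wf_form L M (Neg \<phi>) \<longleftrightarrow> wf_form L M \<phi>"
| "wf_form L M (Conj \<phi> \<psi>) \<longleftrightarrow> wf_form L M \<phi> \<and> wf_form L M \<psi>"
| "wf_form L M (All v \<phi>) \<longleftrightarrow> wf_form L M \<phi>"

primrec tm_vars :: "('s, 'f, 'u) tm \<Rightarrow> 's var set" where
  "tm_vars (Var v) = {v}"
| "tm_vars (Par u) = {}"
| "tm_vars (App f ts) = \<Union> (set (map tm_vars ts))"

primrec fv :: "('s, 'f, 'r, 'u) form \<Rightarrow> 's var set" where
  "fv (Eq t u) = tm_vars t \<union> tm_vars u"
| "fv (Rel r ts) = (\<Union>t\<in>set ts. tm_vars t)"
| "fv (Neg \<phi>) = fv \<phi>"
| "fv (Conj \<phi> \<psi>) = fv \<phi> \<union> fv \<psi>"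
| "fv (All v \<phi>) = fv \<phi> - {v}"

primrec tm_params :: "('s, 'f, 'u) tm \<Rightarrow> 'u set" where
  "tm_params (Var v) = {}"
| "tm_params (Par u) = {u}"
| "tm_params (App f ts) = \<Union> (set (map tm_params ts))"

primrec params :: "('s, 'f, 'r, 'u) form \<Rightarrow> 'u set" where
  "params (Eq t u) = tm_params t \<union> tm_params u"
| "params (Rel r ts) = (\<Union>t\<in>set ts. tm_params t)"
| "params (Neg \<phi>) = params \<phi>"
| "params (Conj \<phi> \<psi>) = params \<phi> \<union> params \<psi>"
| "params (All v \<phi>) = params \<phi>"

primrec tm_subst :: "('s var \<Rightarrow> ('s, 'f, 'u) tm) \<Rightarrow> ('s, 'f, 'u) tm \<Rightarrow> ('s, 'f, 'u) tm" where
  "tm_subst \<sigma> (Var v) = \<sigma> v"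
| "tm_subst \<sigma> (Par u) = Par u"
| "tm_subst \<sigma> (App f ts) = App f (map (tm_subst \<sigma>) ts)"

text \<open>Bound variables are not renamed. In the two substitutions below this is harmless: either
  variables are replaced by parameters, or a variable \<open>x\<close> is replaced by a term whose only variable
  is \<open>x\<close>, and a free occurrence of \<open>x\<close> is never in the scope of a quantifier over \<open>x\<close>.\<close>

primrec subst ::
  "('s var \<Rightarrow> ('s, 'f, 'u) tm) \<Rightarrow> ('s, 'f, 'r, 'u) form \<Rightarrow> ('s, 'f, 'r, 'u) form" where
  "subst \<sigma> (Eq t u) = Eq (tm_subst \<sigma> t) (tm_subst \<sigma> u)"
| "subst \<sigma> (Rel r ts) = Rel r (map (tm_subst \<sigma>) ts)"
| "subst \<sigma> (Neg \<phi>) = Neg (subst \<sigma> \<phi>)"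
| "subst \<sigma> (Conj \<phi> \<psi>) = Conj (subst \<sigma> \<phi>) (subst \<sigma> \<psi>)"
| "subst \<sigma> (All v \<phi>) = All v (subst (\<sigma>(v := Var v)) \<phi>)"

text \<open>\<open>plug Y b \<phi>\<close> is \<open>\<phi>(x; b)\<close> for a formula \<open>\<phi>(x; y)\<close>, where \<open>Y\<close> is the set of variables in the
  tuple \<open>y\<close>, and \<open>rshift m x d \<phi>\<close> is \<open>\<phi>(x \<cdot> d)\<close>, where \<open>m\<close> is the symbol for the group operation.\<close>

definition plug ::
  "'s var set \<Rightarrow> ('s var \<Rightarrow> 'u) \<Rightarrow> ('s, 'f, 'r, 'u) form \<Rightarrow> ('s, 'f, 'r, 'u) form" where
  "plug Y b \<phi> = subst (\<lambda>v. if v \<in> Y then Par (b v) else Var v) \<phi>"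

definition rshift ::
  "'f \<Rightarrow> 's var \<Rightarrow> 'u \<Rightarrow> ('s, 'f, 'r, 'u) form \<Rightarrow> ('s, 'f, 'r, 'u) form" where
  "rshift m x d \<phi> = subst (Var(x := App m [Var x, Par d])) \<phi>"

primrec tm_val ::
  "('s, 'f, 'r, 'u) struc \<Rightarrow> ('s var \<Rightarrow> 'u) \<Rightarrow> ('s, 'f, 'u) tm \<Rightarrow> 'u" where
  "tm_val M e (Var v) = e v"
| "tm_val M e (Par u) = u"
| "tm_val M e (App f ts) = fun_int M f (map (tm_val M e) ts)"

primrec sat ::
  "('s, 'f, 'r, 'u) struc \<Rightarrow> ('s var \<Rightarrow> 'u) \<Rightarrow> ('s, 'f, 'r, 'u) form \<Rightarrow> bool" where
  "sat M e (Eq t u) \<longleftrightarrow> tm_val M e t = tm_val M e u"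
| "sat M e (Rel r ts) \<longleftrightarrow> rel_int M r (map (tm_val M e) ts)"
| "sat M e (Neg \<phi>) \<longleftrightarrow> \<not> sat M e \<phi>"
| "sat M e (Conj \<phi> \<psi>) \<longleftrightarrow> sat M e \<phi> \<and> sat M e \<psi>"
| "sat M e (All v \<phi>) \<longleftrightarrow> (\<forall>u\<in>univ M (fst v). sat M (e(v := u)) \<phi>)"

definition vals :: "('s, 'f, 'r, 'u) struc \<Rightarrow> ('s var \<Rightarrow> 'u) set" where
  "vals M = {e. \<forall>v. e v \<in> univ M (fst v)}"

text \<open>\<open>forms L M V A\<close> is the set of formulas with free variables in \<open>V\<close> and parameters in
  \<open>A \<subseteq> points M\<close>; the structure \<open>M\<close> serves only to give the parameters their sorts.\<close>

definition forms ::
  "('s, 'f, 'r) lang \<Rightarrow> ('s, 'f, 'r, 'u) struc \<Rightarrow> 's var set \<Rightarrow> 'u set \<Rightarrow>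
     ('s, 'f, 'r, 'u) form set" where
  "forms L M V A = {\<phi>. wf_form L M \<phi> \<and> fv \<phi> \<subseteq> V \<and> params \<phi> \<subseteq> A}"

definition elem_sub ::
  "('s, 'f, 'r) lang \<Rightarrow> ('s, 'f, 'r, 'u) struc \<Rightarrow> ('s, 'f, 'r, 'u) struc \<Rightarrow> bool" where
  "elem_sub L M N \<longleftrightarrow>
     is_struc L M \<and> is_struc L N \<and> (\<forall>s. univ M s \<subseteq> univ N s) \<and>
     (\<forall>\<phi>\<in>forms L M UNIV {}. \<forall>e\<in>vals M. sat M e \<phi> \<longleftrightarrow> sat N e \<phi>)"

definition induced :: "('s, 'f, 'r, 'u) struc \<Rightarrow> 'u set \<Rightarrow> ('s, 'f, 'r, 'u) struc" where
  "induced M A = M\<lparr>univ := \<lambda>s. univ M s \<inter> A\<rparr>"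

definition small_model ::
  "'k rel \<Rightarrow> ('s, 'f, 'r) lang \<Rightarrow> ('s, 'f, 'r, 'u) struc \<Rightarrow> 'u set \<Rightarrow> bool" where
  "small_model \<kappa> L M A \<longleftrightarrow> A \<subseteq> points M \<and> |A| <o \<kappa> \<and> elem_sub L (induced M A) M"

text \<open>\<open>types L M V A\<close> is the space \<open>S\<^sub>V(A)\<close>; \<open>tp L M V A e\<close> is the type over \<open>A\<close> of the tuple
  \<open>(e v)\<^sub>v\<close> with \<open>v \<in> V\<close>. Only the values of \<open>e\<close> on \<open>V\<close> matter.\<close>

definition types ::
  "('s, 'f, 'r) lang \<Rightarrow> ('s, 'f, 'r, 'u) struc \<Rightarrow> 's var set \<Rightarrow> 'u set \<Rightarrow>
     ('s, 'f, 'r, 'u) form set set" where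
  "types L M V A = {p. p \<subseteq> forms L M V A \<and>
     (\<forall>\<phi>\<in>forms L M V A. \<phi> \<in> p \<or> Neg \<phi> \<in> p) \<and>
     (\<forall>F. F \<subseteq> p \<and> finite F \<longrightarrow> (\<exists>e\<in>vals M. \<forall>\<phi>\<in>F. sat M e \<phi>))}"

definition tp ::
  "('s, 'f, 'r) lang \<Rightarrow> ('s, 'f, 'r, 'u) struc \<Rightarrow> 's var set \<Rightarrow> 'u set \<Rightarrow> ('s var \<Rightarrow> 'u) \<Rightarrow>
     ('s, 'f, 'r, 'u) form set" where
  "tp L M V A e = {\<phi> \<in> forms L M V A. sat M e \<phi>}"

abbreviation tp1 ::
  "('s, 'f, 'r) lang \<Rightarrow> ('s, 'f, 'r, 'u) struc \<Rightarrow> 's var \<Rightarrow> 'u set \<Rightarrow> 'u \<Rightarrow>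
     ('s, 'f, 'r, 'u) form set" where
  "tp1 L M x A a \<equiv> tp L M {x} A (\<lambda>_. a)"

definition saturated ::
  "'k rel \<Rightarrow> ('s, 'f, 'r) lang \<Rightarrow> ('s, 'f, 'r, 'u) struc \<Rightarrow> bool" where
  "saturated \<kappa> L M \<longleftrightarrow>
     (\<forall>A v. A \<subseteq> points M \<and> |A| <o \<kappa> \<longrightarrow>
        (\<forall>p\<in>types L M {v} A. \<exists>a\<in>univ M (fst v). tp1 L M v A a = p))"

text \<open>A monster model: \<open>\<kappa>\<close>-saturated, where \<open>\<kappa>\<close> is a cardinal above the (always infinite) number of
  formulas of the language. Small means of cardinality less than \<open>\<kappa>\<close>.\<close>

definition monster ::
  "'k rel \<Rightarrow> ('s, 'f, 'r) lang \<Rightarrow> ('s, 'f, 'r, 'u) struc \<Rightarrow> bool" where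
  "monster \<kappa> L M \<longleftrightarrow>
     is_struc L M \<and> Card_order \<kappa> \<and> |forms L M UNIV {}| <o \<kappa> \<and> saturated \<kappa> L M"

definition expands_group ::
  "('s, 'f, 'r) lang \<Rightarrow> 'f \<Rightarrow> 's \<Rightarrow> ('s, 'f, 'r, 'u) struc \<Rightarrow> bool" where
  "expands_group L m g M \<longleftrightarrow>
     m \<in> funs L \<and> fun_dom L m = [g, g] \<and> fun_cod L m = g \<and>
     (\<exists>e. group \<lparr>carrier = univ M g, mult = (\<lambda>a b. fun_int M m [a, b]), one = e\<rparr>)"

definition models ::
  "('s, 'f, 'r, 'u) struc \<Rightarrow> ('s, 'f, 'r, 'u) form set \<Rightarrow> bool" where
  "models M T \<longleftrightarrow> (\<forall>\<phi>\<in>T. \<forall>e\<in>vals M. sat M e \<phi>)"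

definition type_space ::
  "('s, 'f, 'r) lang \<Rightarrow> ('s, 'f, 'r, 'u) struc \<Rightarrow> 's var set \<Rightarrow> 'u set \<Rightarrow>
     ('s, 'f, 'r, 'u) form set topology" where
  "type_space L M V A =
     topology_generated_by ((\<lambda>\<phi>. {p \<in> types L M V A. \<phi> \<in> p}) ` forms L M V A)"

definition borel_of :: "'a topology \<Rightarrow> 'a measure" where
  "borel_of X = sigma (topspace X) {U. openin X U}"

text \<open>Regularity is stated for compact Hausdorff spaces, where closed and compact sets agree.\<close>

definition regular_borel_prob :: "'a topology \<Rightarrow> 'a measure \<Rightarrow> bool" where
  "regular_borel_prob X P \<longleftrightarrow>
     prob_space P \<and> space P = topspace X \<and> sets P = sets (borel_of X) \<and>
     (\<forall>B\<in>sets P. \<forall>\<epsilon>>0. \<exists>C U. closedin X C \<and> openin X U \<and> C \<subseteq> B \<and> B \<subseteq> U \<and>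
        measure P (U - C) < \<epsilon>)"

text \<open>A Keisler measure is a function on formulas that respects equivalence. Only its values on
  \<open>forms L M {x} A\<close> are meaningful, so the restriction of a measure over \<open>A\<close> to \<open>B \<subseteq> A\<close> is the same
  function considered over \<open>B\<close>.\<close>

definition keisler_measure ::
  "('s, 'f, 'r) lang \<Rightarrow> ('s, 'f, 'r, 'u) struc \<Rightarrow> 's var \<Rightarrow> 'u set \<Rightarrow>
     (('s, 'f, 'r, 'u) form \<Rightarrow> real) \<Rightarrow> bool" where
  "keisler_measure L M x A \<mu> \<longleftrightarrow>
     (\<forall>\<phi>\<in>forms L M {x} A. 0 \<le> \<mu> \<phi>) \<and>
     (\<forall>\<phi>\<in>forms L M {x} A. (\<forall>e\<in>vals M. sat M e \<phi>) \<longrightarrow> \<mu> \<phi> = 1) \<and>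
     (\<forall>\<phi>\<in>forms L M {x} A. \<forall>\<psi>\<in>forms L M {x} A.
        (\<forall>e\<in>vals M. sat M e \<phi> \<longleftrightarrow> sat M e \<psi>) \<longrightarrow> \<mu> \<phi> = \<mu> \<psi>) \<and>
     (\<forall>\<phi>\<in>forms L M {x} A. \<forall>\<psi>\<in>forms L M {x} A.
        (\<forall>e\<in>vals M. \<not> (sat M e \<phi> \<and> sat M e \<psi>)) \<longrightarrow> \<mu> (Disj \<phi> \<psi>) = \<mu> \<phi> + \<mu> \<psi>)"

text \<open>\<open>supp L M x A \<mu>\<close> is \<open>S(\<mu>|\<^sub>A)\<close>.\<close>

definition supp ::
  "('s, 'f, 'r) lang \<Rightarrow> ('s, 'f, 'r, 'u) struc \<Rightarrow> 's var \<Rightarrow> 'u set \<Rightarrow>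
     (('s, 'f, 'r, 'u) form \<Rightarrow> real) \<Rightarrow> ('s, 'f, 'r, 'u) form set set" where
  "supp L M x A \<mu> = {p \<in> types L M {x} A. \<forall>\<phi>\<in>p. 0 < \<mu> \<phi>}"

definition corresponds ::
  "('s, 'f, 'r) lang \<Rightarrow> ('s, 'f, 'r, 'u) struc \<Rightarrow> 's var \<Rightarrow> 'u set \<Rightarrow>
     (('s, 'f, 'r, 'u) form \<Rightarrow> real) \<Rightarrow> ('s, 'f, 'r, 'u) form set measure \<Rightarrow> bool" where
  "corresponds L M x A \<mu> P \<longleftrightarrow>
     regular_borel_prob (type_space L M {x} A) P \<and>
     (\<forall>\<phi>\<in>forms L M {x} A. measure P {p \<in> types L M {x} A. \<phi> \<in> p} = \<mu> \<phi>)"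

text \<open>The function \<open>F\<close> expresses that \<open>\<mu>(\<phi>(x; b))\<close> depends only on \<open>tp(b/A)\<close>; by saturation
  every type over the small set \<open>A\<close> is of the form \<open>tp(b/A)\<close>.\<close>

definition definable_over ::
  "('s, 'f, 'r) lang \<Rightarrow> ('s, 'f, 'r, 'u) struc \<Rightarrow> 's var \<Rightarrow>
     (('s, 'f, 'r, 'u) form \<Rightarrow> real) \<Rightarrow> 'u set \<Rightarrow> bool" where
  "definable_over L M x \<mu> A \<longleftrightarrow>
     (\<forall>Y \<phi>. finite Y \<and> x \<notin> Y \<and> \<phi> \<in> forms L M (insert x Y) A \<longrightarrow>
        (\<exists>F. continuous_map (type_space L M Y A) (top_of_set {0..1}) F \<and>
           (\<forall>b\<in>vals M. \<mu> (plug Y b \<phi>) = F (tp L M Y A b))))"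

definition definable ::
  "'k rel \<Rightarrow> ('s, 'f, 'r) lang \<Rightarrow> ('s, 'f, 'r, 'u) struc \<Rightarrow> 's var \<Rightarrow>
     (('s, 'f, 'r, 'u) form \<Rightarrow> real) \<Rightarrow> bool" where
  "definable \<kappa> L M x \<mu> \<longleftrightarrow> (\<exists>A. small_model \<kappa> L M A \<and> definable_over L M x \<mu> A)"

definition invariant_type ::
  "('s, 'f, 'r) lang \<Rightarrow> ('s, 'f, 'r, 'u) struc \<Rightarrow> 's var \<Rightarrow> 'u set \<Rightarrow>
     ('s, 'f, 'r, 'u) form set \<Rightarrow> bool" where
  "invariant_type L M x A p \<longleftrightarrow>
     (\<forall>Y \<phi>. finite Y \<and> x \<notin> Y \<and> \<phi> \<in> forms L M (insert x Y) A \<longrightarrow>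
        (\<forall>b\<in>vals M. \<forall>c\<in>vals M. tp L M Y A b = tp L M Y A c \<longrightarrow>
           (plug Y b \<phi> \<in> p \<longleftrightarrow> plug Y c \<phi> \<in> p)))"

definition invariantly_supported ::
  "'k rel \<Rightarrow> ('s, 'f, 'r) lang \<Rightarrow> ('s, 'f, 'r, 'u) struc \<Rightarrow> 's var \<Rightarrow>
     (('s, 'f, 'r, 'u) form \<Rightarrow> real) \<Rightarrow> bool" where
  "invariantly_supported \<kappa> L M x \<mu> \<longleftrightarrow>
     (\<exists>A. small_model \<kappa> L M A \<and> (\<forall>p\<in>supp L M x (points M) \<mu>. invariant_type L M x A p))"

text \<open>\<open>N\<close> and \<open>F\<close> witness that \<open>(\<mu>, \<nu>)\<close> is \<open>*\<close>-Borel at \<open>\<phi>\<close>. Since the elements of \<open>S(\<nu>\<^sub>y|\<^sub>N)\<close>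
  are only used through their realizations, no second variable \<open>y\<close> is needed.\<close>

definition fibre_map ::
  "'k rel \<Rightarrow> ('s, 'f, 'r) lang \<Rightarrow> 'f \<Rightarrow> ('s, 'f, 'r, 'u) struc \<Rightarrow> 's var \<Rightarrow>
     (('s, 'f, 'r, 'u) form \<Rightarrow> real) \<Rightarrow> (('s, 'f, 'r, 'u) form \<Rightarrow> real) \<Rightarrow>
     ('s, 'f, 'r, 'u) form \<Rightarrow> 'u set \<Rightarrow> (('s, 'f, 'r, 'u) form set \<Rightarrow> real) \<Rightarrow> bool" where
  "fibre_map \<kappa> L m M x \<mu> \<nu> \<phi> N F \<longleftrightarrow>
     small_model \<kappa> L M N \<and> params \<phi> \<subseteq> N \<and>
     (\<forall>q\<in>supp L M x N \<nu>. \<forall>d\<in>univ M (fst x). tp1 L M x N d = q \<longrightarrow>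
        \<mu> (rshift m x d \<phi>) = F q) \<and>
     F \<in> borel_of (subtopology (type_space L M {x} N) (supp L M x N \<nu>)) \<rightarrow>\<^sub>M borel"

definition star_borel ::
  "'k rel \<Rightarrow> ('s, 'f, 'r) lang \<Rightarrow> 'f \<Rightarrow> ('s, 'f, 'r, 'u) struc \<Rightarrow> 's var \<Rightarrow>
     (('s, 'f, 'r, 'u) form \<Rightarrow> real) \<Rightarrow> (('s, 'f, 'r, 'u) form \<Rightarrow> real) \<Rightarrow> bool" where
  "star_borel \<kappa> L m M x \<mu> \<nu> \<longleftrightarrow>
     (\<forall>\<phi>\<in>forms L M {x} (points M). \<exists>N F. fibre_map \<kappa> L m M x \<mu> \<nu> \<phi> N F)"

text \<open>\<open>has_convolution \<dots> \<mu> \<nu> \<phi> r\<close> says that \<open>(\<mu> * \<nu>)(\<phi>) = r\<close>; the value does not depend on the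
  choice of \<open>N\<close>, and \<open>F\<close> and \<open>P\<close> are determined by \<open>N\<close>.\<close>

definition has_convolution ::
  "'k rel \<Rightarrow> ('s, 'f, 'r) lang \<Rightarrow> 'f \<Rightarrow> ('s, 'f, 'r, 'u) struc \<Rightarrow> 's var \<Rightarrow>
     (('s, 'f, 'r, 'u) form \<Rightarrow> real) \<Rightarrow> (('s, 'f, 'r, 'u) form \<Rightarrow> real) \<Rightarrow>
     ('s, 'f, 'r, 'u) form \<Rightarrow> real \<Rightarrow> bool" where
  "has_convolution \<kappa> L m M x \<mu> \<nu> \<phi> r \<longleftrightarrow>
     (\<exists>N F P. fibre_map \<kappa> L m M x \<mu> \<nu> \<phi> N F \<and> corresponds L M x N \<nu> P \<and>
        r = (\<integral>q. F q \<partial>(restrict_space P (supp L M x N \<nu>))))"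

definition idempotent_measure ::
  "'k rel \<Rightarrow> ('s, 'f, 'r) lang \<Rightarrow> 'f \<Rightarrow> ('s, 'f, 'r, 'u) struc \<Rightarrow> 's var \<Rightarrow>
     (('s, 'f, 'r, 'u) form \<Rightarrow> real) \<Rightarrow> bool" where
  "idempotent_measure \<kappa> L m M x \<mu> \<longleftrightarrow> star_borel \<kappa> L m M x \<mu> \<mu> \<and>
     (\<forall>\<phi>\<in>forms L M {x} (points M). has_convolution \<kappa> L m M x \<mu> \<mu> \<phi> (\<mu> \<phi>))"

text \<open>The product of types over \<open>M\<close> is computed in a larger monster model \<open>M'\<close>; here \<open>p'\<close> is the
  \<open>A\<close>-invariant extension of \<open>p\<close> to \<open>M'\<close>.\<close>

definition is_type_prod ::
  "'k rel \<Rightarrow> ('s, 'f, 'r) lang \<Rightarrow> 'f \<Rightarrow> ('s, 'f, 'r, 'u) struc \<Rightarrow> ('s, 'f, 'r, 'u) struc \<Rightarrow>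
     's var \<Rightarrow> ('s, 'f, 'r, 'u) form set \<Rightarrow> ('s, 'f, 'r, 'u) form set \<Rightarrow>
     ('s, 'f, 'r, 'u) form set \<Rightarrow> bool" where
  "is_type_prod \<kappa> L m M M' x p q r \<longleftrightarrow>
     (\<exists>A p' a b. small_model \<kappa> L M A \<and> invariant_type L M x A p \<and> invariant_type L M x A q \<and>
        p' \<in> types L M' {x} (points M') \<and> p \<subseteq> p' \<and> invariant_type L M' x A p' \<and>
        a \<in> univ M' (fst x) \<and> b \<in> univ M' (fst x) \<and>
        tp1 L M' x (points M) b = q \<and>
        tp1 L M' x (insert b (points M)) a = p' \<inter> forms L M' {x} (insert b (points M)) \<and>
        r = tp1 L M' x (points M) (fun_int M' m [a, b]))"

definition type_prod ::
  "'k rel \<Rightarrow> ('s, 'f, 'r) lang \<Rightarrow> 'f \<Rightarrow> ('s, 'f, 'r, 'u) struc \<Rightarrow> ('s, 'f, 'r, 'u) struc \<Rightarrow>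
     's var \<Rightarrow> ('s, 'f, 'r, 'u) form set \<Rightarrow> ('s, 'f, 'r, 'u) form set \<Rightarrow>
     ('s, 'f, 'r, 'u) form set" where
  "type_prod \<kappa> L m M M' x p q = (THE r. is_type_prod \<kappa> L m M M' x p q r)"

definition left_ideal :: "'a set \<Rightarrow> ('a \<Rightarrow> 'a \<Rightarrow> 'a) \<Rightarrow> 'a set \<Rightarrow> bool" where
  "left_ideal S op I \<longleftrightarrow> I \<noteq> {} \<and> I \<subseteq> S \<and> (\<forall>p\<in>S. \<forall>q\<in>I. op p q \<in> I)"

definition minimal_left_ideal :: "'a set \<Rightarrow> ('a \<Rightarrow> 'a \<Rightarrow> 'a) \<Rightarrow> 'a set \<Rightarrow> bool" where
  "minimal_left_ideal S op I \<longleftrightarrow>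
     left_ideal S op I \<and> (\<forall>J. left_ideal S op J \<and> J \<subseteq> I \<longrightarrow> J = I)"

definition minimal_measure ::
  "'k rel \<Rightarrow> ('s, 'f, 'r) lang \<Rightarrow> 'f \<Rightarrow> ('s, 'f, 'r, 'u) struc \<Rightarrow> ('s, 'f, 'r, 'u) struc \<Rightarrow>
     's var \<Rightarrow> (('s, 'f, 'r, 'u) form \<Rightarrow> real) \<Rightarrow> bool" where
  "minimal_measure \<kappa> L m M M' x \<mu> \<longleftrightarrow>
     minimal_left_ideal (supp L M x (points M) \<mu>) (type_prod \<kappa> L m M M' x)
       (supp L M x (points M) \<mu>)"

end

theory Submission
  imports Defs
begin

text \<open>Write \<open>S(\<mu>)\<close> for the support and let \<open>f(q) = \<mu>(\<phi>(x \<cdot> d))\<close> for \<open>d \<Turnstile> q\<close>, where \<open>q \<in> S(\<mu>)\<close>. Definability of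
  \<open>\<mu>\<close> makes \<open>f\<close> well defined and continuous, so by compactness it attains its maximum \<open>r\<close> on \<open>S(\<mu>)\<close>. The
  point is that the set \<open>K\<close> where \<open>f = r\<close> is a left ideal; minimality then makes \<open>f\<close> constant, and
  idempotence identifies the constant with \<open>\<mu>(\<phi>)\<close>, which is the integral of \<open>f\<close>. Since every type in
  the support of a restriction of \<open>\<mu>\<close> extends to one in \<open>S(\<mu>)\<close>, this is the claim.

  To see that \<open>K\<close> is a left ideal, let \<open>q \<in> K\<close> be realized by \<open>b\<close> and consider the formula \<open>\<phi>(x \<cdot> b)\<close>. Its
  measure is \<open>r\<close>. By idempotence it is also the mean over \<open>p \<in> S(\<mu>)\<close> of \<open>\<mu>(\<phi>(x \<cdot> d \<cdot> b))\<close> with \<open>d \<Turnstile> p\<close>, and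
  \<open>d \<cdot> b\<close> realizes \<open>p * q\<close>, so the integrand is \<open>f(p * q) \<le> r\<close>. A continuous function that is bounded by
  its mean is constant on the support, that is, \<open>p * q \<in> K\<close> for all \<open>p\<close>.

  The proof has three ingredients. First, products of types must be computed: \<open>type_prod_mem\<close> shows
  that \<open>\<theta> \<in> p * q\<close> iff \<open>\<theta>(x \<cdot> d) \<in> p\<close>, for any \<open>d\<close> in the original monster model that realizes \<open>q\<close> over enough
  parameters. It rests on the existence and uniqueness of invariant extensions of types, obtained by
  moving parameters along partial elementary maps (\<open>inv_ext\<close>, \<open>invariant_type_move\<close>). Second, the
  identity \<open>f(p * q) = \<mu>(\<phi>(x \<cdot> d \<cdot> b))\<close> follows from this (\<open>val_type_prod\<close>). Third, the passage from
  an almost everywhere statement about a Borel function on the support over a small model to a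
  statement about all of \<open>S(\<mu>)\<close> is \<open>val_max\<close>; it uses that the support has full measure
  (\<open>support_full\<close>) and compactness in the form of \<open>supp_attains\<close>. Continuity of \<open>f\<close> enters through
  \<open>rshift_usc\<close>.\<close>

section \<open>Syntax and its evaluation\<close>

text \<open>Bound variables are what a new variable has to avoid besides the free ones, because \<open>subst\<close>
  does not rename them.\<close>
primrec bv :: "('s, 'f, 'r, 'u) form \<Rightarrow> 's var set" where
  "bv (Eq t u) = {}"
| "bv (Rel r ts) = {}"
| "bv (Neg \<phi>) = bv \<phi>"
| "bv (Conj \<phi> \<psi>) = bv \<phi> \<union> bv \<psi>"
| "bv (All v \<phi>) = insert v (bv \<phi>)"

text \<open>The map \<open>\<nu>\<close> may send a parameter to another parameter or to a variable. So this one recursion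
  covers both the transport of formulas along a map of structures and the abstraction of parameters.\<close>
primrec tm_par :: "('u \<Rightarrow> ('s, 'f, 'u) tm) \<Rightarrow> ('s, 'f, 'u) tm \<Rightarrow> ('s, 'f, 'u) tm" where
  "tm_par \<nu> (Var v) = Var v"
| "tm_par \<nu> (Par u) = \<nu> u"
| "tm_par \<nu> (App f ts) = App f (map (tm_par \<nu>) ts)"

primrec par :: "('u \<Rightarrow> ('s, 'f, 'u) tm) \<Rightarrow> ('s, 'f, 'r, 'u) form \<Rightarrow> ('s, 'f, 'r, 'u) form" where
  "par \<nu> (Eq t u) = Eq (tm_par \<nu> t) (tm_par \<nu> u)"
| "par \<nu> (Rel r ts) = Rel r (map (tm_par \<nu>) ts)"
| "par \<nu> (Neg \<phi>) = Neg (par \<nu> \<phi>)"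
| "par \<nu> (Conj \<phi> \<psi>) = Conj (par \<nu> \<phi>) (par \<nu> \<psi>)"
| "par \<nu> (All v \<phi>) = All v (par \<nu> \<phi>)"

abbreviation move :: "('u \<Rightarrow> 'u) \<Rightarrow> ('s, 'f, 'r, 'u) form \<Rightarrow> ('s, 'f, 'r, 'u) form" where
  "move h \<equiv> par (\<lambda>u. Par (h u))"

lemma finite_tm_vars: "finite (tm_vars t)"
  by (induction t) auto

lemma finite_tm_params: "finite (tm_params t)"
  by (induction t) auto

lemma finite_fv: "finite (fv \<phi>)"
  by (induction \<phi>) (auto simp: finite_tm_vars)

lemma finite_bv: "finite (bv \<phi>)"
  by (induction \<phi>) auto

lemma finite_params: "finite (params \<phi>)"
  by (induction \<phi>) (auto simp: finite_tm_params)

lemma tm_val_cong: "(\<And>v. v \<in> tm_vars t \<Longrightarrow> e v = e' v) \<Longrightarrow> tm_val M e t = tm_val M e' t"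
proof (induction t)
  case (App f ts)
  have "map (tm_val M e) ts = map (tm_val M e') ts"
    using App by (intro map_cong) auto
  then show ?case by (simp only: tm_val.simps)
qed auto

lemma sat_cong: "(\<And>v. v \<in> fv \<phi> \<Longrightarrow> e v = e' v) \<Longrightarrow> sat M e \<phi> \<longleftrightarrow> sat M e' \<phi>"
proof (induction \<phi> arbitrary: e e')
  case (Eq t u)
  then show ?case using tm_val_cong[of t e e' M] tm_val_cong[of u e e' M] by simp
next
  case (Rel r ts)
  have "map (tm_val M e) ts = map (tm_val M e') ts"
    using Rel by (intro map_cong tm_val_cong) auto
  then show ?case by (simp only: sat.simps)
next
  case (Neg \<phi>)
  have "sat M e \<phi> \<longleftrightarrow> sat M e' \<phi>"
    by (rule Neg.IH) (simp add: Neg.prems)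
  then show ?case by simp
next
  case (Conj \<phi> \<psi>)
  have "sat M e \<phi> \<longleftrightarrow> sat M e' \<phi>"
    by (rule Conj.IH(1)) (simp add: Conj.prems)
  moreover have "sat M e \<psi> \<longleftrightarrow> sat M e' \<psi>"
    by (rule Conj.IH(2)) (simp add: Conj.prems)
  ultimately show ?case by simp
next
  case (All v \<phi>)
  have "sat M (e(v := u)) \<phi> = sat M (e'(v := u)) \<phi>" for u
    using All.prems by (intro All.IH) auto
  then show ?case by simp
qed

lemma tm_val_subst: "tm_val M e (tm_subst \<sigma> t) = tm_val M (\<lambda>v. tm_val M e (\<sigma> v)) t"
proof (induction t)
  case (App f ts)
  have "map (tm_val M e \<circ> tm_subst \<sigma>) ts = map (tm_val M (\<lambda>v. tm_val M e (\<sigma> v))) ts"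
    using App by (intro map_cong) auto
  then show ?case by (simp del: map_eq_conv)
qed auto

text \<open>If \<open>\<sigma> v\<close> contains no variable other than \<open>v\<close>, nothing can be captured: below a quantifier over
  \<open>v\<close> the only terms that mention \<open>v\<close> are those for \<open>v\<close> itself, and these are not substituted there.
  Plugging in parameters and right translation are of this kind.\<close>
lemma sat_subst:
  assumes "\<And>v. tm_vars (\<sigma> v) \<subseteq> {v}"
  shows "sat M e (subst \<sigma> \<phi>) \<longleftrightarrow> sat M (\<lambda>v. tm_val M e (\<sigma> v)) \<phi>"
  using assms
proof (induction \<phi> arbitrary: \<sigma> e)
  case (Rel r ts)
  have "map (tm_val M e \<circ> tm_subst \<sigma>) ts = map (tm_val M (\<lambda>v. tm_val M e (\<sigma> v))) ts"
    by (intro map_cong) (auto simp: tm_val_subst)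
  then show ?case by (simp del: map_eq_conv)
next
  case (All v \<phi>)
  have "sat M (e(v := u)) (subst (\<sigma>(v := Var v)) \<phi>) \<longleftrightarrow>
      sat M ((\<lambda>v. tm_val M e (\<sigma> v))(v := u)) \<phi>" for u
  proof -
    have "tm_val M (e(v := u)) (\<sigma> w) = tm_val M e (\<sigma> w)" if "w \<noteq> v" for w
      using All.prems[of w] that by (intro tm_val_cong) force
    then have "(\<lambda>w. tm_val M (e(v := u)) ((\<sigma>(v := Var v)) w)) = (\<lambda>v. tm_val M e (\<sigma> v))(v := u)"
      by (intro ext) simp
    moreover have "sat M (e(v := u)) (subst (\<sigma>(v := Var v)) \<phi>) \<longleftrightarrow>
      sat M (\<lambda>w. tm_val M (e(v := u)) ((\<sigma>(v := Var v)) w)) \<phi>"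
      using All.prems by (intro All.IH) auto
    ultimately show ?thesis by simp
  qed
  then show ?case by simp
qed (auto simp: tm_val_subst)

lemma sat_plug: "sat M e (plug Y b \<phi>) \<longleftrightarrow> sat M (\<lambda>v. if v \<in> Y then b v else e v) \<phi>"
proof -
  have "(\<lambda>v. tm_val M e (if v \<in> Y then Par (b v) else Var v)) = (\<lambda>v. if v \<in> Y then b v else e v)"
    by (auto simp: fun_eq_iff)
  then show ?thesis
    unfolding plug_def by (subst sat_subst) auto
qed

lemma sat_rshift: "sat M e (rshift m x d \<phi>) \<longleftrightarrow> sat M (e(x := fun_int M m [e x, d])) \<phi>"
proof -
  have "(\<lambda>v. tm_val M e ((Var(x := App m [Var x, Par d])) v)) = e(x := fun_int M m [e x, d])"
    by (auto simp: fun_eq_iff)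
  then show ?thesis
    unfolding rshift_def by (subst sat_subst) auto
qed

lemma tm_val_par_cong:
  "(\<And>u. u \<in> tm_params t \<Longrightarrow> tm_val M e (\<nu> u) = tm_val M e (\<nu>' u)) \<Longrightarrow>
    tm_val M e (tm_par \<nu> t) = tm_val M e (tm_par \<nu>' t)"
proof (induction t)
  case (App f ts)
  have "map (tm_val M e \<circ> tm_par \<nu>) ts = map (tm_val M e \<circ> tm_par \<nu>') ts"
    using App by (intro map_cong) auto
  then show ?case by (simp del: map_eq_conv)
qed auto

text \<open>The terms for a parameter are evaluated below quantifiers, where only the values of variables
  that are never bound are known to be those of \<open>e\<close>.\<close>
lemma sat_par_cong:
  assumes "\<And>u e'. u \<in> params \<phi> \<Longrightarrow> (\<And>v. v \<notin> bv \<phi> \<Longrightarrow> e' v = e v) \<Longrightarrow>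
    tm_val M e' (\<nu> u) = tm_val M e' (\<nu>' u)"
  shows "sat M e (par \<nu> \<phi>) \<longleftrightarrow> sat M e (par \<nu>' \<phi>)"
  using assms
proof (induction \<phi> arbitrary: e)
  case (Eq t u)
  then show ?case
    using tm_val_par_cong[of t M e \<nu> \<nu>'] tm_val_par_cong[of u M e \<nu> \<nu>'] by simp
next
  case (Rel r ts)
  have "map (tm_val M e \<circ> tm_par \<nu>) ts = map (tm_val M e \<circ> tm_par \<nu>') ts"
    using Rel by (intro map_cong) (auto intro!: tm_val_par_cong)
  then show ?case by (simp del: map_eq_conv)
next
  case (Neg \<phi>)
  have "sat M e (par \<nu> \<phi>) \<longleftrightarrow> sat M e (par \<nu>' \<phi>)"
    by (rule Neg.IH) (rule Neg.prems, auto)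
  then show ?case by simp
next
  case (Conj \<phi> \<psi>)
  have "sat M e (par \<nu> \<phi>) \<longleftrightarrow> sat M e (par \<nu>' \<phi>)"
    by (rule Conj.IH(1)) (rule Conj.prems, auto)
  moreover have "sat M e (par \<nu> \<psi>) \<longleftrightarrow> sat M e (par \<nu>' \<psi>)"
    by (rule Conj.IH(2)) (rule Conj.prems, auto)
  ultimately show ?case by simp
next
  case (All v \<phi>)
  have "sat M (e(v := u)) (par \<nu> \<phi>) \<longleftrightarrow> sat M (e(v := u)) (par \<nu>' \<phi>)" for u
    by (rule All.IH) (rule All.prems, auto)
  then show ?case by simp
qed

lemma tm_par_id: "tm_par Par t = t"
  by (induction t) (simp_all add: map_idI)

lemma par_id: "par Par \<phi> = \<phi>"
  by (induction \<phi>) (simp_all add: tm_par_id map_idI)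

lemma tm_par_cong:
  "(\<And>u. u \<in> tm_params t \<Longrightarrow> \<nu> u = \<nu>' u) \<Longrightarrow> tm_par \<nu> t = tm_par \<nu>' t"
  by (induction t) auto

lemma par_cong: "(\<And>u. u \<in> params \<phi> \<Longrightarrow> \<nu> u = \<nu>' u) \<Longrightarrow> par \<nu> \<phi> = par \<nu>' \<phi>"
  by (induction \<phi>) (auto intro!: tm_par_cong)

lemma tm_par_comp: "tm_par \<nu> (tm_par \<nu>' t) = tm_par (\<lambda>u. tm_par \<nu> (\<nu>' u)) t"
  by (induction t) auto

lemma par_comp: "par \<nu> (par \<nu>' \<phi>) = par (\<lambda>u. tm_par \<nu> (\<nu>' u)) \<phi>"
  by (induction \<phi>) (auto simp: tm_par_comp)

lemma tm_vars_par: "tm_vars (tm_par \<nu> t) \<subseteq> tm_vars t \<union> (\<Union>u\<in>tm_params t. tm_vars (\<nu> u))"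
proof (induction t)
  case (App f ts)
  have "tm_vars (tm_par \<nu> t) \<subseteq> tm_vars (App f ts) \<union> (\<Union>u\<in>tm_params (App f ts). tm_vars (\<nu> u))"
    if "t \<in> set ts" for t
    by (rule order_trans[OF App[OF that]]) (use that in auto)
  then show ?case by (simp add: UN_subset_iff)
qed auto

lemma fv_par: "fv (par \<nu> \<phi>) \<subseteq> fv \<phi> \<union> (\<Union>u\<in>params \<phi>. tm_vars (\<nu> u))"
proof (induction \<phi>)
  case (Eq t u)
  then show ?case using tm_vars_par[of \<nu> t] tm_vars_par[of \<nu> u] by auto
next
  case (Rel r ts)
  have "tm_vars (tm_par \<nu> t) \<subseteq> fv (Rel r ts) \<union> (\<Union>u\<in>params (Rel r ts). tm_vars (\<nu> u))"
    if "t \<in> set ts" for t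
    by (rule order_trans[OF tm_vars_par]) (use that in auto)
  then show ?case by (simp add: UN_subset_iff)
qed auto

lemma tm_params_par: "tm_params (tm_par \<nu> t) = (\<Union>u\<in>tm_params t. tm_params (\<nu> u))"
  by (induction t) auto

lemma params_par: "params (par \<nu> \<phi>) = (\<Union>u\<in>params \<phi>. tm_params (\<nu> u))"
  by (induction \<phi>) (auto simp: tm_params_par)

lemma fv_move: "fv (move h \<phi>) \<subseteq> fv \<phi>"
  using fv_par[of "\<lambda>u. Par (h u)" \<phi>] by simp

lemma tm_move_subst:
  "tm_par (\<lambda>u. Par (h u)) (tm_subst \<sigma> t) =
    tm_subst (\<lambda>v. tm_par (\<lambda>u. Par (h u)) (\<sigma> v)) (tm_par (\<lambda>u. Par (h u)) t)"
  by (induction t) auto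

lemma move_subst:
  "move h (subst \<sigma> \<phi>) = subst (\<lambda>v. tm_par (\<lambda>u. Par (h u)) (\<sigma> v)) (move h \<phi>)"
proof (induction \<phi> arbitrary: \<sigma>)
  case (All v \<phi>)
  have "(\<lambda>w. tm_par (\<lambda>u. Par (h u)) ((\<sigma>(v := Var v)) w)) =
      (\<lambda>v. tm_par (\<lambda>u. Par (h u)) (\<sigma> v))(v := Var v)"
    by (auto simp: fun_eq_iff)
  then show ?case by (simp add: All)
qed (auto simp: tm_move_subst)

lemma move_plug: "move h (plug Y b \<phi>) = plug Y (\<lambda>v. h (b v)) (move h \<phi>)"
  unfolding plug_def move_subst
  by (rule arg_cong[where f = "\<lambda>\<sigma>. subst \<sigma> (move h \<phi>)"]) (auto simp: fun_eq_iff)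

lemma move_rshift: "move h (rshift m x d \<phi>) = rshift m x (h d) (move h \<phi>)"
  unfolding rshift_def move_subst
  by (rule arg_cong[where f = "\<lambda>\<sigma>. subst \<sigma> (move h \<phi>)"]) (auto simp: fun_eq_iff)

lemma move_fixed: "(\<And>u. u \<in> params \<phi> \<Longrightarrow> h u = u) \<Longrightarrow> move h \<phi> = \<phi>"
  using par_cong[of \<phi> "\<lambda>u. Par (h u)" Par] by (simp add: par_id)

lemma tm_vars_subst: "tm_vars (tm_subst \<sigma> t) = (\<Union>v\<in>tm_vars t. tm_vars (\<sigma> v))"
  by (induction t) auto

lemma fv_subst:
  "(\<And>v. tm_vars (\<sigma> v) \<subseteq> {v}) \<Longrightarrow> fv (subst \<sigma> \<phi>) = (\<Union>v\<in>fv \<phi>. tm_vars (\<sigma> v))"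
proof (induction \<phi> arbitrary: \<sigma>)
  case (All v \<phi>)
  have "fv (subst (\<sigma>(v := Var v)) \<phi>) = (\<Union>w\<in>fv \<phi>. tm_vars ((\<sigma>(v := Var v)) w))"
    using All.prems by (intro All.IH) auto
  moreover have "v \<notin> tm_vars (\<sigma> w)" if "w \<noteq> v" for w
    using All.prems[of w] that by blast
  ultimately show ?case by (auto split: if_splits)
qed (auto simp: tm_vars_subst)

lemma tm_params_subst:
  "tm_params (tm_subst \<sigma> t) = tm_params t \<union> (\<Union>v\<in>tm_vars t. tm_params (\<sigma> v))"
  by (induction t) auto

lemma params_subst: "params (subst \<sigma> \<phi>) \<subseteq> params \<phi> \<union> (\<Union>v\<in>fv \<phi>. tm_params (\<sigma> v))"
proof (induction \<phi> arbitrary: \<sigma>)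
  case (All v \<phi>)
  have "params (subst (\<sigma>(v := Var v)) \<phi>) \<subseteq>
      params \<phi> \<union> (\<Union>w\<in>fv \<phi>. tm_params ((\<sigma>(v := Var v)) w))"
    by (rule All.IH)
  also have "\<dots> \<subseteq> params \<phi> \<union> (\<Union>w\<in>fv \<phi> - {v}. tm_params (\<sigma> w))"
    by (auto split: if_splits)
  finally show ?case by simp
next
  case (Conj \<phi> \<psi>)
  then show ?case by (simp only: subst.simps params.simps fv.simps) blast
qed (auto simp: tm_params_subst)

lemma has_sort_subst:
  assumes "has_sort L M t s" "\<And>v. has_sort L M (\<sigma> v) (fst v)"
  shows "has_sort L M (tm_subst \<sigma> t) s"
  using assms(1)
proof (induction rule: has_sort.induct)
  case (3 f ts)
  have "list_all2 (has_sort L M) (map (tm_subst \<sigma>) ts) (fun_dom L f)"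
    unfolding list_all2_map1 by (rule list.rel_mono_strong[OF 3(2)]) auto
  then show ?case using has_sort.intros(3)[OF 3(1)] by simp
qed (auto intro: has_sort.intros assms(2))

lemma wf_subst:
  "wf_form L M \<phi> \<Longrightarrow> (\<And>v. has_sort L M (\<sigma> v) (fst v)) \<Longrightarrow> wf_form L M (subst \<sigma> \<phi>)"
proof (induction \<phi> arbitrary: \<sigma>)
  case (Eq t u)
  then obtain s where "has_sort L M t s" "has_sort L M u s" by auto
  then show ?case using Eq.prems(2) has_sort_subst[of L M _ s \<sigma>] by auto
next
  case (Rel r ts)
  have "list_all2 (has_sort L M) (map (tm_subst \<sigma>) ts) (rel_dom L r)"
    unfolding list_all2_map1
    by (rule list.rel_mono_strong[of "has_sort L M" ts]) (use Rel in \<open>auto intro!: has_sort_subst\<close>)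
  then show ?case using Rel by simp
next
  case (All v \<phi>)
  have "wf_form L M (subst (\<sigma>(v := Var v)) \<phi>)"
    using All.prems by (intro All.IH) (auto intro: has_sort.intros)
  then show ?case by simp
qed auto

lemma has_sort_par:
  assumes "has_sort L M t s"
    "\<And>u s. u \<in> tm_params t \<Longrightarrow> u \<in> univ M s \<Longrightarrow> has_sort L M' (\<nu> u) s"
  shows "has_sort L M' (tm_par \<nu> t) s"
  using assms
proof (induction rule: has_sort.induct)
  case (3 f ts)
  have "list_all2 (has_sort L M') (map (tm_par \<nu>) ts) (fun_dom L f)"
    unfolding list_all2_map1 by (rule list.rel_mono_strong[OF 3(2)]) (use 3(3) in auto)
  then show ?case using has_sort.intros(3)[OF 3(1)] by simp
qed (auto intro: has_sort.intros)

lemma wf_par: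
  "wf_form L M \<phi> \<Longrightarrow> (\<And>u s. u \<in> params \<phi> \<Longrightarrow> u \<in> univ M s \<Longrightarrow> has_sort L M' (\<nu> u) s) \<Longrightarrow>
    wf_form L M' (par \<nu> \<phi>)"
proof (induction \<phi>)
  case (Eq t u)
  then obtain s where "has_sort L M t s" "has_sort L M u s" by auto
  then have "has_sort L M' (tm_par \<nu> t) s" "has_sort L M' (tm_par \<nu> u) s"
    using Eq.prems(2) by (auto intro!: has_sort_par)
  then show ?case by auto
next
  case (Rel r ts)
  have "list_all2 (has_sort L M') (map (tm_par \<nu>) ts) (rel_dom L r)"
    unfolding list_all2_map1
    by (rule list.rel_mono_strong[of "has_sort L M" ts]) (use Rel in \<open>auto intro!: has_sort_par\<close>)
  then show ?case using Rel by simp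
qed auto

lemma has_sort_params: "has_sort L M t s \<Longrightarrow> tm_params t \<subseteq> points M"
proof (induction rule: has_sort.induct)
  case (3 f ts)
  then have "\<forall>t\<in>set ts. tm_params t \<subseteq> points M"
    by (simp add: list_all2_conv_all_nth all_set_conv_all_nth)
  then show ?case by auto
qed (auto simp: points_def)

lemma wf_params: "wf_form L M \<phi> \<Longrightarrow> params \<phi> \<subseteq> points M"
proof (induction \<phi>)
  case (Rel r ts)
  then have "\<forall>t\<in>set ts. \<exists>s. has_sort L M t s"
    by (auto simp: list_all2_conv_all_nth all_set_conv_all_nth)
  then have "\<forall>t\<in>set ts. tm_params t \<subseteq> points M"
    by (meson has_sort_params)
  then show ?case by auto
next
  case (Eq t u)
  then obtain s where "has_sort L M t s" "has_sort L M u s" by auto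
  then show ?case by (simp add: has_sort_params)
qed auto

section \<open>Formulas over a parameter set\<close>

abbreviation Tru :: "'s var \<Rightarrow> ('s, 'f, 'r, 'u) form" where
  "Tru v \<equiv> All v (Eq (Var v) (Var v))"

lemma forms_simps [simp]:
  "Neg \<phi> \<in> forms L M V A \<longleftrightarrow> \<phi> \<in> forms L M V A"
  "Conj \<phi> \<psi> \<in> forms L M V A \<longleftrightarrow> \<phi> \<in> forms L M V A \<and> \<psi> \<in> forms L M V A"
  "Tru v \<in> forms L M V A"
  by (auto simp: forms_def intro: has_sort.intros)

lemma forms_mono: "V \<subseteq> V' \<Longrightarrow> A \<subseteq> A' \<Longrightarrow> forms L M V A \<subseteq> forms L M V' A'"
  by (auto simp: forms_def)

lemma forms_params: "\<phi> \<in> forms L M V A \<Longrightarrow> \<phi> \<in> forms L M V (params \<phi>)"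
  by (auto simp: forms_def)

lemma forms_points: "\<phi> \<in> forms L M V A \<Longrightarrow> params \<phi> \<subseteq> points M"
  by (auto simp: forms_def dest!: wf_params)

lemma sat_forms_cong:
  "\<phi> \<in> forms L M0 V A \<Longrightarrow> (\<And>v. v \<in> V \<Longrightarrow> e v = e' v) \<Longrightarrow> sat M e \<phi> \<longleftrightarrow> sat M e' \<phi>"
  by (rule sat_cong) (auto simp: forms_def)

lemma sat_forms1: "\<phi> \<in> forms L M0 {x} A \<Longrightarrow> sat M e \<phi> \<longleftrightarrow> sat M (\<lambda>_. e x) \<phi>"
  by (rule sat_forms_cong) auto

lemma plug_forms:
  assumes "\<phi> \<in> forms L M V B" "b \<in> vals M"
  shows "plug Y b \<phi> \<in> forms L M (V - Y) (B \<union> b ` (V \<inter> Y))"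
proof -
  let ?\<sigma> = "\<lambda>v. if v \<in> Y then Par (b v) else Var v"
  have "wf_form L M (plug Y b \<phi>)"
    unfolding plug_def using assms
    by (intro wf_subst) (auto simp: forms_def vals_def intro: has_sort.intros)
  moreover have "fv (plug Y b \<phi>) \<subseteq> V - Y"
    unfolding plug_def by (subst fv_subst) (use assms in \<open>auto simp: forms_def split: if_splits\<close>)
  moreover have "params (plug Y b \<phi>) \<subseteq> B \<union> b ` (V \<inter> Y)"
    unfolding plug_def
    by (rule order_trans[OF params_subst]) (use assms in \<open>auto simp: forms_def split: if_splits\<close>)
  ultimately show ?thesis by (simp add: forms_def)
qed

lemma rshift_forms:
  assumes "expands_group L m (fst x) M0" "\<phi> \<in> forms L M {x} B" "d \<in> univ M (fst x)"
  shows "rshift m x d \<phi> \<in> forms L M {x} (insert d B)"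
proof -
  let ?\<sigma> = "Var(x := App m [Var x, Par d])"
  have m: "m \<in> funs L" "fun_dom L m = [fst x, fst x]" "fun_cod L m = fst x"
    using assms(1) by (auto simp: expands_group_def)
  have "has_sort L M (App m [Var x, Par d]) (fst x)"
    using has_sort.intros(3)[OF m(1), where ts = "[Var x, Par d]" and M = M] assms(3) m
    by (auto intro: has_sort.intros)
  then have "wf_form L M (rshift m x d \<phi>)"
    unfolding rshift_def using assms
    by (intro wf_subst) (auto simp: forms_def intro: has_sort.intros)
  moreover have "fv (rshift m x d \<phi>) \<subseteq> {x}"
    unfolding rshift_def by (subst fv_subst) (use assms in \<open>auto simp: forms_def split: if_splits\<close>)
  moreover have "params (rshift m x d \<phi>) \<subseteq> insert d B"
    unfolding rshift_def
    by (rule order_trans[OF params_subst]) (use assms in \<open>auto simp: forms_def split: if_splits\<close>)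
  ultimately show ?thesis by (simp add: forms_def)
qed

text \<open>The conjunction is formed once for all structures and all ways \<open>\<nu>\<close> of moving the parameters, so
  that it commutes with elementary maps.\<close>
lemma finite_conj:
  assumes "finite F" "F \<subseteq> forms L M V B"
  shows "\<exists>\<theta>\<in>forms L M V B. \<forall>M1 \<nu> e. sat M1 e (par \<nu> \<theta>) \<longleftrightarrow> (\<forall>\<phi>\<in>F. sat M1 e (par \<nu> \<phi>))"
  using assms
proof (induction F)
  case empty
  have "Tru (undefined :: 'a var) \<in> forms L M V B" by simp
  then show ?case by (auto intro!: bexI[of _ "Tru undefined"])
next
  case (insert \<phi> F)
  then obtain \<theta> where "\<theta> \<in> forms L M V B"
    "\<forall>M1 \<nu> e. sat M1 e (par \<nu> \<theta>) \<longleftrightarrow> (\<forall>\<phi>\<in>F. sat M1 e (par \<nu> \<phi>))" by auto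
  then show ?case using insert by (auto intro!: bexI[of _ "Conj \<phi> \<theta>"])
qed

lemma finite_conj_sat:
  assumes "finite F" "F \<subseteq> forms L M V B"
  obtains \<theta> where "\<theta> \<in> forms L M V B" "\<And>M1 e. sat M1 e \<theta> \<longleftrightarrow> (\<forall>\<phi>\<in>F. sat M1 e \<phi>)"
  using finite_conj[OF assms] par_id by metis

lemma vals_nonempty:
  assumes "is_struc L M" obtains e where "e \<in> vals M"
proof -
  have "(\<lambda>v. SOME w. w \<in> univ M (fst v)) \<in> vals M"
    using assms by (auto simp: vals_def is_struc_def some_in_eq)
  then show thesis by (rule that)
qed

lemma valsI: "(\<And>v. e v \<in> univ M (fst v)) \<Longrightarrow> e \<in> vals M"
  unfolding vals_def by blast

lemma vals_univ: "e \<in> vals M \<Longrightarrow> e v \<in> univ M (fst v)"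
  unfolding vals_def by blast

lemma vals_upd: "e \<in> vals M \<Longrightarrow> u \<in> univ M (fst v) \<Longrightarrow> e(v := u) \<in> vals M"
  by (auto simp: vals_def)

lemma univ_points: "u \<in> univ M s \<Longrightarrow> u \<in> points M"
  by (auto simp: points_def)

lemma univ_sort: "is_struc L M \<Longrightarrow> u \<in> univ M s \<Longrightarrow> u \<in> univ M t \<Longrightarrow> s = t"
  by (auto simp: is_struc_def)

text \<open>Definability and invariance speak of a parameter-free formula with a tuple plugged in, whereas
  types and measures consist of formulas that carry their parameters inside. This lemma translates
  between the two: \<open>\<psi>\<close> is \<open>\<phi>\<close> with every parameter replaced by a variable of its sort that is neither
  free nor bound in \<open>\<phi>\<close>. The same \<open>\<psi>\<close> and \<open>b\<close> serve for all \<open>h\<close>, since moving the parameters of \<open>\<phi>\<close>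
  only changes the tuple; this is what makes the translation compatible with elementary maps.\<close>

lemma abstract_params:
  fixes \<phi> :: "('s, 'f, 'r, 'u) form"
  assumes "wf_form L M \<phi>" "is_struc L M" "finite X"
  obtains Y \<psi> b where "finite Y" "Y \<inter> X = {}" "Y \<inter> fv \<phi> = {}" "b \<in> vals M" "b ` Y = params \<phi>"
    "\<psi> \<in> forms L M (fv \<phi> \<union> Y) {}"
    "\<forall>M1 h e. sat M1 e (move h \<phi>) \<longleftrightarrow> sat M1 (\<lambda>v. if v \<in> Y then h (b v) else e v) \<psi>"
proof -
  define W where "W = X \<union> fv \<phi> \<union> bv \<phi>"
  have "finite (snd ` W)"
    using assms(3) by (simp add: W_def finite_fv finite_bv)
  then obtain k where k: "\<And>v. v \<in> W \<Longrightarrow> snd v < k"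
    by (meson finite_nat_set_iff_bounded image_eqI)
  obtain idx :: "'u \<Rightarrow> nat" where idx: "inj_on idx (params \<phi>)"
    using finite_imp_inj_to_nat_seg[OF finite_params] by metis
  define sort where "sort u = (SOME s. u \<in> univ M s)" for u
  have sort: "u \<in> univ M (sort u)" if "u \<in> params \<phi>" for u
    using wf_params[OF assms(1)] that unfolding sort_def points_def by (auto intro: someI)
  define y where "y u = (sort u, k + idx u)" for u
  have inj: "inj_on y (params \<phi>)"
    using idx by (auto simp: y_def inj_on_def)
  define Y where "Y = y ` params \<phi>"
  define b where "b v = (if v \<in> Y then inv_into (params \<phi>) y v else (SOME w. w \<in> univ M (fst v)))" for v
  have b_y: "b (y u) = u" if "u \<in> params \<phi>" for u
    using that inj by (auto simp: b_def Y_def)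
  have fresh: "y u \<notin> W" for u
    using k[of "y u"] by (auto simp: y_def)
  \<comment> \<open>The number part of \<open>y u\<close> exceeds every number used in \<open>\<phi>\<close> and \<open>X\<close>, so \<open>y u\<close> is new.\<close>
  define \<psi> where "\<psi> = par (\<lambda>u. Var (y u)) \<phi>"
  show thesis
  proof (rule that)
    show "finite Y" by (simp add: Y_def finite_params)
    show "Y \<inter> X = {}" "Y \<inter> fv \<phi> = {}"
      using fresh by (auto simp: Y_def W_def)
    show "b \<in> vals M"
    proof -
      have "b v \<in> univ M (fst v)" for v
      proof (cases "v \<in> Y")
        case True
        then obtain u where "u \<in> params \<phi>" "v = y u" by (auto simp: Y_def)
        then show ?thesis using b_y sort by (simp add: y_def)
      next
        case False
        then show ?thesis using assms(2) by (auto simp: b_def is_struc_def some_in_eq)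
      qed
      then show ?thesis unfolding vals_def by blast
    qed
    show "b ` Y = params \<phi>"
      using b_y by (force simp: Y_def)
    have "wf_form L M \<psi>"
      unfolding \<psi>_def
    proof (rule wf_par[OF assms(1)])
      fix u s assume "u \<in> params \<phi>" "u \<in> univ M s"
      then have "s = fst (y u)"
        using sort univ_sort[OF assms(2)] by (simp add: y_def)
      then show "has_sort L M (Var (y u)) s" by (simp add: has_sort.intros(1))
    qed
    moreover have "fv \<psi> \<subseteq> fv \<phi> \<union> Y"
      unfolding \<psi>_def Y_def by (rule order_trans[OF fv_par]) auto
    moreover have "params \<psi> = {}"
      by (simp add: \<psi>_def params_par)
    ultimately show "\<psi> \<in> forms L M (fv \<phi> \<union> Y) {}"
      by (simp add: forms_def)
    show "\<forall>M1 h e. sat M1 e (move h \<phi>) \<longleftrightarrow> sat M1 (\<lambda>v. if v \<in> Y then h (b v) else e v) \<psi>"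
    proof (intro allI)
      fix M1 :: "('s, 'f, 'r, 'u) struc" and h :: "'u \<Rightarrow> 'u" and e :: "'s var \<Rightarrow> 'u"
      let ?e = "\<lambda>v. if v \<in> Y then h (b v) else e v"
      have "sat M1 ?e \<psi> \<longleftrightarrow> sat M1 ?e (move h \<phi>)"
        unfolding \<psi>_def
      proof (rule sat_par_cong)
        fix u e' assume u: "u \<in> params \<phi>" and e': "\<And>v. v \<notin> bv \<phi> \<Longrightarrow> e' v = ?e v"
        have "y u \<notin> bv \<phi>" "y u \<in> Y"
          using fresh[of u] u by (auto simp: W_def Y_def)
        then show "tm_val M1 e' (Var (y u)) = tm_val M1 e' (Par (h u))"
          using e'[of "y u"] b_y[OF u] by simp
      qed
      also have "\<dots> \<longleftrightarrow> sat M1 e (move h \<phi>)"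
      proof (rule sat_cong)
        fix v assume "v \<in> fv (move h \<phi>)"
        then have "v \<in> fv \<phi>" using fv_move by blast
        then show "?e v = e v" using fresh by (auto simp: Y_def W_def)
      qed
      finally show "sat M1 e (move h \<phi>) \<longleftrightarrow> sat M1 ?e \<psi>" by simp
    qed
  qed
qed

section \<open>Elementary maps\<close>

text \<open>A partial elementary map with domain \<open>B\<close>. Testing it on sentences is enough, because the
  sentences over \<open>B\<close> include all \<open>plug V e \<theta>\<close> with \<open>e\<close> in \<open>B\<close>. As sentences ignore the valuation, \<open>e\<close> and
  \<open>e'\<close> are arbitrary.\<close>
definition elem_map ::
  "('s, 'f, 'r) lang \<Rightarrow> ('s, 'f, 'r, 'u) struc \<Rightarrow> ('s, 'f, 'r, 'u) struc \<Rightarrow> 'u set \<Rightarrow>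
    ('u \<Rightarrow> 'u) \<Rightarrow> bool" where
  "elem_map L M N B h \<longleftrightarrow>
     (\<forall>s. \<forall>u\<in>B \<inter> univ M s. h u \<in> univ N s) \<and>
     (\<forall>\<theta>\<in>forms L M {} B. \<forall>e e'. sat M e \<theta> \<longleftrightarrow> sat N e' (move h \<theta>))"

lemma elem_map_mono: "elem_map L M N B h \<Longrightarrow> B' \<subseteq> B \<Longrightarrow> elem_map L M N B' h"
  unfolding elem_map_def using forms_mono[of "{}" "{}" B' B] by fast

lemma move_forms:
  assumes "elem_map L M N B h" "\<theta> \<in> forms L M V B"
  shows "move h \<theta> \<in> forms L N V (h ` B)"
proof -
  have "wf_form L N (move h \<theta>)"
    by (rule wf_par[of L M]) (use assms in \<open>auto simp: forms_def elem_map_def intro!: has_sort.intros\<close>)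
  then show ?thesis
    using assms fv_move[of h \<theta>] by (auto simp: forms_def params_par)
qed

lemma elem_map_sat:
  assumes "elem_map L M N B h" "\<theta> \<in> forms L M V B" "e \<in> vals M" "e ` V \<subseteq> B"
  shows "sat M e \<theta> \<longleftrightarrow> sat N (\<lambda>v. h (e v)) (move h \<theta>)"
proof -
  have "plug V e \<theta> \<in> forms L M {} B"
    using plug_forms[OF assms(2,3), of V] assms(4) by (simp add: Un_absorb2)
  then have "sat M e (plug V e \<theta>) \<longleftrightarrow> sat N (\<lambda>v. h (e v)) (move h (plug V e \<theta>))"
    using assms(1) by (simp add: elem_map_def)
  then show ?thesis by (simp add: sat_plug move_plug cong: if_cong)
qed

lemma elem_sub_wf:
  assumes "elem_sub L M N" "params \<phi> \<subseteq> points M"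
  shows "wf_form L N \<phi> \<longleftrightarrow> wf_form L M \<phi>"
proof
  have sub: "univ M s \<subseteq> univ N s" for s using assms(1) by (simp add: elem_sub_def)
  have "has_sort L M (Par u) s" if u: "u \<in> params \<phi>" "u \<in> univ N s" for u s
  proof -
    obtain t where "u \<in> univ M t" using u assms(2) unfolding points_def by blast
    then have "t = s"
      using sub[of t] u univ_sort[of L N u t s] assms(1) by (auto simp: elem_sub_def)
    then show ?thesis using \<open>u \<in> univ M t\<close> by (simp add: has_sort.intros)
  qed
  then show "wf_form L N \<phi> \<Longrightarrow> wf_form L M \<phi>"
    using wf_par[of L N \<phi> M Par] by (simp add: par_id)
  show "wf_form L M \<phi> \<Longrightarrow> wf_form L N \<phi>"
    using wf_par[of L M \<phi> N Par] sub by (auto simp: par_id intro: has_sort.intros)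
qed

lemma elem_sub_forms: "elem_sub L M N \<Longrightarrow> B \<subseteq> points M \<Longrightarrow> forms L N V B = forms L M V B"
  using elem_sub_wf by (fastforce simp: forms_def)

text \<open>Elementary substructures are defined by formulas without parameters; the parameters of \<open>\<phi>\<close> are
  turned into values of variables.\<close>
lemma elem_sub_sat:
  assumes "elem_sub L M N" "\<phi> \<in> forms L M V B" "e \<in> vals M"
  shows "sat N e \<phi> \<longleftrightarrow> sat M e \<phi>"
proof -
  have M: "is_struc L M" using assms(1) by (simp add: elem_sub_def)
  have wf: "wf_form L M \<phi>" using assms(2) by (simp add: forms_def)
  obtain Y \<psi> b where "finite Y" "Y \<inter> {} = {}" "Y \<inter> fv \<phi> = {}"
    and *: "b \<in> vals M" "b ` Y = params \<phi>" "\<psi> \<in> forms L M (fv \<phi> \<union> Y) {}"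
    and sat: "\<forall>M1 h e. sat M1 e (move h \<phi>) \<longleftrightarrow> sat M1 (\<lambda>v. if v \<in> Y then h (b v) else e v) \<psi>"
    by (rule abstract_params[OF wf M finite.emptyI])
  let ?e = "\<lambda>v. if v \<in> Y then b v else e v"
  have "?e \<in> vals M" using * assms(3) by (simp add: vals_def)
  moreover have "\<psi> \<in> forms L M UNIV {}"
    by (rule forms_mono[THEN subsetD, OF _ _ *(3)]) auto
  ultimately have "sat M ?e \<psi> \<longleftrightarrow> sat N ?e \<psi>" using assms(1) by (simp add: elem_sub_def)
  then show ?thesis
    using sat[rule_format, of M e "\<lambda>u. u"] sat[rule_format, of N e "\<lambda>u. u"] by (simp add: par_id)
qed

lemma elem_map_id_superstructure:
  assumes "elem_sub L M N" "B \<subseteq> points M"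
  shows "elem_map L N M B (\<lambda>u. u)"
  unfolding elem_map_def
proof (intro conjI allI ballI)
  fix s u assume "u \<in> B \<inter> univ N s"
  then obtain t where "u \<in> univ M t" "u \<in> univ N s"
    using assms(2) by (auto simp: points_def)
  moreover from this have "s = t"
    using assms(1) univ_sort[of L N u s t] by (auto simp: elem_sub_def)
  ultimately show "u \<in> univ M s" by simp
next
  fix \<theta> e e' assume "\<theta> \<in> forms L N {} B"
  then have \<theta>: "\<theta> \<in> forms L M {} B" using elem_sub_forms[OF assms] by simp
  obtain e0 where "e0 \<in> vals M" using vals_nonempty assms(1) by (auto simp: elem_sub_def)
  then show "sat N e \<theta> \<longleftrightarrow> sat M e' (move (\<lambda>u. u) \<theta>)"
    using elem_sub_sat[OF assms(1) \<theta>, of e0] sat_forms_cong[OF \<theta>, of e e0 N]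
      sat_forms_cong[OF \<theta>, of e' e0 M] by (simp add: par_id)
qed

lemma elem_map_id: "is_struc L M \<Longrightarrow> elem_map L M M B (\<lambda>u. u)"
  unfolding elem_map_def
proof (intro conjI ballI allI)
  fix \<theta> e e' assume "\<theta> \<in> forms L M {} B"
  then show "sat M e \<theta> \<longleftrightarrow> sat M e' (move (\<lambda>u. u) \<theta>)"
    using sat_forms_cong[of \<theta> L M "{}" B e e' M] by (simp add: par_id)
qed simp

text \<open>The element \<open>u'\<close> is only known to realize the image of the type of \<open>u\<close> in the one variable \<open>v\<close>,
  while the variable \<open>z\<close> that replaces \<open>u\<close> in a sentence has to avoid its bound variables. The formula
  \<open>\<forall>z. z = v \<longrightarrow> \<dots>\<close> passes from \<open>z\<close> to \<open>v\<close> without substituting under quantifiers.\<close>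

lemma elem_map_insert:
  fixes L :: "('s, 'f, 'r) lang" and M N :: "('s, 'f, 'r, 'u) struc"
  assumes h: "elem_map L M N B h" and M: "is_struc L M"
    and u: "u \<in> univ M (fst v)" and u': "u' \<in> univ N (fst v)"
    and sat: "\<And>\<theta>. \<theta> \<in> forms L M {v} B \<Longrightarrow> sat M (\<lambda>_. u) \<theta> \<longleftrightarrow> sat N (\<lambda>_. u') (move h \<theta>)"
  shows "elem_map L M N (insert u B) (h(u := u'))"
proof (cases "u \<in> B")
  case True
  have "Eq (Var v) (Par u) \<in> forms L M {v} B"
    using True u by (auto simp: forms_def intro: has_sort.intros)
  from sat[OF this] have "u' = h u" by simp
  then have "h(u := u') = h" by auto
  then show ?thesis using h True by (simp add: insert_absorb)
next
  case False
  let ?h = "h(u := u')"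
  show ?thesis
    unfolding elem_map_def
  proof (intro conjI allI ballI)
    fix s w assume "w \<in> insert u B \<inter> univ M s"
    then show "?h w \<in> univ N s"
      using h u' univ_sort[OF M u] False by (auto simp: elem_map_def)
  next
    fix \<theta> e e' assume \<theta>: "\<theta> \<in> forms L M {} (insert u B)"
    have "finite (snd ` (insert v (bv \<theta>)))" by (simp add: finite_bv)
    then obtain k where k: "\<And>w. w \<in> insert v (bv \<theta>) \<Longrightarrow> snd w < k"
      by (meson finite_nat_set_iff_bounded image_eqI)
    define z where "z = (fst v, k)"
    have z: "z \<noteq> v" "z \<notin> bv \<theta>" using k by (force simp: z_def)+
    define \<nu> :: "'u \<Rightarrow> ('s, 'f, 'u) tm" where "\<nu> = Par(u := Var z)"
    have \<nu>: "par \<nu> \<theta> \<in> forms L M {z} B"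
    proof -
      have "wf_form L M (par \<nu> \<theta>)"
      proof (rule wf_par)
        show "wf_form L M \<theta>" using \<theta> by (simp add: forms_def)
        show "has_sort L M (\<nu> w) s" if "w \<in> params \<theta>" "w \<in> univ M s" for w s
        proof (cases "w = u")
          case True
          then have "s = fst z" using univ_sort[OF M u] that by (simp add: z_def)
          then show ?thesis using True by (simp add: \<nu>_def has_sort.intros)
        qed (use that in \<open>simp add: \<nu>_def has_sort.intros\<close>)
      qed
      moreover have "fv (par \<nu> \<theta>) \<subseteq> {z}"
        by (rule order_trans[OF fv_par]) (use \<theta> in \<open>auto simp: forms_def \<nu>_def split: if_splits\<close>)
      moreover have "params (par \<nu> \<theta>) \<subseteq> B"
        using \<theta> by (auto simp: forms_def \<nu>_def params_par split: if_splits)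
      ultimately show ?thesis by (simp add: forms_def)
    qed
    let ?\<xi> = "All z (Neg (Conj (Eq (Var z) (Var v)) (Neg (par \<nu> \<theta>))))"
    have \<xi>: "?\<xi> \<in> forms L M {v} B"
      using \<nu> z by (auto simp: forms_def z_def intro!: exI[of _ "fst v"] intro: has_sort.intros
          has_sort.intros(1)[of L M "(fst v, k)", simplified])
    have "sat M e \<theta> \<longleftrightarrow> sat M (\<lambda>_. u) \<theta>"
      by (rule sat_forms_cong[OF \<theta>]) simp
    also have "\<dots> \<longleftrightarrow> sat M (\<lambda>_. u) (par \<nu> \<theta>)"
      using sat_par_cong[of \<theta> "\<lambda>_. u" M Par \<nu>] z by (simp add: \<nu>_def par_id)
    also have "\<dots> \<longleftrightarrow> sat M (\<lambda>_. u) ?\<xi>"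
      using z u by (auto simp: z_def fun_upd_idem)
    also have "\<dots> \<longleftrightarrow> sat N (\<lambda>_. u') (move h ?\<xi>)"
      by (rule sat[OF \<xi>])
    also have "\<dots> \<longleftrightarrow> sat N (\<lambda>_. u') (move h (par \<nu> \<theta>))"
      using z u' by (auto simp: z_def fun_upd_idem)
    also have "\<dots> \<longleftrightarrow> sat N (\<lambda>_. u') (move ?h \<theta>)"
      unfolding par_comp using z by (intro sat_par_cong) (auto simp: \<nu>_def)
    also have "\<dots> \<longleftrightarrow> sat N e' (move ?h \<theta>)"
      using \<theta> fv_move[of ?h \<theta>] by (intro sat_cong) (auto simp: forms_def)
    finally show "sat M e \<theta> \<longleftrightarrow> sat N e' (move ?h \<theta>)" .
  qed
qed

text \<open>The image of the type of \<open>u\<close> over \<open>B\<close> is finitely satisfiable, because \<open>h\<close> preserves existential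
  statements over \<open>B\<close>, and it is complete, because every formula over \<open>h ` B\<close> is the image of one over
  \<open>B\<close>. Saturation realizes it.\<close>
lemma elem_map_extend1:
  fixes L :: "('s, 'f, 'r) lang" and M N :: "('s, 'f, 'r, 'u) struc"
  assumes h: "elem_map L M N B h" and M: "is_struc L M" and N: "is_struc L N"
    and B: "B \<subseteq> points M" and sat: "saturated \<kappa> L N" and small: "|h ` B| <o \<kappa>"
    and u: "u \<in> univ M s"
  obtains u' where "u' \<in> univ N s" "elem_map L M N (insert u B) (h(u := u'))"
proof -
  define v :: "'s var" where "v = (s, 0)"
  define Q where "Q = move h ` {\<theta> \<in> forms L M {v} B. sat M (\<lambda>_. u) \<theta>}"
  have hB: "h ` B \<subseteq> points N"
  proof
    fix w assume "w \<in> h ` B"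
    then obtain z where z: "z \<in> B" "w = h z" by blast
    then obtain t where "z \<in> univ M t" using B by (auto simp: points_def)
    then have "w \<in> univ N t" using h z by (simp add: elem_map_def)
    then show "w \<in> points N" by (rule univ_points)
  qed
  have "Q \<in> types L N {v} (h ` B)"
    unfolding types_def mem_Collect_eq
  proof (intro conjI ballI allI impI)
    show "Q \<subseteq> forms L N {v} (h ` B)"
      using move_forms[OF h] by (auto simp: Q_def)
  next
    fix \<theta>' assume \<theta>': "\<theta>' \<in> forms L N {v} (h ` B)"
    define g where "g = inv_into B h"
    have g: "g w \<in> B" "h (g w) = w" if "w \<in> h ` B" for w
      using that by (auto simp: g_def inv_into_into f_inv_into_f)
    \<comment> \<open>Elements of \<open>h ` B\<close> have preimages of the same sort since the sorts are disjoint.\<close>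
    have "wf_form L M (move g \<theta>')"
    proof (rule wf_par)
      show "wf_form L N \<theta>'" using \<theta>' by (simp add: forms_def)
      fix w s assume "w \<in> params \<theta>'" and w: "w \<in> univ N s"
      then have "w \<in> h ` B" using \<theta>' by (auto simp: forms_def)
      then obtain t where t: "g w \<in> univ M t" using g(1) B by (auto simp: points_def)
      then have "w \<in> univ N t" using h g[OF \<open>w \<in> h ` B\<close>] by (force simp: elem_map_def)
      then have "s = t" using univ_sort[OF N w] by simp
      then show "has_sort L M (Par (g w)) s" using t by (simp add: has_sort.intros)
    qed
    then have mem: "move g \<theta>' \<in> forms L M {v} B"
      using \<theta>' fv_move[of g \<theta>'] g(1) by (auto simp: forms_def params_par)
    have eq: "move h (move g \<theta>') = \<theta>'"
      unfolding par_comp tm_par.simps by (rule move_fixed) (use \<theta>' g(2) in \<open>auto simp: forms_def\<close>)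
    show "\<theta>' \<in> Q \<or> Neg \<theta>' \<in> Q"
    proof (cases "sat M (\<lambda>_. u) (move g \<theta>')")
      case True
      then show ?thesis using mem eq by (force simp: Q_def)
    next
      case False
      then have "Neg (move g \<theta>') \<in> {\<theta> \<in> forms L M {v} B. sat M (\<lambda>_. u) \<theta>}"
        using mem by simp
      then have "move h (Neg (move g \<theta>')) \<in> Q" unfolding Q_def by blast
      then show ?thesis using eq by simp
    qed
  next
    fix F assume F: "F \<subseteq> Q \<and> finite F"
    then obtain F0 where F0: "finite F0" "F0 \<subseteq> {\<theta> \<in> forms L M {v} B. sat M (\<lambda>_. u) \<theta>}"
      "F = move h ` F0"
      using finite_subset_image[OF conjunct2[OF F] conjunct1[OF F, unfolded Q_def]] by blast
    have "F0 \<subseteq> forms L M {v} B" using F0 by auto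
    from finite_conj[OF F0(1) this] obtain \<theta> where \<theta>: "\<theta> \<in> forms L M {v} B"
      and conj: "\<And>M1 \<nu> e. sat M1 e (par \<nu> \<theta>) \<longleftrightarrow> (\<forall>\<phi>\<in>F0. sat M1 e (par \<nu> \<phi>))"
      by blast
    obtain e where e: "e \<in> vals N" using vals_nonempty[OF N] .
    have ex: "All v (Neg \<theta>) \<in> forms L M {} B" using \<theta> by (auto simp: forms_def)
    have "sat M (\<lambda>_. u) \<theta>" using conj[of M _ Par] F0(2) by (auto simp: par_id)
    then have "\<not> sat M (\<lambda>_. u) (All v (Neg \<theta>))"
      using u by (auto simp: v_def fun_upd_idem intro!: bexI[of _ u])
    moreover have "sat M (\<lambda>_. u) (All v (Neg \<theta>)) \<longleftrightarrow> sat N e (move h (All v (Neg \<theta>)))"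
      using h ex by (simp only: elem_map_def)
    ultimately have "\<not> sat N e (move h (All v (Neg \<theta>)))" by blast
    then obtain w where w: "w \<in> univ N (fst v)" "sat N (e(v := w)) (move h \<theta>)"
      by auto
    then have "e(v := w) \<in> vals N" "\<forall>\<phi>\<in>F. sat N (e(v := w)) \<phi>"
      using e conj F0(3) by (auto simp: vals_upd)
    then show "\<exists>e\<in>vals N. \<forall>\<phi>\<in>F. sat N e \<phi>" by blast
  qed
  from sat[unfolded saturated_def, rule_format, OF conjI[OF hB small] this]
  obtain u' where u': "u' \<in> univ N s" "tp1 L N v (h ` B) u' = Q"
    by (auto simp: v_def)
  have "sat M (\<lambda>_. u) \<theta> \<longleftrightarrow> sat N (\<lambda>_. u') (move h \<theta>)" if \<theta>: "\<theta> \<in> forms L M {v} B" for \<theta>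
  proof -
    have *: "sat N (\<lambda>_. u') (move h \<theta>)" if "sat M (\<lambda>_. u) \<theta>" "\<theta> \<in> forms L M {v} B" for \<theta>
      using that u'(2) by (auto simp: Q_def tp_def)
    from *[of \<theta>] *[of "Neg \<theta>"] \<theta> show ?thesis by auto
  qed
  then have "elem_map L M N (insert u B) (h(u := u'))"
    using elem_map_insert[OF h M, of u v u'] u u' by (auto simp: v_def)
  then show thesis using that u' by blast
qed


section \<open>Small sets\<close>

text \<open>A language has infinitely many formulas, because every sort has infinitely many variables.\<close>
lemma monster_infinite:
  assumes "monster \<kappa> L M"
  shows "\<not> finite (Field \<kappa>)"
proof -
  let ?f = "\<lambda>n :: nat. Eq (Var (undefined, n)) (Var (undefined, n))"
  have "has_sort L M (Var (undefined, n)) undefined" for n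
    using has_sort.intros(1)[of L M "(undefined, n)"] by simp
  then have "range ?f \<subseteq> forms L M UNIV {}"
    by (auto simp: forms_def intro!: exI[of _ undefined])
  moreover have "infinite (range ?f)"
    by (rule range_inj_infinite) (auto simp: inj_def)
  ultimately have "infinite (forms L M UNIV {})" using finite_subset by blast
  then have "|UNIV :: nat set| \<le>o |forms L M UNIV {}|"
    using infinite_iff_card_of_nat by blast
  then have "|UNIV :: nat set| \<le>o \<kappa>"
    using assms ordLeq_ordLess_trans ordLess_imp_ordLeq unfolding monster_def by blast
  also have "\<kappa> =o |Field \<kappa>|"
    using assms card_of_Field_ordIso ordIso_symmetric unfolding monster_def by blast
  finally show ?thesis using infinite_iff_card_of_nat by blast
qed

lemma small_Un: "monster \<kappa> L M \<Longrightarrow> |A| <o \<kappa> \<Longrightarrow> |B| <o \<kappa> \<Longrightarrow> |A \<union> B| <o \<kappa>"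
  using card_of_Un_ordLess_infinite_Field[of \<kappa>] monster_infinite unfolding monster_def by blast

lemma small_finite:
  assumes "monster \<kappa> L M" "finite B"
  shows "|B| <o \<kappa>"
proof (rule finite_ordLess_infinite)
  show "Well_order \<kappa>" using assms(1) by (auto simp: monster_def card_order_on_def)
  show "Well_order |B|" by (rule card_of_Well_order)
  show "finite (Field ( |B| ))" using assms(2) by (simp add: Field_card_of)
  show "infinite (Field \<kappa>)" by (rule monster_infinite[OF assms(1)])
qed

lemma small_image: "|B| <o \<kappa> \<Longrightarrow> |f ` B| <o \<kappa>"
  using card_of_image ordLeq_ordLess_trans by blast

text \<open>The base \<open>A\<close> stays fixed because new elements are added one at a time, and those that are already
  in \<open>A\<close> are skipped.\<close>
lemma elem_map_extend:
  assumes M': "monster \<kappa>' L M'" and M: "monster \<kappa> L M" and sub: "elem_sub L M M'"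
    and A: "A \<subseteq> points M" "|A| <o \<kappa>" and B: "finite B" "B \<subseteq> points M'"
  obtains h where "\<forall>u\<in>A. h u = u" "elem_map L M' M (A \<union> B) h"
proof -
  have "\<exists>h. (\<forall>u\<in>A. h u = u) \<and> elem_map L M' M (A \<union> B) h"
    using B
  proof (induction B)
    case empty
    then show ?case using elem_map_id_superstructure[OF sub A(1)] by auto
  next
    case (insert u B)
    then obtain h where h: "\<forall>u\<in>A. h u = u" "elem_map L M' M (A \<union> B) h" by auto
    have AM': "A \<subseteq> points M'"
      using A(1) sub by (fastforce simp: points_def elem_sub_def)
    show ?case
    proof (cases "u \<in> A")
      case True
      then have "A \<union> insert u B = A \<union> B" by auto
      then show ?thesis using h by auto
    next
      case False
      have "|h ` (A \<union> B)| <o \<kappa>"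
        using small_Un[OF M A(2) small_finite[OF M insert(1)]] by (rule small_image)
      moreover obtain s where "u \<in> univ M' s" using insert by (auto simp: points_def)
      moreover have "is_struc L M'" "is_struc L M" "saturated \<kappa> L M"
        using M M' by (simp_all add: monster_def)
      moreover have "A \<union> B \<subseteq> points M'" using AM' insert.prems by simp
      ultimately obtain u' where "elem_map L M' M (insert u (A \<union> B)) (h(u := u'))"
        using elem_map_extend1[OF h(2)] by metis
      then have "elem_map L M' M (A \<union> insert u B) (h(u := u'))" by simp
      moreover have "\<forall>w\<in>A. (h(u := u')) w = w" using h(1) False by auto
      ultimately show ?thesis by blast
    qed
  qed
  then show thesis using that by blast
qed

section \<open>Complete types\<close>

lemma typesD:
  assumes "p \<in> types L M V A"
  shows "p \<subseteq> forms L M V A" "\<And>\<phi>. \<phi> \<in> forms L M V A \<Longrightarrow> \<phi> \<in> p \<or> Neg \<phi> \<in> p"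
    "\<And>F. F \<subseteq> p \<Longrightarrow> finite F \<Longrightarrow> \<exists>e\<in>vals M. \<forall>\<phi>\<in>F. sat M e \<phi>"
  using assms by (auto simp: types_def)

text \<open>A complete finitely satisfiable set is deductively closed; most facts about types below are
  instances of this one.\<close>
lemma types_conseq:
  assumes p: "p \<in> types L M V A" and F: "finite F" "F \<subseteq> p" and \<phi>: "\<phi> \<in> forms L M V A"
    and cons: "\<And>e. e \<in> vals M \<Longrightarrow> (\<And>\<theta>. \<theta> \<in> F \<Longrightarrow> sat M e \<theta>) \<Longrightarrow> sat M e \<phi>"
  shows "\<phi> \<in> p"
proof (rule ccontr)
  assume "\<phi> \<notin> p"
  then have "insert (Neg \<phi>) F \<subseteq> p" "finite (insert (Neg \<phi>) F)"
    using typesD(2)[OF p \<phi>] F by auto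
  then obtain e where "e \<in> vals M" "\<forall>\<theta>\<in>insert (Neg \<phi>) F. sat M e \<theta>"
    using typesD(3)[OF p] by blast
  then show False using cons by auto
qed

lemma types_equiv:
  assumes p: "p \<in> types L M V A" and "\<phi> \<in> forms L M V A" "\<psi> \<in> forms L M V A"
    and "\<And>e. e \<in> vals M \<Longrightarrow> sat M e \<phi> \<longleftrightarrow> sat M e \<psi>"
  shows "\<phi> \<in> p \<longleftrightarrow> \<psi> \<in> p"
  using types_conseq[OF p, of "{\<phi>}" \<psi>] types_conseq[OF p, of "{\<psi>}" \<phi>] assms by auto

lemma types_Neg:
  assumes p: "p \<in> types L M V A" and \<phi>: "\<phi> \<in> forms L M V A"
  shows "Neg \<phi> \<in> p \<longleftrightarrow> \<phi> \<notin> p"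
  using typesD(2)[OF p \<phi>] typesD(3)[OF p, of "{\<phi>, Neg \<phi>}"] by auto

lemma types_Conj:
  assumes p: "p \<in> types L M V A" and "\<phi> \<in> forms L M V A" "\<psi> \<in> forms L M V A"
  shows "Conj \<phi> \<psi> \<in> p \<longleftrightarrow> \<phi> \<in> p \<and> \<psi> \<in> p"
proof
  show "Conj \<phi> \<psi> \<in> p" if "\<phi> \<in> p \<and> \<psi> \<in> p"
    by (rule types_conseq[OF p, of "{\<phi>, \<psi>}"]) (use that assms in auto)
  show "\<phi> \<in> p \<and> \<psi> \<in> p" if *: "Conj \<phi> \<psi> \<in> p"
  proof
    show "\<phi> \<in> p" by (rule types_conseq[OF p, of "{Conj \<phi> \<psi>}"]) (use * assms in auto)
    show "\<psi> \<in> p" by (rule types_conseq[OF p, of "{Conj \<phi> \<psi>}"]) (use * assms in auto)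
  qed
qed

lemma types_restrict:
  assumes "p \<in> types L M V A" "B \<subseteq> A"
  shows "p \<inter> forms L M V B \<in> types L M V B"
  unfolding types_def mem_Collect_eq
proof (intro conjI ballI allI impI)
  fix \<phi> assume "\<phi> \<in> forms L M V B"
  then show "\<phi> \<in> p \<inter> forms L M V B \<or> Neg \<phi> \<in> p \<inter> forms L M V B"
    using typesD(2)[OF assms(1), of \<phi>] forms_mono[of V V B A L M] assms(2) by auto
qed (use typesD(3)[OF assms(1)] in auto)

lemma types_eqI:
  assumes "p \<in> types L M V A" "q \<in> types L M V A" "p \<subseteq> q"
  shows "p = q"
proof -
  have "\<phi> \<in> p" if "\<phi> \<in> q" for \<phi>
  proof -
    have "\<phi> \<in> forms L M V A" using that typesD(1)[OF assms(2)] by blast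
    then show ?thesis using types_Neg[OF assms(1)] types_Neg[OF assms(2)] that assms(3) by blast
  qed
  then show ?thesis using assms(3) by blast
qed

lemma realize:
  assumes M: "monster \<kappa> L M" and p: "p \<in> types L M {x} A" and B: "B \<subseteq> A" "B \<subseteq> points M" "|B| <o \<kappa>"
  obtains d where "d \<in> univ M (fst x)" "tp1 L M x B d = p \<inter> forms L M {x} B"
proof -
  have "saturated \<kappa> L M" using M by (simp add: monster_def)
  from this[unfolded saturated_def, rule_format, OF conjI[OF B(2,3)] types_restrict[OF p B(1)]]
  show thesis using that by blast
qed

lemma mem_tp1:
  "\<phi> \<in> forms L M {x} B \<Longrightarrow> \<phi> \<in> tp1 L M x B d \<longleftrightarrow> sat M (\<lambda>_. d) \<phi>"
  by (simp add: tp_def)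

lemma types_superstructure:
  assumes sub: "elem_sub L M N" and p: "p \<in> types L M V (points M)"
  shows "p \<in> types L N V (points M)"
  unfolding types_def mem_Collect_eq elem_sub_forms[OF sub subset_refl]
proof (intro conjI ballI allI impI)
  fix F assume F: "F \<subseteq> p \<and> finite F"
  then obtain e where e: "e \<in> vals M" "\<forall>\<phi>\<in>F. sat M e \<phi>" using typesD(3)[OF p] by blast
  have "e \<in> vals N" using e(1) sub by (auto simp: vals_def elem_sub_def)
  moreover have "\<forall>\<phi>\<in>F. sat N e \<phi>"
    using e F typesD(1)[OF p] elem_sub_sat[OF sub _ e(1)] by blast
  ultimately show "\<exists>e\<in>vals N. \<forall>\<phi>\<in>F. sat N e \<phi>" by blast
qed (use typesD[OF p] in auto)

section \<open>Invariant types and their products\<close>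

lemma tp1_mono:
  assumes "tp1 L M x B d = p \<inter> forms L M {x} B" "B' \<subseteq> B"
  shows "tp1 L M x B' d = p \<inter> forms L M {x} B'"
  using assms(1) forms_mono[OF subset_refl assms(2), of L M "{x}"] by (fastforce simp: tp_def)

text \<open>Invariance in terms of elementary maps. Both images of \<open>\<theta>\<close> come from the same parameter-free
  formula, and the two tuples plugged into it have the same type over \<open>A\<close>, namely that of the original
  tuple in \<open>M0\<close>. It is used for \<open>M0\<close> an elementary extension of \<open>M\<close>, where it makes the invariant
  extension well defined, and for \<open>M0 = M\<close>.\<close>
lemma invariant_type_move:
  assumes p: "p \<in> types L M {x} (points M)" and inv: "invariant_type L M x A p"
    and A: "A \<subseteq> points M" and M: "is_struc L M" and M0: "is_struc L M0"
    and AM0: "\<And>Y. forms L M Y A \<subseteq> forms L M0 Y A"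
    and \<theta>: "\<theta> \<in> forms L M0 {x} (points M0)"
    and h1: "elem_map L M0 M (A \<union> params \<theta>) h1" "\<And>u. u \<in> A \<Longrightarrow> h1 u = u"
    and h2: "elem_map L M0 M (A \<union> params \<theta>) h2" "\<And>u. u \<in> A \<Longrightarrow> h2 u = u"
  shows "move h1 \<theta> \<in> p \<longleftrightarrow> move h2 \<theta> \<in> p"
proof -
  have wf: "wf_form L M0 \<theta>" using \<theta> by (simp add: forms_def)
  obtain Y \<psi> b where Y: "finite Y" "Y \<inter> {x} = {}" "Y \<inter> fv \<theta> = {}"
    and b: "b \<in> vals M0" "b ` Y = params \<theta>" and \<psi>: "\<psi> \<in> forms L M0 (fv \<theta> \<union> Y) {}"
    and sat: "\<forall>M1 h e. sat M1 e (move h \<theta>) \<longleftrightarrow> sat M1 (\<lambda>v. if v \<in> Y then h (b v) else e v) \<psi>"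
    by (rule abstract_params[OF wf M0, of "{x}"]) simp
  have "wf_form L M (par Par \<psi>)"
    by (rule wf_par[of L M0]) (use \<psi> in \<open>auto simp: forms_def\<close>)
  then have \<psi>M: "\<psi> \<in> forms L M (insert x Y) A"
    using \<psi> \<theta> by (auto simp: par_id forms_def)
  obtain e0 where e0: "e0 \<in> vals M" using vals_nonempty[OF M] .
  define c where "c h = (\<lambda>v. if v \<in> Y then h (b v) else e0 v)" for h
  have vals: "c h \<in> vals M" if "elem_map L M0 M (A \<union> params \<theta>) h" for h
  proof -
    have "h (b v) \<in> univ M (fst v)" if v: "v \<in> Y" for v
    proof -
      have "b v \<in> params \<theta>" using v b(2) by blast
      then show ?thesis
        using vals_univ[OF b(1)] \<open>elem_map L M0 M (A \<union> params \<theta>) h\<close> by (simp add: elem_map_def)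
    qed
    then show ?thesis using vals_univ[OF e0] by (intro valsI) (simp add: c_def)
  qed
  have type: "sat M (c h) \<xi> \<longleftrightarrow> sat M0 b \<xi>"
    if h: "elem_map L M0 M (A \<union> params \<theta>) h" "\<And>u. u \<in> A \<Longrightarrow> h u = u"
      and \<xi>: "\<xi> \<in> forms L M Y A" for h \<xi>
  proof -
    have "\<xi> \<in> forms L M0 Y (A \<union> params \<theta>)"
      using \<xi> AM0[of Y] forms_mono[of Y Y A "A \<union> params \<theta>" L M0] by blast
    then have "sat M0 b \<xi> \<longleftrightarrow> sat M (\<lambda>v. h (b v)) (move h \<xi>)"
      by (rule elem_map_sat[OF h(1) _ b(1)]) (simp add: b(2))
    also have "move h \<xi> = \<xi>"
      by (rule move_fixed) (use h(2) \<xi> in \<open>auto simp: forms_def\<close>)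
    also have "sat M (\<lambda>v. h (b v)) \<xi> \<longleftrightarrow> sat M (c h) \<xi>"
      by (rule sat_forms_cong[OF \<xi>]) (simp add: c_def)
    finally show ?thesis by simp
  qed
  have "tp L M Y A (c h1) = tp L M Y A (c h2)"
    using type[OF h1] type[OF h2] by (auto simp: tp_def)
  then have "plug Y (c h1) \<psi> \<in> p \<longleftrightarrow> plug Y (c h2) \<psi> \<in> p"
    using inv Y(1,2) \<psi>M vals[OF h1(1)] vals[OF h2(1)] unfolding invariant_type_def by blast
  moreover have "move h \<theta> \<in> p \<longleftrightarrow> plug Y (c h) \<psi> \<in> p"
    if h: "elem_map L M0 M (A \<union> params \<theta>) h" for h
  proof (rule types_equiv[OF p])
    have \<theta>A: "\<theta> \<in> forms L M0 {x} (A \<union> params \<theta>)" using \<theta> by (simp add: forms_def)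
    show "move h \<theta> \<in> forms L M {x} (points M)"
      using move_forms[OF h \<theta>A] forms_points[OF move_forms[OF h \<theta>A]] by (simp add: forms_def)
    have "plug Y (c h) \<psi> \<in> forms L M (insert x Y - Y) (A \<union> c h ` (insert x Y \<inter> Y))"
      by (rule plug_forms[OF \<psi>M vals[OF h]])
    then show "plug Y (c h) \<psi> \<in> forms L M {x} (points M)"
      using forms_points[of "plug Y (c h) \<psi>"] by (auto simp: forms_def)
    show "sat M e (move h \<theta>) \<longleftrightarrow> sat M e (plug Y (c h) \<psi>)" for e
      using sat by (simp add: sat_plug c_def cong: if_cong)
  qed
  ultimately show ?thesis using h1(1) h2(1) by blast
qed

locale monster_pair =
  fixes \<kappa> :: "'k rel" and \<kappa>' :: "'l rel" and L :: "('s, 'f, 'r) lang"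
    and M M' :: "('s, 'f, 'r, 'u) struc"
  assumes M: "monster \<kappa> L M" and M': "monster \<kappa>' L M'" and sub: "elem_sub L M M'"
    and small: "|points M| <o \<kappa>'"
begin

lemma struc: "is_struc L M" "is_struc L M'"
  using M M' by (simp_all add: monster_def)

lemma points_sub: "points M \<subseteq> points M'"
  using sub by (fastforce simp: points_def elem_sub_def)

lemma sat_sub: "\<phi> \<in> forms L M {x} B \<Longrightarrow> d \<in> univ M (fst x) \<Longrightarrow> sat M' (\<lambda>_. d) \<phi> \<longleftrightarrow> sat M (\<lambda>_. d) \<phi>"
proof -
  assume \<phi>: "\<phi> \<in> forms L M {x} B" and d: "d \<in> univ M (fst x)"
  obtain e where "e \<in> vals M" using vals_nonempty[OF struc(1)] .
  then have "e(x := d) \<in> vals M" using d by (rule vals_upd)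
  from elem_sub_sat[OF sub \<phi> this] show ?thesis
    using sat_forms1[OF \<phi>, of M "e(x := d)"] sat_forms1[OF \<phi>, of M' "e(x := d)"] by simp
qed

text \<open>The unique \<open>A\<close>-invariant extension of \<open>p\<close> to \<open>M'\<close>: a formula belongs to it if \<open>p\<close> contains a copy of
  the formula over \<open>M\<close> whose parameters have the same type over \<open>A\<close>.\<close>
definition inv_ext :: "'s var \<Rightarrow> 'u set \<Rightarrow> ('s, 'f, 'r, 'u) form set \<Rightarrow> ('s, 'f, 'r, 'u) form set" where
  "inv_ext x A p = {\<theta> \<in> forms L M' {x} (points M').
     \<exists>h. (\<forall>u\<in>A. h u = u) \<and> elem_map L M' M (A \<union> params \<theta>) h \<and> move h \<theta> \<in> p}"

context
  fixes x :: "'s var" and A :: "'u set" and p :: "('s, 'f, 'r, 'u) form set"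
  assumes A: "A \<subseteq> points M" "|A| <o \<kappa>"
    and p: "p \<in> types L M {x} (points M)" and inv: "invariant_type L M x A p"
begin

text \<open>By invariance of \<open>p\<close> every elementary \<open>h\<close> over \<open>A\<close> gives the same answer. Hence finitely many formulas
  can be tested with one common \<open>h\<close>.\<close>
lemma mem_inv_ext:
  assumes \<theta>: "\<theta> \<in> forms L M' {x} (points M')" and h: "\<And>u. u \<in> A \<Longrightarrow> h u = u"
    and B: "elem_map L M' M B h" "A \<subseteq> B" "params \<theta> \<subseteq> B"
  shows "\<theta> \<in> inv_ext x A p \<longleftrightarrow> move h \<theta> \<in> p"
proof -
  have h': "elem_map L M' M (A \<union> params \<theta>) h"
    using elem_map_mono[OF B(1)] B(2,3) by simp
  have forms: "forms L M Y A \<subseteq> forms L M' Y A" for Y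
    using elem_sub_forms[OF sub A(1)] by simp
  have "move h \<theta> \<in> p" if "elem_map L M' M (A \<union> params \<theta>) h1" "\<forall>u\<in>A. h1 u = u" "move h1 \<theta> \<in> p" for h1
    using invariant_type_move[OF p inv A(1) struc forms \<theta> that(1) _ h' h] that(2,3) by blast
  then show ?thesis using \<theta> h h' by (auto simp: inv_ext_def)
qed

text \<open>A single \<open>h\<close> moves finitely many formulas of the extension into \<open>p\<close>, where they are jointly
  satisfiable, and existential sentences are reflected by \<open>h\<close>.\<close>
lemma inv_ext_types: "inv_ext x A p \<in> types L M' {x} (points M')"
  unfolding types_def mem_Collect_eq
proof (intro conjI ballI allI impI)
  show "inv_ext x A p \<subseteq> forms L M' {x} (points M')" by (auto simp: inv_ext_def)
next
  fix \<theta> assume \<theta>: "\<theta> \<in> forms L M' {x} (points M')"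
  obtain h where h0: "\<forall>u\<in>A. h u = u" "elem_map L M' M (A \<union> params \<theta>) h"
    by (rule elem_map_extend[OF M' M sub A finite_params[of \<theta>] forms_points[OF \<theta>]])
  then have h: "\<And>u. u \<in> A \<Longrightarrow> h u = u" "elem_map L M' M (A \<union> params \<theta>) h" by auto
  have "move h \<theta> \<in> forms L M {x} (points M)"
    using move_forms[OF h(2), of \<theta> "{x}"] \<theta> forms_points[OF move_forms[OF h(2), of \<theta> "{x}"]]
    by (auto simp: forms_def)
  then have "move h \<theta> \<in> p \<or> move h (Neg \<theta>) \<in> p" using typesD(2)[OF p] by simp
  then show "\<theta> \<in> inv_ext x A p \<or> Neg \<theta> \<in> inv_ext x A p"
    using mem_inv_ext[OF \<theta> h] mem_inv_ext[OF _ h, of "Neg \<theta>"] \<theta> by auto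
next
  fix F assume F: "F \<subseteq> inv_ext x A p \<and> finite F"
  then have forms: "F \<subseteq> forms L M' {x} (points M')" by (auto simp: inv_ext_def)
  define B where "B = (\<Union>\<phi>\<in>F. params \<phi>)"
  have B: "finite B" "B \<subseteq> points M'"
    using F forms by (auto simp: B_def finite_params forms_def)
  obtain h where h0: "\<forall>u\<in>A. h u = u" "elem_map L M' M (A \<union> B) h"
    by (rule elem_map_extend[OF M' M sub A B])
  then have h: "\<And>u. u \<in> A \<Longrightarrow> h u = u" "elem_map L M' M (A \<union> B) h" by auto
  have in_p: "move h \<phi> \<in> p" if "\<phi> \<in> F" for \<phi>
    using mem_inv_ext[of \<phi>, OF _ h] that F forms by (auto simp: B_def)
  have FB: "F \<subseteq> forms L M' {x} (A \<union> B)"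
    using forms by (auto simp: forms_def B_def)
  from finite_conj[OF _ FB] F obtain \<theta> where \<theta>: "\<theta> \<in> forms L M' {x} (A \<union> B)"
    and conj: "\<And>M1 \<nu> e. sat M1 e (par \<nu> \<theta>) \<longleftrightarrow> (\<forall>\<phi>\<in>F. sat M1 e (par \<nu> \<phi>))" by blast
  obtain e where e: "e \<in> vals M" "\<forall>\<phi>\<in>move h ` F. sat M e \<phi>"
    using typesD(3)[OF p, of "move h ` F"] in_p F by blast
  then have "sat M (e(x := e x)) (move h \<theta>)" "e x \<in> univ M (fst x)"
    using conj vals_univ[OF e(1)] by auto
  then have "\<not> sat M e (move h (All x (Neg \<theta>)))" by (auto intro: bexI[of _ "e x"])
  moreover have "All x (Neg \<theta>) \<in> forms L M' {} (A \<union> B)"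
    using \<theta> by (auto simp: forms_def)
  moreover obtain e' where e': "e' \<in> vals M'" using vals_nonempty[OF struc(2)] .
  ultimately have "\<not> sat M' e' (All x (Neg \<theta>))"
    using h(2) by (simp only: elem_map_def) blast
  then obtain w where "w \<in> univ M' (fst x)" "sat M' (e'(x := w)) \<theta>" by auto
  then have "e'(x := w) \<in> vals M'" "\<forall>\<phi>\<in>F. sat M' (e'(x := w)) \<phi>"
    using e' conj[of M' _ Par] by (auto simp: vals_upd par_id)
  then show "\<exists>e\<in>vals M'. \<forall>\<phi>\<in>F. sat M' e \<phi>" by blast
qed

lemma inv_ext_superset: "p \<subseteq> inv_ext x A p"
proof
  fix \<theta> assume \<theta>: "\<theta> \<in> p"
  then have \<theta>M: "\<theta> \<in> forms L M {x} (points M)" using typesD(1)[OF p] by blast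
  then have \<theta>M': "\<theta> \<in> forms L M' {x} (points M')"
    using elem_sub_forms[OF sub subset_refl] forms_mono[OF subset_refl points_sub] by fast
  show "\<theta> \<in> inv_ext x A p"
    using mem_inv_ext[OF \<theta>M' _ elem_map_id_superstructure[OF sub subset_refl] A(1) forms_points[OF \<theta>M]] \<theta>
    by (simp add: par_id)
qed

text \<open>One \<open>h\<close> that is defined on both tuples takes them to tuples of \<open>M\<close> with the same type over \<open>A\<close>.\<close>
lemma inv_ext_invariant: "invariant_type L M' x A (inv_ext x A p)"
  unfolding invariant_type_def
proof (intro allI impI ballI)
  fix Y \<psi> b c
  assume Y: "finite Y \<and> x \<notin> Y \<and> \<psi> \<in> forms L M' (insert x Y) A"
    and b: "b \<in> vals M'" and c: "c \<in> vals M'" and eq: "tp L M' Y A b = tp L M' Y A c"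
  have \<psi>': "\<psi> \<in> forms L M' (insert x Y) A" using Y by simp
  then have \<psi>: "\<psi> \<in> forms L M (insert x Y) A" using elem_sub_forms[OF sub A(1)] by simp
  have BC: "finite (b ` Y \<union> c ` Y)" "b ` Y \<union> c ` Y \<subseteq> points M'"
    using Y univ_points[OF vals_univ[OF b]] univ_points[OF vals_univ[OF c]] by auto
  obtain h where h0: "\<forall>u\<in>A. h u = u" "elem_map L M' M (A \<union> (b ` Y \<union> c ` Y)) h"
    by (rule elem_map_extend[OF M' M sub A BC])
  then have h: "\<And>u. u \<in> A \<Longrightarrow> h u = u" "elem_map L M' M (A \<union> (b ` Y \<union> c ` Y)) h" by auto
  obtain e0 where e0: "e0 \<in> vals M" using vals_nonempty[OF struc(1)] .
  define d where "d f = (\<lambda>v. if v \<in> Y then h (f v) else e0 v)" for f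
  have d: "d f \<in> vals M" if f: "f \<in> vals M'" "f ` Y \<subseteq> b ` Y \<union> c ` Y" for f
  proof -
    have "h (f v) \<in> univ M (fst v)" if v: "v \<in> Y" for v
    proof -
      have "f v \<in> A \<union> (b ` Y \<union> c ` Y)" using v f(2) by blast
      then show ?thesis using h(2) vals_univ[OF f(1)] unfolding elem_map_def by blast
    qed
    then show ?thesis using vals_univ[OF e0] by (intro valsI) (simp add: d_def)
  qed
  have plug: "plug Y f \<psi> \<in> inv_ext x A p \<longleftrightarrow> plug Y (d f) \<psi> \<in> p"
    if f: "f \<in> vals M'" "f ` Y \<subseteq> b ` Y \<union> c ` Y" for f
  proof -
    have "plug Y f \<psi> \<in> forms L M' (insert x Y - Y) (A \<union> f ` (insert x Y \<inter> Y))"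
      by (rule plug_forms[OF \<psi>' f(1)])
    then have "plug Y f \<psi> \<in> forms L M' {x} (A \<union> (b ` Y \<union> c ` Y))"
      using f(2) forms_mono[of "insert x Y - Y" "{x}" "A \<union> f ` (insert x Y \<inter> Y)" "A \<union> (b ` Y \<union> c ` Y)" L M']
      by blast
    moreover from this have "plug Y f \<psi> \<in> forms L M' {x} (points M')"
      using forms_points by (fastforce simp: forms_def)
    ultimately have "plug Y f \<psi> \<in> inv_ext x A p \<longleftrightarrow> move h (plug Y f \<psi>) \<in> p"
      using mem_inv_ext[OF _ h] by (auto simp: forms_def)
    also have "move h (plug Y f \<psi>) = plug Y (\<lambda>v. h (f v)) \<psi>"
    proof -
      have "move h \<psi> = \<psi>" by (rule move_fixed) (use h(1) \<psi> in \<open>auto simp: forms_def\<close>)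
      then show ?thesis by (simp add: move_plug)
    qed
    also have "\<dots> = plug Y (d f) \<psi>"
      unfolding plug_def d_def by (simp cong: if_cong)
    finally show ?thesis .
  qed
  have type: "sat M (d f) \<xi> \<longleftrightarrow> sat M' f \<xi>"
    if f: "f \<in> vals M'" "f ` Y \<subseteq> b ` Y \<union> c ` Y" and \<xi>: "\<xi> \<in> forms L M Y A" for f \<xi>
  proof -
    have "\<xi> \<in> forms L M' Y (A \<union> (b ` Y \<union> c ` Y))"
      using \<xi> elem_sub_forms[OF sub A(1)] forms_mono[of Y Y A "A \<union> (b ` Y \<union> c ` Y)" L M'] by auto
    then have "sat M' f \<xi> \<longleftrightarrow> sat M (\<lambda>v. h (f v)) (move h \<xi>)"
      by (rule elem_map_sat[OF h(2) _ f(1)]) (use f(2) in auto)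
    also have "move h \<xi> = \<xi>"
      by (rule move_fixed) (use h(1) \<xi> in \<open>auto simp: forms_def\<close>)
    also have "sat M (\<lambda>v. h (f v)) \<xi> \<longleftrightarrow> sat M (d f) \<xi>"
      by (rule sat_forms_cong[OF \<xi>]) (simp add: d_def)
    finally show ?thesis by simp
  qed
  have "sat M' b \<xi> \<longleftrightarrow> sat M' c \<xi>" if "\<xi> \<in> forms L M Y A" for \<xi>
    using eq that elem_sub_forms[OF sub A(1)] by (auto simp: tp_def)
  then have "tp L M Y A (d b) = tp L M Y A (d c)"
    using type[of b] type[of c] b c by (auto simp: tp_def)
  then have "plug Y (d b) \<psi> \<in> p \<longleftrightarrow> plug Y (d c) \<psi> \<in> p"
    using inv Y \<psi> d[of b] d[of c] b c unfolding invariant_type_def by blast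
  then show "plug Y b \<psi> \<in> inv_ext x A p \<longleftrightarrow> plug Y c \<psi> \<in> inv_ext x A p"
    using plug[of b] plug[of c] b c by simp
qed

end

text \<open>\<open>is_type_prod\<close> with its base model \<open>A\<close> exposed. The characterization of membership below holds for
  realizations over \<open>A\<close>, and the proof of minimality needs the same \<open>A\<close> for all types of a support.\<close>
definition is_type_prod_over ::
  "'u set \<Rightarrow> 'f \<Rightarrow> 's var \<Rightarrow> ('s, 'f, 'r, 'u) form set \<Rightarrow> ('s, 'f, 'r, 'u) form set \<Rightarrow>
    ('s, 'f, 'r, 'u) form set \<Rightarrow> bool" where
  "is_type_prod_over A m x p q r \<longleftrightarrow>
     (\<exists>p' a b. small_model \<kappa> L M A \<and> invariant_type L M x A p \<and> invariant_type L M x A q \<and>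
        p' \<in> types L M' {x} (points M') \<and> p \<subseteq> p' \<and> invariant_type L M' x A p' \<and>
        a \<in> univ M' (fst x) \<and> b \<in> univ M' (fst x) \<and>
        tp1 L M' x (points M) b = q \<and>
        tp1 L M' x (insert b (points M)) a = p' \<inter> forms L M' {x} (insert b (points M)) \<and>
        r = tp1 L M' x (points M) (fun_int M' m [a, b]))"

lemma is_type_prod_iff:
  "is_type_prod \<kappa> L m M M' x p q r \<longleftrightarrow> (\<exists>A. is_type_prod_over A m x p q r)"
  unfolding is_type_prod_def is_type_prod_over_def by (rule refl)

text \<open>Membership in \<open>p * q\<close> can be tested inside \<open>M\<close>. The product is the type of \<open>a \<cdot> b\<close> for \<open>b \<Turnstile> q\<close> in \<open>M'\<close>,
  so \<open>\<theta> \<in> p * q\<close> iff \<open>\<theta>(x \<cdot> b) \<in> p'\<close>. Exchanging \<open>b\<close> for an element \<open>d\<close> of \<open>M\<close> with the same type over \<open>A\<close>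
  and the parameters of \<open>\<theta>\<close> does not matter to the invariant type \<open>p'\<close>, and \<open>\<theta>(x \<cdot> d)\<close> has its
  parameters in \<open>M\<close>, where \<open>p'\<close> agrees with \<open>p\<close>.\<close>
lemma is_type_prod_over_mem:
  assumes r: "is_type_prod_over A m x p q r"
    and p: "p \<in> types L M {x} (points M)"
    and G: "expands_group L m (fst x) M"
  shows "A \<subseteq> points M \<and> |A| <o \<kappa> \<and> r \<subseteq> forms L M {x} (points M) \<and>
    (\<forall>\<theta>\<in>forms L M {x} (points M). \<forall>d\<in>univ M (fst x).
      tp1 L M x (A \<union> params \<theta>) d = q \<inter> forms L M {x} (A \<union> params \<theta>) \<longrightarrow>
      (\<theta> \<in> r \<longleftrightarrow> rshift m x d \<theta> \<in> p))"
proof -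
  obtain p' a b where A: "small_model \<kappa> L M A" and
      p': "p' \<in> types L M' {x} (points M')" "p \<subseteq> p'" "invariant_type L M' x A p'" and
      ab: "a \<in> univ M' (fst x)" "b \<in> univ M' (fst x)" and
      b: "tp1 L M' x (points M) b = q" and
      a: "tp1 L M' x (insert b (points M)) a = p' \<inter> forms L M' {x} (insert b (points M))" and
      r: "r = tp1 L M' x (points M) (fun_int M' m [a, b])"
    using r unfolding is_type_prod_over_def by blast
  have A': "A \<subseteq> points M" "|A| <o \<kappa>" using A by (simp_all add: small_model_def)
  have forms: "forms L M' V (points M) = forms L M V (points M)" for V
    by (rule elem_sub_forms[OF sub subset_refl])
  show ?thesis
  proof (intro conjI A')
    show "r \<subseteq> forms L M {x} (points M)" unfolding r using forms by (auto simp: tp_def)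
  next
    show "\<forall>\<theta>\<in>forms L M {x} (points M). \<forall>d\<in>univ M (fst x).
      tp1 L M x (A \<union> params \<theta>) d = q \<inter> forms L M {x} (A \<union> params \<theta>) \<longrightarrow>
      (\<theta> \<in> r \<longleftrightarrow> rshift m x d \<theta> \<in> p)"
    proof (intro ballI impI)
      fix \<theta> d assume \<theta>: "\<theta> \<in> forms L M {x} (points M)" and d: "d \<in> univ M (fst x)"
        and tpd: "tp1 L M x (A \<union> params \<theta>) d = q \<inter> forms L M {x} (A \<union> params \<theta>)"
      define B where "B = A \<union> params \<theta>"
      have B: "B \<subseteq> points M" using A' forms_points[OF \<theta>] by (simp add: B_def)
      have \<theta>': "\<theta> \<in> forms L M' {x} (points M)" using \<theta> forms by simp
      have d': "d \<in> univ M' (fst x)" using d sub by (auto simp: elem_sub_def)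
      have agree: "sat M' (\<lambda>_. b) \<xi> \<longleftrightarrow> sat M' (\<lambda>_. d) \<xi>" if "\<xi> \<in> forms L M' {x} B" for \<xi>
      proof -
        have \<xi>: "\<xi> \<in> forms L M {x} B" using that elem_sub_forms[OF sub B] by simp
        have "\<xi> \<in> forms L M' {x} (points M)"
          using that forms_mono[OF subset_refl B] by blast
        then have "sat M' (\<lambda>_. b) \<xi> \<longleftrightarrow> \<xi> \<in> q" unfolding b[symmetric] by (rule mem_tp1[symmetric])
        also have "\<dots> \<longleftrightarrow> sat M (\<lambda>_. d) \<xi>"
          using tpd \<xi> mem_tp1[OF \<xi>, of d] unfolding B_def by blast
        also have "\<dots> \<longleftrightarrow> sat M' (\<lambda>_. d) \<xi>" by (rule sat_sub[OF \<xi> d, symmetric])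
        finally show ?thesis .
      qed
      \<comment> \<open>If \<open>b\<close> already lies in \<open>B\<close>, then \<open>x = b\<close> belongs to its type over \<open>B\<close>, so \<open>d = b\<close>.\<close>
      let ?h = "(\<lambda>u. u)(b := d)"
      have fixed: "?h u = u" if "u \<in> B" for u
      proof (cases "u = b")
        case True
        have "Eq (Var x) (Par b) \<in> forms L M' {x} B"
          using ab that True by (auto simp: forms_def intro!: exI[of _ "fst x"] has_sort.intros)
        then show ?thesis using agree[of "Eq (Var x) (Par b)"] True by simp
      qed simp
      have bM': "rshift m x b \<theta> \<in> forms L M' {x} (insert b (points M))"
        by (rule rshift_forms[OF G \<theta>' ab(2)])
      then have bM'': "rshift m x b \<theta> \<in> forms L M' {x} (points M')"
        using forms_points[OF bM'] by (auto simp: forms_def)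
      have "\<theta> \<in> forms L M' {x} (params \<theta>)" using \<theta>' by (rule forms_params)
      from rshift_forms[OF G this ab(2)] have par: "A \<union> params (rshift m x b \<theta>) \<subseteq> insert b B"
        by (auto simp: forms_def B_def)
      have "elem_map L M' M' (insert b B) ?h"
        by (rule elem_map_insert[OF elem_map_id[OF struc(2)] struc(2) ab(2) d'])
          (use agree in \<open>simp add: par_id\<close>)
      then have h: "elem_map L M' M' (A \<union> params (rshift m x b \<theta>)) ?h"
        by (rule elem_map_mono[OF _ par])
      have "\<theta> \<in> r \<longleftrightarrow> sat M' (\<lambda>_. fun_int M' m [a, b]) \<theta>"
        unfolding r by (rule mem_tp1[OF \<theta>'])
      also have "\<dots> \<longleftrightarrow> sat M' (\<lambda>_. a) (rshift m x b \<theta>)"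
        unfolding sat_rshift by (rule sat_forms_cong[OF \<theta>']) simp
      also have "\<dots> \<longleftrightarrow> rshift m x b \<theta> \<in> p'"
        using mem_tp1[OF bM', of a] a bM' by blast
      also have "\<dots> \<longleftrightarrow> move (\<lambda>u. u) (rshift m x b \<theta>) \<in> p'" by (simp add: par_id)
      also have "\<dots> \<longleftrightarrow> move ?h (rshift m x b \<theta>) \<in> p'"
        by (rule invariant_type_move[OF p'(1,3) _ struc(2) struc(2) subset_refl bM''
              elem_map_id[OF struc(2)] _ h fixed]) (use A' points_sub in \<open>auto simp: B_def\<close>)
      also have "move ?h (rshift m x b \<theta>) = rshift m x d \<theta>"
        using move_fixed[of \<theta> ?h] fixed by (simp add: move_rshift B_def)
      also have "rshift m x d \<theta> \<in> p' \<longleftrightarrow> rshift m x d \<theta> \<in> p"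
      proof -
        have "rshift m x d \<theta> \<in> forms L M {x} (points M)"
          using rshift_forms[OF G \<theta> d] univ_points[OF d] by (simp add: insert_absorb)
        moreover from this have "rshift m x d \<theta> \<in> forms L M' {x} (points M')"
          using forms forms_mono[OF subset_refl points_sub, of L M' "{x}"] by blast
        ultimately show ?thesis using types_Neg[OF p] types_Neg[OF p'(1)] p'(2) by blast
      qed
      finally show "\<theta> \<in> r \<longleftrightarrow> rshift m x d \<theta> \<in> p" .
    qed
  qed
qed

lemma is_type_prod_over_ex:
  assumes A: "small_model \<kappa> L M A"
    and p: "p \<in> types L M {x} (points M)" "invariant_type L M x A p"
    and q: "q \<in> types L M {x} (points M)" "invariant_type L M x A q"
  shows "\<exists>r. is_type_prod_over A m x p q r"
proof -
  have A': "A \<subseteq> points M" "|A| <o \<kappa>" using A by (simp_all add: small_model_def)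
  obtain b where b: "b \<in> univ M' (fst x)" "tp1 L M' x (points M) b = q \<inter> forms L M' {x} (points M)"
    by (rule realize[OF M' types_superstructure[OF sub q(1)] subset_refl points_sub small])
  have bq: "tp1 L M' x (points M) b = q"
    using b(2) typesD(1)[OF q(1)] elem_sub_forms[OF sub subset_refl, of "{x}"] by simp blast
  have "|insert b (points M)| <o \<kappa>'"
    using small_Un[OF M' small_finite[OF M', of "{b}"] small] by simp
  moreover have "insert b (points M) \<subseteq> points M'"
    using univ_points[OF b(1)] points_sub by simp
  ultimately obtain a where a: "a \<in> univ M' (fst x)"
    "tp1 L M' x (insert b (points M)) a = inv_ext x A p \<inter> forms L M' {x} (insert b (points M))"
    using realize[OF M' inv_ext_types[OF A' p], of "insert b (points M)"] by metis
  show ?thesis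
    unfolding is_type_prod_over_def
    by (rule exI[of _ "tp1 L M' x (points M) (fun_int M' m [a, b])"],
        rule exI[of _ "inv_ext x A p"], rule exI[of _ a], rule exI[of _ b])
      (intro conjI A p(2) q(2) a b(1) bq refl inv_ext_types[OF A' p] inv_ext_superset[OF A' p]
        inv_ext_invariant[OF A' p])
qed

text \<open>The choice of the base, the invariant extension and the realizations in \<open>is_type_prod\<close> is
  irrelevant: two candidates with bases \<open>A1\<close> and \<open>A2\<close> are compared through a realization of \<open>q\<close> in \<open>M\<close> over
  \<open>A1 \<union> A2\<close> and the parameters of the formula. So the definite description denotes a product.\<close>
lemma type_prod_mem:
  assumes A: "small_model \<kappa> L M A"
    and p: "p \<in> types L M {x} (points M)" "invariant_type L M x A p"
    and q: "q \<in> types L M {x} (points M)" "invariant_type L M x A q"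
    and G: "expands_group L m (fst x) M"
    and \<theta>: "\<theta> \<in> forms L M {x} (points M)" and d: "d \<in> univ M (fst x)"
      "tp1 L M x (A \<union> params \<theta>) d = q \<inter> forms L M {x} (A \<union> params \<theta>)"
  shows "\<theta> \<in> type_prod \<kappa> L m M M' x p q \<longleftrightarrow> rshift m x d \<theta> \<in> p"
proof -
  obtain r where over: "is_type_prod_over A m x p q r"
    using is_type_prod_over_ex[OF A p q] by blast
  then have r: "is_type_prod \<kappa> L m M M' x p q r" using is_type_prod_iff by blast
  have sub: "r1 \<subseteq> r2"
    if r1: "is_type_prod \<kappa> L m M M' x p q r1" and r2: "is_type_prod \<kappa> L m M M' x p q r2" for r1 r2
  proof
    fix \<theta> assume "\<theta> \<in> r1"
    obtain A1 A2 where over12: "is_type_prod_over A1 m x p q r1" "is_type_prod_over A2 m x p q r2"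
      using r1 r2 is_type_prod_iff by blast
    have A1: "A1 \<subseteq> points M" "|A1| <o \<kappa>" "r1 \<subseteq> forms L M {x} (points M)"
      and 1: "\<forall>\<theta>\<in>forms L M {x} (points M). \<forall>d\<in>univ M (fst x).
        tp1 L M x (A1 \<union> params \<theta>) d = q \<inter> forms L M {x} (A1 \<union> params \<theta>) \<longrightarrow>
        (\<theta> \<in> r1 \<longleftrightarrow> rshift m x d \<theta> \<in> p)"
      using is_type_prod_over_mem[OF over12(1) p(1) G] by blast+
    have A2: "A2 \<subseteq> points M" "|A2| <o \<kappa>" "r2 \<subseteq> forms L M {x} (points M)"
      and 2: "\<forall>\<theta>\<in>forms L M {x} (points M). \<forall>d\<in>univ M (fst x).
        tp1 L M x (A2 \<union> params \<theta>) d = q \<inter> forms L M {x} (A2 \<union> params \<theta>) \<longrightarrow>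
        (\<theta> \<in> r2 \<longleftrightarrow> rshift m x d \<theta> \<in> p)"
      using is_type_prod_over_mem[OF over12(2) p(1) G] by blast+
    have \<theta>: "\<theta> \<in> forms L M {x} (points M)" using \<open>\<theta> \<in> r1\<close> A1(3) by blast
    let ?B = "A1 \<union> A2 \<union> params \<theta>"
    have B: "?B \<subseteq> points M" "|?B| <o \<kappa>"
      using A1 A2 forms_points[OF \<theta>]
      by (auto intro!: small_Un[OF M] intro: small_finite[OF M finite_params])
    obtain d where d: "d \<in> univ M (fst x)" "tp1 L M x ?B d = q \<inter> forms L M {x} ?B"
      by (rule realize[OF M q(1) B(1) B])
    have "\<theta> \<in> r1 \<longleftrightarrow> rshift m x d \<theta> \<in> p"
      by (rule 1[rule_format, OF \<theta> d(1) tp1_mono[OF d(2)]]) auto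
    moreover have "\<theta> \<in> r2 \<longleftrightarrow> rshift m x d \<theta> \<in> p"
      by (rule 2[rule_format, OF \<theta> d(1) tp1_mono[OF d(2)]]) auto
    ultimately show "\<theta> \<in> r2" using \<open>\<theta> \<in> r1\<close> by blast
  qed
  have "type_prod \<kappa> L m M M' x p q = r"
    unfolding type_prod_def
  proof (rule the_equality, rule r)
    show "r' = r" if "is_type_prod \<kappa> L m M M' x p q r'" for r'
      using sub[OF that r] sub[OF r that] by blast
  qed
  then show ?thesis using is_type_prod_over_mem[OF over p(1) G] \<theta> d by blast
qed

end

section \<open>Compactness\<close>

text \<open>The common core of all compactness arguments below. The sets \<open>F\<close> with \<open>pos F\<close> are those considered
  large; a maximal set of formulas all of whose finite subsets are large decides every formula, as
  otherwise two finite subsets would contradict \<open>split\<close>. Largeness will mean positive \<open>\<mu>\<close>-measure,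
  positive measure within a closed set, or the presence of types in the support at which a given
  function is almost maximal.\<close>
lemma complete_extension:
  assumes mono: "\<And>F F'. finite F \<Longrightarrow> F' \<subseteq> F \<Longrightarrow> pos F \<Longrightarrow> pos F'"
    and split: "\<And>F \<phi>. finite F \<Longrightarrow> F \<subseteq> forms L M V A \<Longrightarrow> \<phi> \<in> forms L M V A \<Longrightarrow> pos F \<Longrightarrow>
      pos (insert \<phi> F) \<or> pos (insert (Neg \<phi>) F)"
    and \<Gamma>: "\<Gamma> \<subseteq> forms L M V A" "\<And>F. finite F \<Longrightarrow> F \<subseteq> \<Gamma> \<Longrightarrow> pos F"
  obtains p where "\<Gamma> \<subseteq> p" "p \<subseteq> forms L M V A" "\<forall>\<phi>\<in>forms L M V A. \<phi> \<in> p \<or> Neg \<phi> \<in> p"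
    "\<forall>F. finite F \<longrightarrow> F \<subseteq> p \<longrightarrow> pos F"
proof -
  define \<A> where "\<A> = {p. \<Gamma> \<subseteq> p \<and> p \<subseteq> forms L M V A \<and> (\<forall>F. finite F \<longrightarrow> F \<subseteq> p \<longrightarrow> pos F)}"
  have "\<exists>p\<in>\<A>. \<forall>q\<in>\<A>. p \<subseteq> q \<longrightarrow> q = p"
  proof (rule subset_Zorn_nonempty)
    show "\<A> \<noteq> {}" using \<Gamma> by (auto simp: \<A>_def)
    fix \<C> assume \<C>: "\<C> \<noteq> {}" "subset.chain \<A> \<C>"
    have sub: "\<C> \<subseteq> \<A>" using \<C>(2) by (simp add: subset.chain_def)
    have "pos F" if F: "finite F" "F \<subseteq> \<Union>\<C>" for F
    proof -
      obtain p where p: "p \<in> \<C>" "F \<subseteq> p"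
        using finite_subset_Union_chain[OF F \<C>] by blast
      then have "p \<in> \<A>" using sub by blast
      then show ?thesis using F(1) p(2) by (simp add: \<A>_def)
    qed
    moreover have "\<Gamma> \<subseteq> \<Union>\<C>" "\<Union>\<C> \<subseteq> forms L M V A"
      using sub \<C>(1) unfolding \<A>_def by blast+
    ultimately show "\<Union>\<C> \<in> \<A>" by (simp add: \<A>_def)
  qed
  then obtain p where p: "p \<in> \<A>" and max: "\<And>q. q \<in> \<A> \<Longrightarrow> p \<subseteq> q \<Longrightarrow> q = p" by blast
  have p': "\<Gamma> \<subseteq> p" "p \<subseteq> forms L M V A" "\<And>F. finite F \<Longrightarrow> F \<subseteq> p \<Longrightarrow> pos F"
    using p by (auto simp: \<A>_def)
  have "\<phi> \<in> p \<or> Neg \<phi> \<in> p" if \<phi>: "\<phi> \<in> forms L M V A" for \<phi>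
  proof (rule ccontr)
    assume not: "\<not> (\<phi> \<in> p \<or> Neg \<phi> \<in> p)"
    have ex: "\<exists>F. finite F \<and> F \<subseteq> p \<and> \<not> pos (insert \<psi> F)" if \<psi>: "\<psi> \<in> {\<phi>, Neg \<phi>}" for \<psi>
    proof -
      \<comment> \<open>By maximality some finite set that uses \<open>\<psi>\<close> is not large.\<close>
      have "insert \<psi> p \<notin> \<A>" using max[of "insert \<psi> p"] \<psi> not by auto
      moreover have "\<psi> \<in> forms L M V A" using \<phi> \<psi> by auto
      ultimately obtain F where F: "finite F" "F \<subseteq> insert \<psi> p" "\<not> pos F"
        using p' by (auto simp: \<A>_def)
      have "\<not> pos (insert \<psi> (F - {\<psi>}))"
        using mono[of "insert \<psi> (F - {\<psi>})" F] F(1,3) by auto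
      then show ?thesis using F(1,2) by (intro exI[of _ "F - {\<psi>}"]) auto
    qed
    obtain F1 where F1: "finite F1" "F1 \<subseteq> p" "\<not> pos (insert \<phi> F1)" using ex[of \<phi>] by auto
    obtain F2 where F2: "finite F2" "F2 \<subseteq> p" "\<not> pos (insert (Neg \<phi>) F2)" using ex[of "Neg \<phi>"] by auto
    have F: "finite (F1 \<union> F2)" "F1 \<union> F2 \<subseteq> p" using F1 F2 by auto
    then have "F1 \<union> F2 \<subseteq> forms L M V A" using p'(2) by blast
    from split[OF F(1) this \<phi> p'(3)[OF F]] show False
    proof
      assume "pos (insert \<phi> (F1 \<union> F2))"
      then have "pos (insert \<phi> F1)" by (rule mono[rotated -1]) (use F in auto)
      then show False using F1 by blast
    next
      assume "pos (insert (Neg \<phi>) (F1 \<union> F2))"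
      then have "pos (insert (Neg \<phi>) F2)" by (rule mono[rotated -1]) (use F in auto)
      then show False using F2 by blast
    qed
  qed
  then show thesis using that[OF p'(1,2)] p'(3) by blast
qed

lemma tp_types: "e \<in> vals M \<Longrightarrow> tp L M V A e \<in> types L M V A"
  by (auto simp: types_def tp_def)

lemma topspace_type_space [simp]: "topspace (type_space L M V A) = types L M V A"
proof -
  have "Tru undefined \<in> p" if "p \<in> types L M V A" for p
    by (rule types_conseq[OF that, of "{}"]) auto
  then show ?thesis
    unfolding type_space_def by (auto intro!: bexI[of _ "Tru undefined"])
qed

lemma openin_type_space_basic:
  "\<phi> \<in> forms L M V A \<Longrightarrow> openin (type_space L M V A) {p \<in> types L M V A. \<phi> \<in> p}"
  unfolding type_space_def by (rule topology_generated_by_Basis) blast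

text \<open>The sets given by one formula form a base and not only a subbase, since types are closed under
  conjunction.\<close>
lemma type_space_nbhd:
  assumes "openin (type_space L M V A) U" "p \<in> U"
  obtains \<theta> where "\<theta> \<in> forms L M V A" "\<theta> \<in> p" "{q \<in> types L M V A. \<theta> \<in> q} \<subseteq> U"
proof -
  have "generate_topology_on ((\<lambda>\<phi>. {p \<in> types L M V A. \<phi> \<in> p}) ` forms L M V A) U"
    using assms(1) unfolding type_space_def openin_topology_generated_by_iff .
  then have "\<forall>p\<in>U. \<exists>\<theta>\<in>forms L M V A. \<theta> \<in> p \<and> p \<in> types L M V A \<and> {q \<in> types L M V A. \<theta> \<in> q} \<subseteq> U"
  proof induction
    case (Int U1 U2)
    show ?case
    proof
      fix p assume p: "p \<in> U1 \<inter> U2"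
      obtain \<theta>1 where 1: "\<theta>1 \<in> forms L M V A" "\<theta>1 \<in> p" "p \<in> types L M V A"
          "{q \<in> types L M V A. \<theta>1 \<in> q} \<subseteq> U1"
        using bspec[OF Int.IH(1), of p] p by blast
      obtain \<theta>2 where 2: "\<theta>2 \<in> forms L M V A" "\<theta>2 \<in> p" "{q \<in> types L M V A. \<theta>2 \<in> q} \<subseteq> U2"
        using bspec[OF Int.IH(2), of p] p by blast
      have "{q \<in> types L M V A. Conj \<theta>1 \<theta>2 \<in> q} \<subseteq> U1 \<inter> U2"
        using types_Conj[OF _ 1(1) 2(1)] 1(4) 2(3) by blast
      moreover have "Conj \<theta>1 \<theta>2 \<in> p" using types_Conj[OF 1(3) 1(1) 2(1)] 1(2) 2(2) by blast
      ultimately show "\<exists>\<theta>\<in>forms L M V A. \<theta> \<in> p \<and> p \<in> types L M V A \<and> {q \<in> types L M V A. \<theta> \<in> q} \<subseteq> U1 \<inter> U2"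
        using 1 2 forms_simps(2) by blast
    qed
  next
    case (UN K)
    show ?case
    proof
      fix p assume "p \<in> \<Union>K"
      then obtain k where k: "k \<in> K" "p \<in> k" by blast
      then show "\<exists>\<theta>\<in>forms L M V A. \<theta> \<in> p \<and> p \<in> types L M V A \<and> {q \<in> types L M V A. \<theta> \<in> q} \<subseteq> \<Union>K"
        using bspec[OF UN.IH[OF k(1)] k(2)] by blast
    qed
  qed auto
  then show thesis using assms(2) that by blast
qed

section \<open>Keisler measures and their supports\<close>

locale keisler =
  fixes L :: "('s, 'f, 'r) lang" and M :: "('s, 'f, 'r, 'u) struc" and x :: "'s var"
    and \<mu> :: "('s, 'f, 'r, 'u) form \<Rightarrow> real"
  assumes struc: "is_struc L M" and keisler: "keisler_measure L M x (points M) \<mu>"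
begin

abbreviation "Fm \<equiv> forms L M {x} (points M)"
abbreviation "S \<equiv> supp L M x (points M) \<mu>"

lemma Fm_sub: "\<phi> \<in> forms L M {x} B \<Longrightarrow> \<phi> \<in> Fm"
  using forms_points by (fastforce simp: forms_def)

lemma nonneg: "\<phi> \<in> Fm \<Longrightarrow> 0 \<le> \<mu> \<phi>"
  by (rule bspec[OF keisler[unfolded keisler_measure_def, THEN conjunct1]])

lemma valid:
  assumes "\<phi> \<in> Fm" "\<And>e. e \<in> vals M \<Longrightarrow> sat M e \<phi>"
  shows "\<mu> \<phi> = 1"
  by (rule keisler[unfolded keisler_measure_def, THEN conjunct2, THEN conjunct1,
        THEN bspec, THEN mp, OF assms(1)]) (rule ballI, rule assms(2))

lemma equiv:
  assumes "\<phi> \<in> Fm" "\<psi> \<in> Fm" "\<And>e. e \<in> vals M \<Longrightarrow> sat M e \<phi> \<longleftrightarrow> sat M e \<psi>"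
  shows "\<mu> \<phi> = \<mu> \<psi>"
  by (rule keisler[unfolded keisler_measure_def, THEN conjunct2, THEN conjunct2, THEN conjunct1,
        THEN bspec, THEN bspec, THEN mp, OF assms(1,2)]) (rule ballI, rule assms(3))

lemma add:
  assumes "\<phi> \<in> Fm" "\<psi> \<in> Fm" "\<And>e. e \<in> vals M \<Longrightarrow> \<not> (sat M e \<phi> \<and> sat M e \<psi>)"
  shows "\<mu> (Disj \<phi> \<psi>) = \<mu> \<phi> + \<mu> \<psi>"
  by (rule keisler[unfolded keisler_measure_def, THEN conjunct2, THEN conjunct2, THEN conjunct2,
        THEN bspec, THEN bspec, THEN mp, OF assms(1,2)]) (rule ballI, rule assms(3))

lemma diff:
  assumes "\<phi> \<in> Fm" "\<psi> \<in> Fm"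
  shows "\<mu> (Disj \<phi> \<psi>) = \<mu> \<phi> + \<mu> (Conj \<psi> (Neg \<phi>))"
proof -
  have "\<mu> (Disj \<phi> \<psi>) = \<mu> (Disj \<phi> (Conj \<psi> (Neg \<phi>)))"
    by (rule equiv) (use assms in auto)
  then show ?thesis using add[of \<phi> "Conj \<psi> (Neg \<phi>)"] assms by simp
qed

lemma mono:
  assumes "\<phi> \<in> Fm" "\<psi> \<in> Fm" "\<And>e. e \<in> vals M \<Longrightarrow> sat M e \<phi> \<Longrightarrow> sat M e \<psi>"
  shows "\<mu> \<phi> \<le> \<mu> \<psi>"
proof -
  have "\<mu> \<psi> = \<mu> (Disj \<phi> \<psi>)"
    by (rule equiv) (use assms in auto)
  then show ?thesis using diff[OF assms(1,2)] nonneg[of "Conj \<psi> (Neg \<phi>)"] assms(1,2) by simp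
qed

lemma le_1: "\<phi> \<in> Fm \<Longrightarrow> \<mu> \<phi> \<le> 1"
  using mono[of \<phi> "Tru x"] valid[of "Tru x"] by simp

lemma null_Disj:
  assumes "\<phi> \<in> Fm" "\<psi> \<in> Fm" "\<mu> \<phi> = 0" "\<mu> \<psi> = 0"
  shows "\<mu> (Disj \<phi> \<psi>) = 0"
proof -
  have "\<mu> (Conj \<psi> (Neg \<phi>)) \<le> \<mu> \<psi>" by (rule mono) (use assms in auto)
  then show ?thesis using diff[OF assms(1,2)] nonneg[of "Conj \<psi> (Neg \<phi>)"] assms by simp
qed

lemma null_False: "\<mu> (Neg (Tru x)) = 0"
proof -
  have "\<mu> (Disj (Tru x) (Neg (Tru x))) = \<mu> (Tru x)" by (rule equiv) auto
  then show ?thesis using add[of "Tru x" "Neg (Tru x)"] by simp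
qed

text \<open>This says that the conjunction of \<open>F\<close> has positive measure, without naming the conjunction: no null
  formula follows from \<open>F\<close>.\<close>
definition pos :: "('s, 'f, 'r, 'u) form set \<Rightarrow> bool" where
  "pos F \<longleftrightarrow> \<not> (\<exists>\<theta>\<in>Fm. \<mu> \<theta> = 0 \<and> (\<forall>e\<in>vals M. (\<forall>\<phi>\<in>F. sat M e \<phi>) \<longrightarrow> sat M e \<theta>))"

lemma pos_single: "\<phi> \<in> Fm \<Longrightarrow> pos {\<phi>} \<Longrightarrow> 0 < \<mu> \<phi>"
  using nonneg[of \<phi>] by (fastforce simp: pos_def)

lemma pos_sat: "pos F \<Longrightarrow> \<exists>e\<in>vals M. \<forall>\<phi>\<in>F. sat M e \<phi>"
  using null_False forms_simps(3)[of x L M "{x}" "points M"] unfolding pos_def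
  by (metis forms_simps(1))

lemma supp_pos:
  assumes N: "N \<subseteq> points M" and q: "q \<in> supp L M x N \<mu>" and F: "finite F" "F \<subseteq> q"
  shows "pos F"
proof (rule ccontr)
  assume "\<not> pos F"
  then obtain \<theta> where \<theta>: "\<theta> \<in> Fm" "\<mu> \<theta> = 0"
    "\<And>e. e \<in> vals M \<Longrightarrow> (\<And>\<phi>. \<phi> \<in> F \<Longrightarrow> sat M e \<phi>) \<Longrightarrow> sat M e \<theta>" unfolding pos_def by blast
  have qt: "q \<in> types L M {x} N" using q by (simp add: supp_def)
  have "F \<subseteq> forms L M {x} N" using F(2) typesD(1)[OF qt] by blast
  then obtain \<psi> where \<psi>: "\<psi> \<in> forms L M {x} N" "\<And>(M1 :: ('s, 'f, 'r, 'u) struc) e. sat M1 e \<psi> \<longleftrightarrow> (\<forall>\<phi>\<in>F. sat M1 e \<phi>)"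
    using finite_conj_sat[OF F(1)] by metis
  have "\<psi> \<in> q" by (rule types_conseq[OF qt F \<psi>(1)]) (simp add: \<psi>(2))
  then have "0 < \<mu> \<psi>" using q by (simp add: supp_def)
  moreover have "\<mu> \<psi> \<le> \<mu> \<theta>"
    by (rule mono[OF Fm_sub[OF \<psi>(1)] \<theta>(1)]) (use \<theta>(3) \<psi>(2) in blast)
  ultimately show False using \<theta>(2) by simp
qed

text \<open>Positivity splits because the disjunction of two null formulas is null, and it implies
  satisfiability because the false formula is null.\<close>
lemma supp_extend:
  assumes "\<Gamma> \<subseteq> Fm" "\<And>F. finite F \<Longrightarrow> F \<subseteq> \<Gamma> \<Longrightarrow> pos F"
  obtains p where "p \<in> S" "\<Gamma> \<subseteq> p"
proof -
  have m: "pos F'" if "finite F" "F' \<subseteq> F" "pos F" for F F'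
    using that unfolding pos_def by blast
  have s: "pos (insert \<phi> F) \<or> pos (insert (Neg \<phi>) F)" if "finite F" "F \<subseteq> Fm" "\<phi> \<in> Fm" "pos F" for F \<phi>
  proof (rule ccontr)
    assume not: "\<not> (pos (insert \<phi> F) \<or> pos (insert (Neg \<phi>) F))"
    obtain \<theta>1 where 1: "\<theta>1 \<in> Fm" "\<mu> \<theta>1 = 0"
      "\<forall>e\<in>vals M. (\<forall>\<psi>\<in>insert \<phi> F. sat M e \<psi>) \<longrightarrow> sat M e \<theta>1" using not unfolding pos_def by blast
    obtain \<theta>2 where 2: "\<theta>2 \<in> Fm" "\<mu> \<theta>2 = 0"
      "\<forall>e\<in>vals M. (\<forall>\<psi>\<in>insert (Neg \<phi>) F. sat M e \<psi>) \<longrightarrow> sat M e \<theta>2" using not unfolding pos_def by blast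
    have "\<mu> (Disj \<theta>1 \<theta>2) = 0" by (rule null_Disj) (use 1 2 in auto)
    moreover have "Disj \<theta>1 \<theta>2 \<in> Fm" using 1 2 by simp
    moreover have "\<forall>e\<in>vals M. (\<forall>\<psi>\<in>F. sat M e \<psi>) \<longrightarrow> sat M e (Disj \<theta>1 \<theta>2)"
      using 1(3) 2(3) by auto
    ultimately show False using \<open>pos F\<close> unfolding pos_def by blast
  qed
  obtain p where p: "\<Gamma> \<subseteq> p" "p \<subseteq> Fm" "\<forall>\<phi>\<in>Fm. \<phi> \<in> p \<or> Neg \<phi> \<in> p" "\<forall>F. finite F \<longrightarrow> F \<subseteq> p \<longrightarrow> pos F"
    by (rule complete_extension[of pos, OF m s assms])
  have "0 < \<mu> \<phi>" if "\<phi> \<in> p" for \<phi>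
    using p(4)[rule_format, of "{\<phi>}"] p(2) pos_single[of \<phi>] that by auto
  moreover have "p \<in> types L M {x} (points M)"
    unfolding types_def using p pos_sat by blast
  ultimately have "p \<in> S" by (simp add: supp_def)
  then show thesis using that p(1) by blast
qed

lemma supp_lift:
  assumes N: "N \<subseteq> points M" and q: "q \<in> supp L M x N \<mu>"
  obtains p where "p \<in> S" "q \<subseteq> p" "p \<inter> forms L M {x} N = q"
proof -
  have qt: "q \<in> types L M {x} N" using q by (simp add: supp_def)
  have "q \<subseteq> Fm" using typesD(1)[OF qt] Fm_sub by blast
  then obtain p where p: "p \<in> S" "q \<subseteq> p"
    by (rule supp_extend) (use supp_pos[OF N q] in auto)
  have "p \<in> types L M {x} (points M)" using p by (simp add: supp_def)
  from types_eqI[OF qt types_restrict[OF this N]] have "q = p \<inter> forms L M {x} N"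
    using p(2) typesD(1)[OF qt] by blast
  then show thesis using that p by blast
qed

lemma supp_types: "p \<in> S \<Longrightarrow> p \<in> types L M {x} (points M)"
  by (simp add: supp_def)

lemma supp_restrict: "N \<subseteq> points M \<Longrightarrow> p \<in> S \<Longrightarrow> p \<inter> forms L M {x} N \<in> supp L M x N \<mu>"
  using types_restrict[of p L M "{x}" "points M" N] by (simp add: supp_def)

text \<open>An upper semicontinuous function on the compact set \<open>S(\<mu>) \<inter> {p. \<Gamma> \<subseteq> p}\<close> attains any bound \<open>r\<close> that it
  approaches on every basic neighbourhood of that set. For \<open>\<Gamma> = {}\<close> it yields a maximum; for \<open>\<Gamma>\<close> a type
  over a small model it gives control over the fibres of restriction.\<close>
lemma supp_attains:
  fixes h :: "('s, 'f, 'r, 'u) form set \<Rightarrow> real"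
  assumes usc: "\<And>p c. p \<in> S \<Longrightarrow> h p < c \<Longrightarrow> \<exists>\<theta>\<in>p. \<forall>p'\<in>S. \<theta> \<in> p' \<longrightarrow> h p' < c"
    and \<Gamma>: "\<Gamma> \<subseteq> Fm"
    and approx: "\<And>F c. finite F \<Longrightarrow> F \<subseteq> \<Gamma> \<Longrightarrow> c < r \<Longrightarrow> \<exists>p\<in>S. F \<subseteq> p \<and> c < h p"
  obtains p where "p \<in> S" "\<Gamma> \<subseteq> p" "r \<le> h p"
proof -
  define P where "P F \<longleftrightarrow> (\<forall>c<r. \<exists>p\<in>S. F \<subseteq> p \<and> c < h p)" for F
  have m: "P F'" if "finite F" "F' \<subseteq> F" "P F" for F F'
    using that unfolding P_def by (meson subset_trans)
  have s: "P (insert \<phi> F) \<or> P (insert (Neg \<phi>) F)" if "finite F" "F \<subseteq> Fm" "\<phi> \<in> Fm" "P F" for F \<phi>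
  proof (rule ccontr)
    assume "\<not> (P (insert \<phi> F) \<or> P (insert (Neg \<phi>) F))"
    then obtain c1 c2 where c1: "c1 < r" "\<And>p. p \<in> S \<Longrightarrow> insert \<phi> F \<subseteq> p \<Longrightarrow> h p \<le> c1"
      and c2: "c2 < r" "\<And>p. p \<in> S \<Longrightarrow> insert (Neg \<phi>) F \<subseteq> p \<Longrightarrow> h p \<le> c2"
      unfolding P_def by (meson not_le)
    obtain p where p: "p \<in> S" "F \<subseteq> p" "max c1 c2 < h p"
      using \<open>P F\<close> c1(1) c2(1) unfolding P_def by (metis max_less_iff_conj)
    have "\<phi> \<in> p \<or> Neg \<phi> \<in> p" using typesD(2)[OF supp_types[OF p(1)] \<open>\<phi> \<in> Fm\<close>] .
    then show False using c1(2)[OF p(1)] c2(2)[OF p(1)] p(2,3) by auto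
  qed
  have g: "P F" if "finite F" "F \<subseteq> \<Gamma>" for F
    using approx[OF that] by (auto simp: P_def)
  obtain p where p: "\<Gamma> \<subseteq> p" "p \<subseteq> Fm" "\<forall>\<phi>\<in>Fm. \<phi> \<in> p \<or> Neg \<phi> \<in> p" "\<forall>F. finite F \<longrightarrow> F \<subseteq> p \<longrightarrow> P F"
    by (rule complete_extension[of P, OF m s \<Gamma> g])
  have ex: "\<exists>p'\<in>S. F \<subseteq> p'" if "finite F" "F \<subseteq> p" for F
    using p(4)[rule_format, OF that] lt_ex[of r] unfolding P_def by blast
  have "\<exists>e\<in>vals M. \<forall>\<phi>\<in>F. sat M e \<phi>" if "F \<subseteq> p" "finite F" for F
    using ex[OF that(2,1)] typesD(3)[OF supp_types _ that(2)] by blast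
  then have "p \<in> types L M {x} (points M)"
    unfolding types_def using p(2,3) by blast
  moreover have "0 < \<mu> \<phi>" if "\<phi> \<in> p" for \<phi>
  proof -
    obtain p' where "p' \<in> S" "{\<phi>} \<subseteq> p'" using ex[of "{\<phi>}"] \<open>\<phi> \<in> p\<close> by blast
    then show ?thesis unfolding supp_def by blast
  qed
  ultimately have pS: "p \<in> S" unfolding supp_def by blast
  have "r \<le> h p"
  proof (rule ccontr)
    assume "\<not> r \<le> h p"
    then have "h p < r" by simp
    then obtain c where c: "h p < c" "c < r" using dense[of "h p" r] by blast
    obtain \<theta> where \<theta>: "\<theta> \<in> p" "\<And>p'. p' \<in> S \<Longrightarrow> \<theta> \<in> p' \<Longrightarrow> h p' < c" using usc[OF pS c(1)] by blast
    have "P {\<theta>}" using p(4) \<theta>(1) by simp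
    then obtain p' where "p' \<in> S" "{\<theta>} \<subseteq> p'" "c < h p'" using c(2) unfolding P_def by blast
    then show False using \<theta>(2)[of p'] by simp
  qed
  then show thesis using that pS p(1) by blast
qed

end

section \<open>Integration over the support\<close>

context keisler
begin

text \<open>A closed set of positive measure meets the support: a type all of whose finite subsets have
  positive measure within the set lies in the set, because it is closed, and contains no null formula.
  So the complement of the support has only null closed subsets, and it is null by regularity.\<close>
lemma support_full:
  assumes N: "N \<subseteq> points M" and P: "corresponds L M x N \<mu> P"
  shows "prob_space P" "supp L M x N \<mu> \<in> sets P" "measure P (supp L M x N \<mu>) = 1"
    "\<And>\<phi>. \<phi> \<in> forms L M {x} N \<Longrightarrow> {q \<in> types L M {x} N. \<phi> \<in> q} \<in> sets P"
proof -
  let ?X = "type_space L M {x} N" and ?S = "supp L M x N \<mu>" and ?FN = "forms L M {x} N"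
  let ?T = "types L M {x} N"
  have reg: "regular_borel_prob ?X P"
    and val: "\<And>\<phi>. \<phi> \<in> ?FN \<Longrightarrow> measure P {p \<in> ?T. \<phi> \<in> p} = \<mu> \<phi>"
    using P by (auto simp: corresponds_def)
  show prob: "prob_space P" using reg by (simp add: regular_borel_prob_def)
  interpret P: prob_space P by (rule prob)
  have space: "space P = ?T" and sets: "sets P = sets (borel_of ?X)"
    using reg by (simp_all add: regular_borel_prob_def)
  have "{U. openin ?X U} \<subseteq> Pow (topspace ?X)" using openin_subset by blast
  then have open_sets: "U \<in> sets P" if "openin ?X U" for U
    using that sets by (auto simp: borel_of_def)
  show basic: "{q \<in> ?T. \<phi> \<in> q} \<in> sets P" if "\<phi> \<in> ?FN" for \<phi>
    by (rule open_sets[OF openin_type_space_basic[OF that]])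
  have compl: "?T - ?S = (\<Union>\<phi>\<in>{\<phi> \<in> ?FN. \<mu> \<phi> = 0}. {q \<in> ?T. \<phi> \<in> q})"
  proof -
    have "\<mu> \<phi> = 0 \<longleftrightarrow> \<not> 0 < \<mu> \<phi>" if "\<phi> \<in> ?FN" for \<phi>
      using nonneg[OF Fm_sub[OF that]] by linarith
    then show ?thesis using typesD(1)[of _ L M "{x}" N] by (fastforce simp: supp_def)
  qed
  have "openin ?X (?T - ?S)"
    unfolding compl by (intro openin_Union) (auto intro: openin_type_space_basic)
  then have compl_sets: "?T - ?S \<in> sets P" by (rule open_sets)
  have "space P - (?T - ?S) = ?S" using space by (auto simp: supp_def)
  then show supp_sets: "?S \<in> sets P" using sets.compl_sets[OF compl_sets] by simp
  have closed_null: "measure P C = 0" if C: "closedin ?X C" "C \<subseteq> ?T - ?S" for C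
  proof (rule ccontr)
    assume "measure P C \<noteq> 0"
    then have posC: "0 < measure P C" by (simp add: zero_less_measure_iff)
    have "openin ?X (?T - C)" using C(1) by (simp add: closedin_def)
    then have "?T - C \<in> sets P" by (rule open_sets)
    moreover have "space P - (?T - C) = C" using C(2) space by auto
    ultimately have C_sets: "C \<in> sets P" using sets.compl_sets[of "?T - C" P] by simp
    define A where "A F = {q \<in> C. F \<subseteq> q}" for F :: "('s, 'f, 'r, 'u) form set"
    have A_insert: "A (insert \<phi> F) = A F \<inter> {q \<in> ?T. \<phi> \<in> q}" for \<phi> F
      using C(2) by (auto simp: A_def)
    have A_sets: "A F \<in> sets P" if "finite F" "F \<subseteq> ?FN" for F
      using that
    proof (induction F)
      case empty
      then show ?case using C_sets by (simp add: A_def)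
    next
      case (insert \<phi> F)
      then show ?case using basic[of \<phi>] by (auto simp: A_insert)
    qed
    define Q where "Q F \<longleftrightarrow> F \<subseteq> ?FN \<and> 0 < measure P (A F)" for F
    have m: "Q F'" if "finite F" "F' \<subseteq> F" "Q F" for F F'
    proof -
      have F': "finite F'" "F' \<subseteq> ?FN" using that finite_subset by (auto simp: Q_def)
      have "measure P (A F) \<le> measure P (A F')"
        by (rule P.finite_measure_mono[OF _ A_sets[OF F']]) (use that(2) in \<open>auto simp: A_def\<close>)
      then show ?thesis using that(3) F' by (auto simp: Q_def)
    qed
    have s: "Q (insert \<phi> F) \<or> Q (insert (Neg \<phi>) F)"
      if F: "finite F" "F \<subseteq> ?FN" and \<phi>: "\<phi> \<in> ?FN" and "Q F" for F \<phi>
    proof -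
      have "A F \<subseteq> A (insert \<phi> F) \<union> A (insert (Neg \<phi>) F)"
        using C(2) typesD(2)[OF _ \<phi>] unfolding A_insert by (auto simp: A_def)
      then have "measure P (A F) \<le> measure P (A (insert \<phi> F) \<union> A (insert (Neg \<phi>) F))"
        by (rule P.finite_measure_mono) (use A_sets[of "insert \<phi> F"] A_sets[of "insert (Neg \<phi>) F"] F \<phi> in auto)
      also have "\<dots> \<le> measure P (A (insert \<phi> F)) + measure P (A (insert (Neg \<phi>) F))"
        by (rule measure_Un_le) (use A_sets[of "insert \<phi> F"] A_sets[of "insert (Neg \<phi>) F"] F \<phi> in auto)
      finally have "0 < measure P (A (insert \<phi> F)) + measure P (A (insert (Neg \<phi>) F))"
        using \<open>Q F\<close> by (simp add: Q_def)
      then have "0 < measure P (A (insert \<phi> F)) \<or> 0 < measure P (A (insert (Neg \<phi>) F))"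
        by linarith
      then show ?thesis using F \<phi> by (auto simp: Q_def)
    qed
    have "Q {}" using posC by (simp add: Q_def A_def)
    then have g: "Q F" if "finite F" "F \<subseteq> {}" for F using that by simp
    obtain p where p: "{} \<subseteq> p" "p \<subseteq> ?FN" "\<forall>\<phi>\<in>?FN. \<phi> \<in> p \<or> Neg \<phi> \<in> p" "\<forall>F. finite F \<longrightarrow> F \<subseteq> p \<longrightarrow> Q F"
      by (rule complete_extension[of Q, OF m s empty_subsetI g])
    have ex: "\<exists>q\<in>C. F \<subseteq> q" if "finite F" "F \<subseteq> p" for F
    proof (rule ccontr)
      assume "\<not> (\<exists>q\<in>C. F \<subseteq> q)"
      then have "A F = {}" by (auto simp: A_def)
      then show False using p(4)[rule_format, OF that] by (simp add: Q_def)
    qed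
    have "\<exists>e\<in>vals M. \<forall>\<phi>\<in>F. sat M e \<phi>" if F: "F \<subseteq> p" "finite F" for F
    proof -
      obtain q where "q \<in> C" "F \<subseteq> q" using ex[OF F(2,1)] by blast
      then show ?thesis using C(2) typesD(3)[of q L M "{x}" N F] F(2) by blast
    qed
    then have pT: "p \<in> ?T" unfolding types_def using p(2,3) by blast
    have "p \<in> C"
    proof (rule ccontr)
      assume "p \<notin> C"
      then have "p \<in> ?T - C" using pT by simp
      with \<open>openin ?X (?T - C)\<close> obtain \<theta> where "\<theta> \<in> p" "{q \<in> ?T. \<theta> \<in> q} \<subseteq> ?T - C"
        by (rule type_space_nbhd)
      then show False using ex[of "{\<theta>}"] C(2) by blast
    qed
    then have "p \<in> ?T - ?S" using C(2) by blast
    then obtain \<phi> where \<phi>: "\<phi> \<in> ?FN" "\<mu> \<phi> = 0" "\<phi> \<in> p" unfolding compl by blast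
    have "measure P (A {\<phi>}) \<le> measure P {q \<in> ?T. \<phi> \<in> q}"
      by (rule P.finite_measure_mono[OF _ basic[OF \<phi>(1)]]) (use C(2) in \<open>auto simp: A_def\<close>)
    then show False using val[OF \<phi>(1)] \<phi>(2,3) p(4)[rule_format, of "{\<phi>}"] by (simp add: Q_def)
  qed
  have "measure P (?T - ?S) \<le> 0 + \<epsilon>" if \<epsilon>: "0 < \<epsilon>" for \<epsilon>
  proof -
    obtain C U where CU: "closedin ?X C" "openin ?X U" "C \<subseteq> ?T - ?S" "?T - ?S \<subseteq> U"
      "measure P (U - C) < \<epsilon>"
      using reg[unfolded regular_borel_prob_def, THEN conjunct2, THEN conjunct2, THEN conjunct2,
          rule_format, OF compl_sets \<epsilon>] by blast
    have "openin ?X (?T - C)" using CU(1) by (simp add: closedin_def)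
    then have "U \<inter> (?T - C) \<in> sets P" using open_sets CU(2) by blast
    moreover have "U \<inter> (?T - C) = U - C"
      using openin_subset[OF CU(2)] by auto
    ultimately have UC: "U - C \<in> sets P" by simp
    have "measure P (?T - ?S) \<le> measure P ((U - C) \<union> C)"
    proof (rule P.finite_measure_mono)
      have "U - C \<union> C = U" using CU(3,4) by auto
      then show "U - C \<union> C \<in> sets P" using open_sets[OF CU(2)] by simp
    qed (use CU in auto)
    also have "\<dots> \<le> measure P (U - C) + measure P C"
    proof (rule measure_Un_le[OF UC])
      have "space P - (?T - C) = C" using CU(3) space by auto
      then show "C \<in> sets P" using sets.compl_sets[OF open_sets[OF \<open>openin ?X (?T - C)\<close>]] by simp
    qed
    finally show ?thesis using closed_null[OF CU(1,3)] CU(5) by simp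
  qed
  then have "measure P (?T - ?S) \<le> 0" by (rule field_le_epsilon)
  then have "measure P (?T - ?S) = 0" using measure_nonneg[of P "?T - ?S"] by linarith
  moreover have "measure P (?T - ?S) = 1 - measure P ?S"
    using P.prob_compl[OF supp_sets] space by simp
  ultimately show "measure P ?S = 1" by simp
qed

lemma prob_space_support:
  assumes N: "N \<subseteq> points M" and P: "corresponds L M x N \<mu> P"
  shows "prob_space (restrict_space P (supp L M x N \<mu>))"
proof -
  let ?R = "restrict_space P (supp L M x N \<mu>)"
  note full = support_full[OF N P]
  interpret P: prob_space P by (rule full(1))
  have "emeasure ?R (space ?R) = 1"
    using full(2,3) by (simp add: emeasure_restrict_space P.emeasure_eq_measure)
  then show ?thesis by (rule prob_spaceI)
qed



text \<open>A function that is bounded by its own mean equals the mean almost everywhere, hence at some point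
  of every set of positive measure.\<close>
lemma integral_on_support:
  fixes r :: real
  assumes N: "N \<subseteq> points M" and P: "corresponds L M x N \<mu> P"
    and F: "F \<in> borel_of (subtopology (type_space L M {x} N) (supp L M x N \<mu>)) \<rightarrow>\<^sub>M borel"
    and bound: "\<And>q. q \<in> supp L M x N \<mu> \<Longrightarrow> 0 \<le> F q \<and> F q \<le> r"
    and int: "r \<le> (\<integral>q. F q \<partial>(restrict_space P (supp L M x N \<mu>)))"
    and \<theta>: "\<theta> \<in> forms L M {x} N" "0 < \<mu> \<theta>"
  obtains q where "q \<in> supp L M x N \<mu>" "\<theta> \<in> q" "F q = r"
proof -
  let ?X = "type_space L M {x} N" and ?S = "supp L M x N \<mu>"
  let ?R = "restrict_space P ?S"
  note full = support_full[OF N P]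
  interpret P: prob_space P by (rule full(1))
  have space: "space ?R = ?S" using full(2) by simp
  interpret R: prob_space ?R by (rule prob_space_support[OF N P])
  have setsP: "sets P = sets (borel_of ?X)"
    using P by (simp add: corresponds_def regular_borel_prob_def)
  have "sets (borel_of (subtopology ?X ?S)) \<subseteq> sets ?R"
  proof -
    have ST: "?S \<subseteq> topspace ?X" by (auto simp: supp_def)
    have open_sub: "{U. openin (subtopology ?X ?S) U} \<subseteq> sets ?R"
    proof
      fix U assume "U \<in> {U. openin (subtopology ?X ?S) U}"
      then obtain V where V: "openin ?X V" "U = V \<inter> ?S" by (auto simp: openin_subtopology)
      have "{U. openin ?X U} \<subseteq> Pow (topspace ?X)" using openin_subset by blast
      then have "V \<in> sets P" using V(1) setsP by (auto simp: borel_of_def)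
      then show "U \<in> sets ?R" using V(2) by (auto simp: sets_restrict_space)
    qed
    have top: "topspace (subtopology ?X ?S) = space ?R" using ST by (auto simp: space)
    have "{U. openin (subtopology ?X ?S) U} \<subseteq> Pow (topspace (subtopology ?X ?S))"
      using openin_subset by blast
    from sets_measure_of[OF this] show ?thesis
      unfolding borel_of_def using sets.sigma_sets_subset[OF open_sub] by (simp only: top)
  qed
  moreover have "space (borel_of (subtopology ?X ?S)) = space ?R"
    unfolding space by (auto simp: borel_of_def space_measure_of_conv supp_def)
  ultimately have "measurable (borel_of (subtopology ?X ?S)) borel \<subseteq> borel_measurable ?R"
    by (intro measurable_mono) simp_all
  then have meas: "F \<in> borel_measurable ?R" using F by blast
  have intF: "integrable ?R F"
    by (rule R.integrable_const_bound[of _ r]) (use bound space in \<open>auto intro!: AE_I2 meas\<close>)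
  have "integral\<^sup>L ?R (\<lambda>q. r - F q) = r - integral\<^sup>L ?R F"
    using intF by (simp add: R.prob_space)
  moreover have "0 \<le> integral\<^sup>L ?R (\<lambda>q. r - F q)"
    by (rule integral_nonneg_AE) (use bound space in \<open>auto intro!: AE_I2\<close>)
  ultimately have "integral\<^sup>L ?R (\<lambda>q. r - F q) = 0" using int by linarith
  moreover have "integrable ?R (\<lambda>q. r - F q)" using intF by simp
  moreover have "AE q in ?R. 0 \<le> r - F q" using bound space by (auto intro!: AE_I2)
  ultimately have ae: "AE q in ?R. r - F q = 0"
    using integral_nonneg_eq_0_iff_AE by blast
  show thesis
  proof (rule ccontr)
    assume not: "\<not> thesis"
    have "AE q in ?R. \<theta> \<notin> q"
      using ae by (rule AE_mp) (use that not space in \<open>auto intro!: AE_I2\<close>)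
    then have "AE q in P. q \<in> ?S \<longrightarrow> \<theta> \<notin> q"
      using full(2) by (subst (asm) AE_restrict_space_iff) auto
    moreover have "AE q in P. q \<in> ?S"
      using full(2,3) P.prob_eq_1 by blast
    ultimately have "AE q in P. \<not> (q \<in> {q \<in> types L M {x} N. \<theta> \<in> q})"
      by eventually_elim auto
    then have "measure P {q \<in> types L M {x} N. \<theta> \<in> q} = 0"
      using P.prob_eq_0[OF full(4)[OF \<theta>(1)]] by blast
    then show False using P \<theta> by (simp add: corresponds_def)
  qed
qed

end

section \<open>Translates\<close>

locale idempotent_setting = monster_pair \<kappa> \<kappa>' L M M' + keisler L M x \<mu>
  for \<kappa> :: "'k rel" and \<kappa>' :: "'l rel" and L :: "('s, 'f, 'r) lang"
    and M M' :: "('s, 'f, 'r, 'u) struc" and x :: "'s var"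
    and \<mu> :: "('s, 'f, 'r, 'u) form \<Rightarrow> real" +
  fixes m :: 'f and G :: "'u set"
  assumes group: "expands_group L m (fst x) M"
    and G: "small_model \<kappa> L M G" and def_G: "definable_over L M x \<mu> G"
begin

abbreviation times :: "'u \<Rightarrow> 'u \<Rightarrow> 'u" where "times a b \<equiv> fun_int M m [a, b]"

abbreviation dom :: "'u set" where "dom \<equiv> univ M (fst x)"

lemma G_points: "G \<subseteq> points M" and G_small: "|G| <o \<kappa>"
  using G by (simp_all add: small_model_def)

lemma times_closed: "a \<in> dom \<Longrightarrow> b \<in> dom \<Longrightarrow> times a b \<in> dom"
  and times_assoc: "a \<in> dom \<Longrightarrow> b \<in> dom \<Longrightarrow> c \<in> dom \<Longrightarrow> times (times a b) c = times a (times b c)"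
proof -
  obtain e where "Group.group \<lparr>carrier = dom, mult = times, one = e\<rparr>"
    using group by (auto simp: expands_group_def)
  then interpret group "\<lparr>carrier = dom, mult = times, one = e\<rparr>" .
  show "a \<in> dom \<Longrightarrow> b \<in> dom \<Longrightarrow> times a b \<in> dom" using m_closed by simp
  show "a \<in> dom \<Longrightarrow> b \<in> dom \<Longrightarrow> c \<in> dom \<Longrightarrow> times (times a b) c = times a (times b c)"
    using m_assoc by simp
qed

lemma rshift_Fm: "\<phi> \<in> Fm \<Longrightarrow> d \<in> dom \<Longrightarrow> rshift m x d \<phi> \<in> Fm"
  by (rule Fm_sub[OF rshift_forms[OF group]])

text \<open>Upper semicontinuity of \<open>d \<mapsto> \<mu>(\<phi>(x \<cdot> d))\<close> with respect to types over \<open>G\<close> and the parameters of \<open>\<phi>\<close>.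
  It comes from definability of \<open>\<mu>\<close>, applied to a formula \<open>\<Theta>(x; y, z)\<close> that expresses \<open>\<psi>(x \<cdot> y; z)\<close>.
  Since bound variables are not renamed, \<open>\<psi>\<close> is not substituted into; \<open>\<Theta>\<close> stores the product in a new
  variable \<open>w\<close> and rebinds \<open>x\<close> to it. The neighbourhood found in the variables \<open>y, z\<close> is brought back to \<open>x\<close>
  by the same device.\<close>
lemma rshift_usc:
  assumes \<phi>: "\<phi> \<in> Fm" and d: "d \<in> dom" and c: "\<mu> (rshift m x d \<phi>) < c"
  shows "\<exists>\<theta>\<in>forms L M {x} (G \<union> params \<phi>). sat M (\<lambda>_. d) \<theta> \<and>
    (\<forall>d'\<in>dom. sat M (\<lambda>_. d') \<theta> \<longrightarrow> \<mu> (rshift m x d' \<phi>) < c)"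
proof -
  define y :: "'s var" where "y = (fst x, Suc (snd x))"
  define w :: "'s var" where "w = (fst x, Suc (Suc (snd x)))"
  have yw: "y \<noteq> x" "w \<noteq> x" "w \<noteq> y" "fst y = fst x" "fst w = fst x"
    by (auto simp: y_def w_def prod_eq_iff)
  have wf: "wf_form L M \<phi>" and fvx: "fv \<phi> \<subseteq> {x}" using \<phi> by (auto simp: forms_def)
  obtain Z \<psi> b where Z: "finite Z" "Z \<inter> {x, y, w} = {}" "Z \<inter> fv \<phi> = {}"
    and b: "b \<in> vals M" "b ` Z = params \<phi>" and \<psi>: "\<psi> \<in> forms L M (fv \<phi> \<union> Z) {}"
    and sat: "\<forall>M1 h e. sat M1 e (move h \<phi>) \<longleftrightarrow> sat M1 (\<lambda>v. if v \<in> Z then h (b v) else e v) \<psi>"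
    by (rule abstract_params[OF wf struc(1), of "{x, y, w}"]) simp
  have \<psi>x: "\<psi> \<in> forms L M (insert x Z) {}"
    by (rule forms_mono[THEN subsetD, OF _ _ \<psi>]) (use fvx in auto)
  have sat_\<phi>: "sat M e \<phi> \<longleftrightarrow> sat M (\<lambda>v. if v \<in> Z then b v else e v) \<psi>" for e
    using sat[rule_format, of M e "\<lambda>u. u"] by (simp add: par_id)
  let ?xy = "App m [Var x, Var y]"
  define \<Theta> where "\<Theta> = All w (Neg (Conj (Eq (Var w) ?xy)
      (Neg (All x (Neg (Conj (Eq (Var x) (Var w)) (Neg \<psi>)))))))"
  have \<Theta>: "\<Theta> \<in> forms L M (insert x (insert y Z)) G"
  proof -
    have m: "m \<in> funs L" "fun_dom L m = [fst x, fst x]" "fun_cod L m = fst x"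
      using group by (auto simp: expands_group_def)
    have v: "has_sort L M (Var x) (fst x)" "has_sort L M (Var y) (fst x)" "has_sort L M (Var w) (fst x)"
      using has_sort.intros(1)[of L M x] has_sort.intros(1)[of L M y] has_sort.intros(1)[of L M w] yw
      by simp_all
    have "has_sort L M ?xy (fst x)"
      using has_sort.intros(3)[OF m(1), where ts = "[Var x, Var y]" and M = M] v m by simp
    then show ?thesis
      using \<psi>x v Z(2) yw by (auto simp: \<Theta>_def forms_def)
  qed
  have sat_\<Theta>: "sat M e \<Theta> \<longleftrightarrow> sat M (e(x := times (e x) (e y))) \<psi>" if e: "e \<in> vals M" for e
  proof -
    let ?t = "times (e x) (e y)"
    have t: "?t \<in> dom"
      using times_closed[of "e x" "e y"] vals_univ[OF e, of x] vals_univ[OF e, of y] yw by simp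
    have "sat M e \<Theta> \<longleftrightarrow> sat M (e(w := ?t, x := ?t)) \<psi>"
      using t yw by (auto simp: \<Theta>_def fun_upd_def)
    also have "\<dots> \<longleftrightarrow> sat M (e(x := ?t)) \<psi>"
      by (rule sat_forms_cong[OF \<psi>x]) (use Z(2) yw in auto)
    finally show ?thesis .
  qed
  let ?Y = "insert y Z"
  have bd: "b(y := d') \<in> vals M" if "d' \<in> dom" for d'
    by (rule vals_upd[OF b(1)]) (simp add: that yw)
  obtain F where F: "continuous_map (type_space L M ?Y G) (top_of_set {0..1}) F"
    and F_eq: "\<And>b. b \<in> vals M \<Longrightarrow> \<mu> (plug ?Y b \<Theta>) = F (tp L M ?Y G b)"
    using def_G[unfolded definable_over_def, rule_format, of ?Y \<Theta>] \<Theta> Z(1,2) yw(1) by auto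
  have shift: "\<mu> (rshift m x d' \<phi>) = F (tp L M ?Y G (b(y := d')))" if d': "d' \<in> dom" for d'
  proof -
    have "plug ?Y (b(y := d')) \<Theta> \<in> forms L M (insert x ?Y - ?Y) (G \<union> (b(y := d')) ` (insert x ?Y \<inter> ?Y))"
      by (rule plug_forms[OF _ bd[OF d']]) (use \<Theta> in auto)
    moreover have "insert x ?Y - ?Y = {x}" using Z(2) yw by auto
    ultimately have "plug ?Y (b(y := d')) \<Theta> \<in> Fm" using Fm_sub by simp
    moreover have "sat M e (rshift m x d' \<phi>) \<longleftrightarrow> sat M e (plug ?Y (b(y := d')) \<Theta>)" if e: "e \<in> vals M" for e
    proof -
      let ?e = "\<lambda>v. if v \<in> ?Y then (b(y := d')) v else e v"
      have e': "?e \<in> vals M"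
        by (rule valsI) (use vals_univ[OF bd[OF d']] vals_univ[OF e] in simp)
      have ex: "?e x = e x" "?e y = d'" using Z(2) yw by auto
      have "sat M e (plug ?Y (b(y := d')) \<Theta>) \<longleftrightarrow> sat M (?e(x := times (?e x) (?e y))) \<psi>"
        unfolding sat_plug by (rule sat_\<Theta>[OF e'])
      also have "\<dots> \<longleftrightarrow> sat M (\<lambda>v. if v \<in> Z then b v else (e(x := times (e x) d')) v) \<psi>"
        unfolding ex by (rule sat_forms_cong[OF \<psi>x]) (use Z(2) yw in auto)
      also have "\<dots> \<longleftrightarrow> sat M e (rshift m x d' \<phi>)"
        unfolding sat_rshift sat_\<phi> by (rule refl)
      finally show ?thesis by simp
    qed
    ultimately have "\<mu> (rshift m x d' \<phi>) = \<mu> (plug ?Y (b(y := d')) \<Theta>)"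
      by (intro equiv rshift_Fm[OF \<phi> d'])
    then show ?thesis using F_eq[OF bd[OF d']] by simp
  qed
  let ?U = "{p \<in> topspace (type_space L M ?Y G). F p \<in> {0..1} \<inter> {..<c}}"
  have "openin (type_space L M ?Y G) ?U"
    by (rule openin_continuous_map_preimage[OF F], rule openin_open_Int) simp
  moreover have "tp L M ?Y G (b(y := d)) \<in> ?U"
    using tp_types[OF bd[OF d]] F c unfolding shift[OF d] by (auto simp: continuous_map_def)
  ultimately obtain \<theta> where \<theta>: "\<theta> \<in> forms L M ?Y G" "\<theta> \<in> tp L M ?Y G (b(y := d))"
    "{q \<in> types L M ?Y G. \<theta> \<in> q} \<subseteq> ?U" by (rule type_space_nbhd)
  let ?\<theta> = "All y (Neg (Conj (Eq (Var y) (Var x)) (Neg (plug Z b \<theta>))))"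
  have "plug Z b \<theta> \<in> forms L M (?Y - Z) (G \<union> b ` (?Y \<inter> Z))" by (rule plug_forms[OF \<theta>(1) b(1)])
  moreover have "?Y - Z = {y}" "b ` (?Y \<inter> Z) = params \<phi>" using Z(2) b(2) by auto
  ultimately have "plug Z b \<theta> \<in> forms L M {y} (G \<union> params \<phi>)" by simp
  moreover have "has_sort L M (Var x) (fst x)" "has_sort L M (Var y) (fst x)"
    using has_sort.intros(1)[of L M x] has_sort.intros(1)[of L M y] yw by simp_all
  ultimately have "?\<theta> \<in> forms L M {x} (G \<union> params \<phi>)" by (auto simp: forms_def)
  moreover have sat_\<theta>: "sat M (\<lambda>_. d') ?\<theta> \<longleftrightarrow> sat M (b(y := d')) \<theta>" if d': "d' \<in> dom" for d'
  proof -
    have "sat M (\<lambda>_. d') ?\<theta> \<longleftrightarrow> sat M (\<lambda>v. if v \<in> Z then b v else d') \<theta>"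
      using d' yw by (auto simp: sat_plug fun_upd_idem cong: if_cong)
    also have "\<dots> \<longleftrightarrow> sat M (b(y := d')) \<theta>"
      by (rule sat_forms_cong[OF \<theta>(1)]) (use Z(2) in auto)
    finally show ?thesis .
  qed
  moreover have "sat M (\<lambda>_. d) ?\<theta>" unfolding sat_\<theta>[OF d] using \<theta>(2) by (simp add: tp_def)
  moreover have "\<mu> (rshift m x d' \<phi>) < c" if d': "d' \<in> dom" "sat M (\<lambda>_. d') ?\<theta>" for d'
  proof -
    have "\<theta> \<in> tp L M ?Y G (b(y := d'))" using d'(2) \<theta>(1) unfolding sat_\<theta>[OF d'(1)] by (simp add: tp_def)
    then have "tp L M ?Y G (b(y := d')) \<in> ?U" using \<theta>(3) tp_types[OF bd[OF d'(1)]] by blast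
    then show ?thesis unfolding shift[OF d'(1)] by simp
  qed
  ultimately show ?thesis by blast
qed

text \<open>Together with symmetry this says that \<open>\<mu>(\<phi>(x \<cdot> d))\<close> depends only on the type of \<open>d\<close>: in a pair of
  elements with equal types the larger value would violate the bound that semicontinuity gives for
  the smaller one.\<close>
lemma rshift_le:
  assumes \<phi>: "\<phi> \<in> Fm" and d: "d \<in> dom" "d' \<in> dom"
    and eq: "tp1 L M x (G \<union> params \<phi>) d = tp1 L M x (G \<union> params \<phi>) d'"
  shows "\<mu> (rshift m x d' \<phi>) \<le> \<mu> (rshift m x d \<phi>)"
proof (rule ccontr)
  assume "\<not> ?thesis"
  then have "\<mu> (rshift m x d \<phi>) < \<mu> (rshift m x d' \<phi>)" by simp
  from rshift_usc[OF \<phi> d(1) this] obtain \<theta> where \<theta>: "\<theta> \<in> forms L M {x} (G \<union> params \<phi>)"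
    "sat M (\<lambda>_. d) \<theta>" "\<forall>d''\<in>dom. sat M (\<lambda>_. d'') \<theta> \<longrightarrow> \<mu> (rshift m x d'' \<phi>) < \<mu> (rshift m x d' \<phi>)"
    by blast
  then have "sat M (\<lambda>_. d') \<theta>" using eq mem_tp1[OF \<theta>(1)] by blast
  then show False using \<theta>(3) d(2) by blast
qed

text \<open>\<open>val \<phi> p\<close> is \<open>\<mu>(\<phi>(x \<cdot> d))\<close> for any \<open>d\<close> realizing \<open>p\<close> over \<open>G\<close> and the parameters of \<open>\<phi>\<close>. As a function of
  \<open>p\<close> it is the integrand of the convolution, pulled back from \<open>S(\<mu>|\<^sub>N)\<close> to \<open>S(\<mu>)\<close>, which frees it from
  the choice of \<open>N\<close>.\<close>
definition val :: "('s, 'f, 'r, 'u) form \<Rightarrow> ('s, 'f, 'r, 'u) form set \<Rightarrow> real" where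
  "val \<phi> p = \<mu> (rshift m x (SOME d. d \<in> dom \<and>
     tp1 L M x (G \<union> params \<phi>) d = p \<inter> forms L M {x} (G \<union> params \<phi>)) \<phi>)"

lemma val_eq:
  assumes \<phi>: "\<phi> \<in> Fm" and d: "d \<in> dom"
    and B: "tp1 L M x B d = p \<inter> forms L M {x} B" "G \<union> params \<phi> \<subseteq> B"
  shows "val \<phi> p = \<mu> (rshift m x d \<phi>)"
proof -
  let ?P = "\<lambda>d. d \<in> dom \<and> tp1 L M x (G \<union> params \<phi>) d = p \<inter> forms L M {x} (G \<union> params \<phi>)"
  have d': "?P d" using d tp1_mono[OF B] by simp
  then have s: "?P (SOME d. ?P d)" by (rule someI)
  have "\<mu> (rshift m x (SOME d. ?P d) \<phi>) = \<mu> (rshift m x d \<phi>)"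
    by (rule antisym; rule rshift_le[OF \<phi>]) (use s d' in auto)
  then show ?thesis unfolding val_def .
qed

lemma small_params: "\<phi> \<in> Fm \<Longrightarrow> |G \<union> params \<phi>| <o \<kappa>" "\<phi> \<in> Fm \<Longrightarrow> G \<union> params \<phi> \<subseteq> points M"
  using small_Un[OF M G_small small_finite[OF M finite_params]] G_points forms_points
  by (blast, blast)

lemma val_bounds:
  assumes "\<phi> \<in> Fm" "p \<in> S"
  shows "0 \<le> val \<phi> p" "val \<phi> p \<le> 1"
proof -
  obtain d where d: "d \<in> dom" "tp1 L M x (G \<union> params \<phi>) d = p \<inter> forms L M {x} (G \<union> params \<phi>)"
    using realize[OF M supp_types[OF assms(2)] small_params(2)[OF assms(1)] small_params(2)[OF assms(1)]
        small_params(1)[OF assms(1)]] by metis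
  have "val \<phi> p = \<mu> (rshift m x d \<phi>)" by (rule val_eq[OF assms(1) d]) simp
  then show "0 \<le> val \<phi> p" "val \<phi> p \<le> 1"
    using nonneg le_1 rshift_Fm[OF assms(1) d(1)] by simp_all
qed

lemma val_usc:
  assumes \<phi>: "\<phi> \<in> Fm" and p: "p \<in> S" and c: "val \<phi> p < c"
  shows "\<exists>\<theta>\<in>p. \<forall>p'\<in>S. \<theta> \<in> p' \<longrightarrow> val \<phi> p' < c"
proof -
  let ?B = "G \<union> params \<phi>"
  note B = small_params[OF \<phi>]
  obtain d where d: "d \<in> dom" "tp1 L M x ?B d = p \<inter> forms L M {x} ?B"
    by (rule realize[OF M supp_types[OF p] B(2,2,1)])
  have "\<mu> (rshift m x d \<phi>) < c" using val_eq[OF \<phi> d subset_refl] c by simp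
  from rshift_usc[OF \<phi> d(1) this] obtain \<theta> where \<theta>: "\<theta> \<in> forms L M {x} ?B" "sat M (\<lambda>_. d) \<theta>"
    and lt: "\<forall>d'\<in>dom. sat M (\<lambda>_. d') \<theta> \<longrightarrow> \<mu> (rshift m x d' \<phi>) < c" by blast
  have "\<theta> \<in> p" using \<theta> d(2) mem_tp1[OF \<theta>(1)] by blast
  moreover have "val \<phi> p' < c" if p': "p' \<in> S" "\<theta> \<in> p'" for p'
  proof -
    obtain d' where d': "d' \<in> dom" "tp1 L M x ?B d' = p' \<inter> forms L M {x} ?B"
      by (rule realize[OF M supp_types[OF p'(1)] B(2,2,1)])
    have "sat M (\<lambda>_. d') \<theta>" using \<theta>(1) p'(2) d'(2) mem_tp1[OF \<theta>(1)] by blast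
    then show ?thesis using lt d'(1) val_eq[OF \<phi> d' subset_refl] by simp
  qed
  ultimately show ?thesis by blast
qed

section \<open>Idempotence\<close>

context
  fixes \<phi> :: "('s, 'f, 'r, 'u) form"
  assumes \<phi>: "\<phi> \<in> Fm" and conv: "has_convolution \<kappa> L m M x \<mu> \<mu> \<phi> (\<mu> \<phi>)"
begin

text \<open>The small model \<open>N\<close> and the integrand \<open>F\<close> come from the definition of the convolution, which leaves \<open>N\<close>
  unrelated to \<open>G\<close>. Realizing a type over \<open>N\<close> and \<open>G\<close> together identifies \<open>F\<close> with \<open>val \<phi>\<close>.\<close>
lemma convolution_on_support:
  obtains N F P where "N \<subseteq> points M" "corresponds L M x N \<mu> P"
    "F \<in> borel_of (subtopology (type_space L M {x} N) (supp L M x N \<mu>)) \<rightarrow>\<^sub>M borel"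
    "\<mu> \<phi> = (\<integral>q. F q \<partial>(restrict_space P (supp L M x N \<mu>)))"
    "\<forall>p\<in>S. F (p \<inter> forms L M {x} N) = val \<phi> p"
proof -
  obtain N F P where fib: "fibre_map \<kappa> L m M x \<mu> \<mu> \<phi> N F" and P: "corresponds L M x N \<mu> P"
    and int: "\<mu> \<phi> = (\<integral>q. F q \<partial>(restrict_space P (supp L M x N \<mu>)))"
    using conv unfolding has_convolution_def by blast
  have N: "N \<subseteq> points M" "|N| <o \<kappa>" using fib by (simp_all add: fibre_map_def small_model_def)
  have "F (p \<inter> forms L M {x} N) = val \<phi> p" if p: "p \<in> S" for p
  proof -
    let ?B = "N \<union> (G \<union> params \<phi>)"
    have B: "?B \<subseteq> points M" "|?B| <o \<kappa>"
      using N small_params[OF \<phi>] small_Un[OF M N(2)] by auto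
    obtain d where d: "d \<in> dom" "tp1 L M x ?B d = p \<inter> forms L M {x} ?B"
      by (rule realize[OF M supp_types[OF p] B(1,1,2)])
    have "tp1 L M x N d = p \<inter> forms L M {x} N" by (rule tp1_mono[OF d(2)]) simp
    then have "\<mu> (rshift m x d \<phi>) = F (p \<inter> forms L M {x} N)"
      using fib d(1) supp_restrict[OF N(1) p] unfolding fibre_map_def by blast
    then show ?thesis using val_eq[OF \<phi> d] by simp
  qed
  then show thesis using that[OF N(1) P _ int] fib unfolding fibre_map_def by blast
qed

text \<open>The integrand is at most its mean \<open>\<mu> \<phi>\<close>, so it equals \<open>\<mu> \<phi>\<close> almost everywhere, and everywhere on the
  support by continuity. Continuity is known for \<open>val \<phi>\<close> on \<open>S(\<mu>)\<close>, but only a Borel function \<open>F\<close> is given on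
  \<open>S(\<mu>|\<^sub>N)\<close>. It descends by compactness: \<open>val \<phi>\<close> is constant on the fibre over \<open>p|\<^sub>N\<close>, so if its value there
  is below \<open>\<mu> \<phi>\<close>, a single formula \<open>\<theta>\<close> over \<open>N\<close> in \<open>p\<close> keeps it below some \<open>c < \<mu> \<phi>\<close>; but \<open>\<theta>\<close> has positive
  measure.\<close>
lemma val_max:
  assumes le: "\<And>p. p \<in> S \<Longrightarrow> val \<phi> p \<le> \<mu> \<phi>" and p: "p \<in> S"
  shows "val \<phi> p = \<mu> \<phi>"
proof (rule ccontr)
  assume "val \<phi> p \<noteq> \<mu> \<phi>"
  then have less: "val \<phi> p < \<mu> \<phi>" using le[OF p] by simp
  obtain N F P where N: "N \<subseteq> points M" and P: "corresponds L M x N \<mu> P"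
    and meas: "F \<in> borel_of (subtopology (type_space L M {x} N) (supp L M x N \<mu>)) \<rightarrow>\<^sub>M borel"
    and int: "\<mu> \<phi> = (\<integral>q. F q \<partial>(restrict_space P (supp L M x N \<mu>)))"
    and F: "\<forall>p\<in>S. F (p \<inter> forms L M {x} N) = val \<phi> p"
    by (rule convolution_on_support)
  let ?q = "p \<inter> forms L M {x} N"
  have q: "?q \<in> supp L M x N \<mu>" by (rule supp_restrict[OF N p])
  then have qt: "?q \<in> types L M {x} N" by (simp add: supp_def)
  have "\<exists>E c. finite E \<and> E \<subseteq> ?q \<and> c < \<mu> \<phi> \<and> (\<forall>p'\<in>S. E \<subseteq> p' \<longrightarrow> val \<phi> p' \<le> c)"
  proof (rule ccontr)
    assume "\<not> ?thesis"
    then have approx: "\<exists>p'\<in>S. E \<subseteq> p' \<and> c < val \<phi> p'"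
      if "finite E" "E \<subseteq> ?q" "c < \<mu> \<phi>" for E c
      using that by (meson not_le)
    have qFm: "?q \<subseteq> Fm" using Fm_sub by blast
    obtain p' where p': "p' \<in> S" "?q \<subseteq> p'" "\<mu> \<phi> \<le> val \<phi> p'"
      by (rule supp_attains[OF val_usc[OF \<phi>] qFm approx])
    have "?q = p' \<inter> forms L M {x} N"
      by (rule types_eqI[OF qt types_restrict[OF supp_types[OF p'(1)] N]]) (use p'(2) in blast)
    then have "val \<phi> p' = val \<phi> p" using F p p'(1) by metis
    then show False using p'(3) less by simp
  qed
  then obtain E c where E: "finite E" "E \<subseteq> ?q" and c: "c < \<mu> \<phi>"
    and le_c: "\<And>p'. p' \<in> S \<Longrightarrow> E \<subseteq> p' \<Longrightarrow> val \<phi> p' \<le> c" by blast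
  have "E \<subseteq> forms L M {x} N" using E(2) by blast
  then obtain \<theta> where \<theta>: "\<theta> \<in> forms L M {x} N"
    and \<theta>_sat: "\<And>(M1 :: ('s, 'f, 'r, 'u) struc) e. sat M1 e \<theta> \<longleftrightarrow> (\<forall>\<psi>\<in>E. sat M1 e \<psi>)"
    using finite_conj_sat[OF E(1)] by metis
  have "\<theta> \<in> ?q" by (rule types_conseq[OF qt E \<theta>]) (simp add: \<theta>_sat)
  then have pos_\<theta>: "0 < \<mu> \<theta>" using q by (simp add: supp_def)
  have lift: "\<exists>p'\<in>S. F q' = val \<phi> p' \<and> q' \<subseteq> p'" if q': "q' \<in> supp L M x N \<mu>" for q'
  proof -
    obtain p' where "p' \<in> S" "q' \<subseteq> p'" "p' \<inter> forms L M {x} N = q'" by (rule supp_lift[OF N q'])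
    then show ?thesis using F by blast
  qed
  have bound: "0 \<le> F q' \<and> F q' \<le> \<mu> \<phi>" if "q' \<in> supp L M x N \<mu>" for q'
    using lift[OF that] val_bounds(1)[OF \<phi>] le by metis
  obtain q' where q': "q' \<in> supp L M x N \<mu>" "\<theta> \<in> q'" "F q' = \<mu> \<phi>"
    by (rule integral_on_support[OF N P meas bound eq_refl[OF int] \<theta> pos_\<theta>])
  obtain p' where p': "p' \<in> S" "F q' = val \<phi> p'" "q' \<subseteq> p'" using lift[OF q'(1)] by blast
  have "E \<subseteq> p'"
  proof
    fix \<psi> assume "\<psi> \<in> E"
    then have "\<psi> \<in> Fm" using E(2) Fm_sub by blast
    then show "\<psi> \<in> p'"
      by (rule types_conseq[OF supp_types[OF p'(1)], of "{\<theta>}", rotated 2])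
        (use \<open>\<psi> \<in> E\<close> \<theta>_sat p'(3) q'(2) in auto)
  qed
  then show False using le_c[OF p'(1)] p'(2) q'(3) c by simp
qed

lemma val_const:
  assumes const: "\<And>p. p \<in> S \<Longrightarrow> val \<phi> p = r"
  shows "\<mu> \<phi> = r"
proof -
  obtain N F P where N: "N \<subseteq> points M" and P: "corresponds L M x N \<mu> P"
    and meas: "F \<in> borel_of (subtopology (type_space L M {x} N) (supp L M x N \<mu>)) \<rightarrow>\<^sub>M borel"
    and int: "\<mu> \<phi> = (\<integral>q. F q \<partial>(restrict_space P (supp L M x N \<mu>)))"
    and F: "\<forall>p\<in>S. F (p \<inter> forms L M {x} N) = val \<phi> p"
    by (rule convolution_on_support)
  interpret R: prob_space "restrict_space P (supp L M x N \<mu>)" by (rule prob_space_support[OF N P])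
  have "F q = r" if q: "q \<in> supp L M x N \<mu>" for q
  proof -
    obtain p where "p \<in> S" "q \<subseteq> p" "p \<inter> forms L M {x} N = q" by (rule supp_lift[OF N q])
    then show ?thesis using F const by metis
  qed
  then have "(\<integral>q. F q \<partial>(restrict_space P (supp L M x N \<mu>))) = (\<integral>q. r \<partial>(restrict_space P (supp L M x N \<mu>)))"
    by (intro Bochner_Integration.integral_cong) (auto simp: space_restrict_space)
  then show ?thesis using int by (simp add: R.prob_space)
qed

end

section \<open>Minimality\<close>

text \<open>For \<open>b \<Turnstile> q\<close> and \<open>d \<Turnstile> p\<close> over enough parameters, \<open>b\<close> included, \<open>d \<cdot> b\<close> realizes \<open>p * q\<close>, and
  \<open>\<phi>(x \<cdot> (d \<cdot> b))\<close> is the translate by \<open>d\<close> of the formula \<open>\<phi>(x \<cdot> b)\<close>. The element \<open>b\<close> works for all \<open>p\<close> at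
  once.\<close>
lemma val_type_prod:
  assumes A: "small_model \<kappa> L M A" and inv: "\<forall>p\<in>S. invariant_type L M x A p"
    and \<phi>: "\<phi> \<in> Fm" and p: "p \<in> S" and q: "q \<in> S" and b: "b \<in> dom"
    and tpb: "tp1 L M x (A \<union> (G \<union> params \<phi>)) b = q \<inter> forms L M {x} (A \<union> (G \<union> params \<phi>))"
  shows "val \<phi> (type_prod \<kappa> L m M M' x p q) = val (rshift m x b \<phi>) p"
proof -
  let ?B = "G \<union> params \<phi>"
  let ?r = "type_prod \<kappa> L m M M' x p q"
  note pt = supp_types[OF p]
  have \<phi>b: "rshift m x b \<phi> \<in> Fm" by (rule rshift_Fm[OF \<phi> b])
  have "|insert b ?B| <o \<kappa>"
    using small_Un[OF M small_finite[OF M, of "{b}"] small_params(1)[OF \<phi>]] by simp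
  moreover have Bb: "insert b ?B \<subseteq> points M" using small_params(2)[OF \<phi>] univ_points[OF b] by simp
  ultimately obtain d where d: "d \<in> dom" "tp1 L M x (insert b ?B) d = p \<inter> forms L M {x} (insert b ?B)"
    using realize[OF M pt Bb Bb] by metis
  have par: "params (rshift m x b \<phi>) \<subseteq> insert b (params \<phi>)"
    using rshift_forms[OF group forms_params[OF \<phi>] b] by (simp add: forms_def)
  have tp_db: "tp1 L M x ?B (times d b) = ?r \<inter> forms L M {x} ?B"
  proof -
    have "\<theta> \<in> tp1 L M x ?B (times d b) \<longleftrightarrow> \<theta> \<in> ?r" if \<theta>: "\<theta> \<in> forms L M {x} ?B" for \<theta>
    proof -
      have \<theta>': "\<theta> \<in> Fm" by (rule Fm_sub[OF \<theta>])
      have "params \<theta> \<subseteq> ?B" using \<theta> by (simp add: forms_def)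
      then have "tp1 L M x (A \<union> params \<theta>) b = q \<inter> forms L M {x} (A \<union> params \<theta>)"
        by (intro tp1_mono[OF tpb]) auto
      then have "\<theta> \<in> ?r \<longleftrightarrow> rshift m x b \<theta> \<in> p"
        using type_prod_mem[OF A pt _ supp_types[OF q] _ group \<theta>' b] inv p q by blast
      also have "\<dots> \<longleftrightarrow> sat M (\<lambda>_. d) (rshift m x b \<theta>)"
      proof -
        have "rshift m x b \<theta> \<in> forms L M {x} (insert b ?B)" by (rule rshift_forms[OF group \<theta> b])
        then show ?thesis using d(2) mem_tp1[of "rshift m x b \<theta>" L M x "insert b ?B" d] by blast
      qed
      also have "\<dots> \<longleftrightarrow> sat M (\<lambda>_. times d b) \<theta>"
        unfolding sat_rshift by (rule sat_forms_cong[OF \<theta>]) simp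
      also have "\<dots> \<longleftrightarrow> \<theta> \<in> tp1 L M x ?B (times d b)" by (rule mem_tp1[OF \<theta>, symmetric])
      finally show ?thesis by simp
    qed
    then show ?thesis by (auto simp: tp_def)
  qed
  have "val \<phi> ?r = \<mu> (rshift m x (times d b) \<phi>)"
    by (rule val_eq[OF \<phi> times_closed[OF d(1) b] tp_db subset_refl])
  also have "\<dots> = \<mu> (rshift m x d (rshift m x b \<phi>))"
  proof (rule equiv[OF rshift_Fm[OF \<phi> times_closed[OF d(1) b]] rshift_Fm[OF \<phi>b d(1)]])
    fix e assume "e \<in> vals M"
    then have "e x \<in> dom" by (rule vals_univ)
    then show "sat M e (rshift m x (times d b) \<phi>) \<longleftrightarrow> sat M e (rshift m x d (rshift m x b \<phi>))"
      using times_assoc[OF _ d(1) b] by (simp add: sat_rshift)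
  qed
  also have "\<dots> = val (rshift m x b \<phi>) p"
    by (rule val_eq[OF \<phi>b d, symmetric]) (use par in auto)
  finally show ?thesis .
qed

text \<open>Let \<open>r\<close> be the maximum of \<open>val \<phi>\<close> and \<open>K\<close> the set where it is attained. For \<open>q \<in> K\<close>, realized by \<open>b\<close>, the
  function \<open>p \<mapsto> val \<phi> (p * q)\<close> is \<open>val\<close> of the formula \<open>\<phi>(x \<cdot> b)\<close>. It is bounded by \<open>r\<close>, which is also the
  measure of \<open>\<phi>(x \<cdot> b)\<close>, so it is constantly \<open>r\<close>. Hence \<open>K\<close> is a left ideal, \<open>K\<close> is the whole support,
  and \<open>\<mu> \<phi>\<close> is the integral of the constant \<open>r\<close>.\<close>
lemma right_invariance:
  assumes idem: "idempotent_measure \<kappa> L m M x \<mu>"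
    and invsupp: "invariantly_supported \<kappa> L M x \<mu>"
    and min: "minimal_measure \<kappa> L m M M' x \<mu>"
    and \<phi>: "\<phi> \<in> Fm" and a: "a \<in> dom"
    and tpa: "tp1 L M x (G \<union> params \<phi>) a \<in> supp L M x (G \<union> params \<phi>) \<mu>"
  shows "\<mu> \<phi> = \<mu> (rshift m x a \<phi>)"
proof -
  let ?op = "type_prod \<kappa> L m M M' x"
  have conv: "has_convolution \<kappa> L m M x \<mu> \<mu> \<psi> (\<mu> \<psi>)" if "\<psi> \<in> Fm" for \<psi>
    using idem that by (simp add: idempotent_measure_def)
  obtain A where A: "small_model \<kappa> L M A" and inv: "\<forall>p\<in>S. invariant_type L M x A p"
    using invsupp unfolding invariantly_supported_def by blast
  have A': "A \<subseteq> points M" "|A| <o \<kappa>" using A by (simp_all add: small_model_def)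
  have ideal: "S \<noteq> {}" "\<And>p q. p \<in> S \<Longrightarrow> q \<in> S \<Longrightarrow> ?op p q \<in> S"
    and minimal: "\<And>J. left_ideal S ?op J \<Longrightarrow> J \<subseteq> S \<Longrightarrow> J = S"
    using min unfolding minimal_measure_def minimal_left_ideal_def left_ideal_def by blast+
  define r where "r = (SUP p\<in>S. val \<phi> p)"
  have bdd: "bdd_above (val \<phi> ` S)" using val_bounds(2)[OF \<phi>] by (auto intro!: bdd_aboveI)
  have le_r: "val \<phi> p \<le> r" if "p \<in> S" for p
    unfolding r_def by (rule cSUP_upper[OF that bdd])
  have approx: "\<exists>p\<in>S. E \<subseteq> p \<and> c < val \<phi> p" if "finite E" "E \<subseteq> {}" "c < r" for E c
    using that less_cSUP_iff[OF ideal(1) bdd] by (auto simp: r_def)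
  obtain p0 where p0: "p0 \<in> S" "r \<le> val \<phi> p0"
    by (rule supp_attains[OF val_usc[OF \<phi>] empty_subsetI approx])
  define K where "K = {p \<in> S. val \<phi> p = r}"
  have "left_ideal S ?op K"
    unfolding left_ideal_def
  proof (intro conjI ballI)
    show "K \<noteq> {}" using p0 le_r[OF p0(1)] by (auto simp: K_def)
    show "K \<subseteq> S" by (auto simp: K_def)
    fix p q assume p: "p \<in> S" and "q \<in> K"
    then have q: "q \<in> S" "val \<phi> q = r" by (auto simp: K_def)
    let ?B = "A \<union> (G \<union> params \<phi>)"
    have B: "?B \<subseteq> points M" "|?B| <o \<kappa>"
      using A' small_params[OF \<phi>] small_Un[OF M] by auto
    obtain b where b: "b \<in> dom" "tp1 L M x ?B b = q \<inter> forms L M {x} ?B"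
      by (rule realize[OF M supp_types[OF q(1)] B(1,1,2)])
    let ?\<phi> = "rshift m x b \<phi>"
    have \<phi>b: "?\<phi> \<in> Fm" by (rule rshift_Fm[OF \<phi> b(1)])
    have prod: "val \<phi> (?op p' q) = val ?\<phi> p'" if "p' \<in> S" for p'
      by (rule val_type_prod[OF A inv \<phi> that q(1) b])
    have "\<mu> ?\<phi> = r" using val_eq[OF \<phi> b] q(2) by simp
    moreover have "val ?\<phi> p' \<le> r" if "p' \<in> S" for p'
      using le_r[OF ideal(2)[OF that q(1)]] prod[OF that] by simp
    ultimately have "val ?\<phi> p = r" using val_max[OF \<phi>b conv[OF \<phi>b] _ p] by simp
    then show "?op p q \<in> K" using prod[OF p] ideal(2)[OF p q(1)] by (simp add: K_def)
  qed
  then have "K = S" by (rule minimal) (auto simp: K_def)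
  then have const: "val \<phi> p = r" if "p \<in> S" for p using that by (auto simp: K_def)
  have "\<mu> \<phi> = r" by (rule val_const[OF \<phi> conv[OF \<phi>] const])
  moreover obtain p where p: "p \<in> S" "tp1 L M x (G \<union> params \<phi>) a \<subseteq> p"
      "p \<inter> forms L M {x} (G \<union> params \<phi>) = tp1 L M x (G \<union> params \<phi>) a"
    by (rule supp_lift[OF small_params(2)[OF \<phi>] tpa])
  moreover have "val \<phi> p = \<mu> (rshift m x a \<phi>)"
    by (rule val_eq[OF \<phi> a p(3)[symmetric] subset_refl])
  ultimately show ?thesis using const[OF p(1)] by simp
qed

end

theorem corollary4p16:
  fixes L :: "('s, 'f, 'r) lang" and m :: 'f and x :: "'s var"
    and T :: "('s, 'f, 'r, 'u) form set"
    and \<G> \<G>' :: "('s, 'f, 'r, 'u) struc" and \<kappa> :: "'k rel" and \<kappa>' :: "'l rel"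
    and \<mu> :: "('s, 'f, 'r, 'u) form \<Rightarrow> real"
    and G :: "'u set" and \<phi> :: "('s, 'f, 'r, 'u) form" and a :: 'u
  assumes "monster \<kappa> L \<G>"
    and "T \<subseteq> forms L \<G> {} {}" and "models \<G> T"
    and "expands_group L m (fst x) \<G>"
    and "monster \<kappa>' L \<G>'" and "elem_sub L \<G> \<G>'" and "|points \<G>| <o \<kappa>'"
    and "keisler_measure L \<G> x (points \<G>) \<mu>"
    and "definable \<kappa> L \<G> x \<mu>"
    and "invariantly_supported \<kappa> L \<G> x \<mu>"
    and "idempotent_measure \<kappa> L m \<G> x \<mu>"
    and "minimal_measure \<kappa> L m \<G> \<G>' x \<mu>"
    and "small_model \<kappa> L \<G> G" and "definable_over L \<G> x \<mu> G"
    and "\<phi> \<in> forms L \<G> {x} (points \<G>)"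
    and "a \<in> univ \<G> (fst x)"
    and "tp1 L \<G> x (G \<union> params \<phi>) a \<in> supp L \<G> x (G \<union> params \<phi>) \<mu>"
  shows "\<mu> \<phi> = \<mu> (rshift m x a \<phi>)"
proof -
  interpret idempotent_setting \<kappa> \<kappa>' L \<G> \<G>' x \<mu> m G
    using assms by unfold_locales (simp_all add: monster_def)
  show ?thesis
    by (rule right_invariance[OF assms(11,10,12,15,16,17)])
qed

end
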